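(* In the setting described in the context, let $Z=(X,Y,N)$ be the solution to $$X_t=X_0+\int_{0+}^t\int_{\mathbb{R}}h_\Lambda(X_{u-},Y_{u-},N_{u-},v)\,\wp(du,dv),$$ $$Y_t=Y_0+t-\int_{0+}^t (Y_{u-})\int_{\mathbb{R}}g_\Lambda(X_{u-},Y_{u-},N_{u-},v)\,\wp(du,dv),$$ $$N_t=\int_{0+}^t\int_{\mathbb{R}}g_\Lambda(X_{u-},Y_{u-},N_{u-},v)\,\wp(du,dv),\qquad t\ge0,$$ let $T_1<T_2<\cdots$ be the successive jump times of $X$, and let $i\in\mathcal{X}$, $y\in\mathbb{R}_+$ and $n\ge1$. Then the following hold. (i) $F(\cdot\mid i,n)$ is the conditional cumulative distribution function of the holding time of the process $X$ (after the $n$-th transition, given that the state is $i$), i.e. $P[T_{n+1}-T_n\le y\mid X_{T_n}=i]=F(y\mid i,n)$. (ii) For all $j\ne X_{T_n}$, $p_{X_{T_n}j}(T_{n+1}-T_n,n)=P[X_{T_{n+1}}=j\mid X_{T_n},\,T_{n+1}-T_n]$ almost surely.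
   Context: $(\Omega,\mathcal{F},\{\mathcal{F}_t\}_{t\ge0},P)$ is a filtered probability space satisfying the usual hypothesis; $\mathcal{X}=\{1,2,\dots\}$ is the state space, embedded in $\mathbb{R}$; $\mathbb{N}_0=\{0,1,2,\dots\}$, $\mathbb{R}_+=[0,\infty)$; $m_d$ is Lebesgue measure on $\mathbb{R}^d$. $\mathcal{X}$ is endowed with a total order $\prec_1$, which induces a total order $\prec_2$ on $\mathcal{X}_2:=\{(i,j)\in\mathcal{X}^2: i\ne j\}$ by the lexicographic order. For each $(i,j)\in\mathcal{X}_2$, $\lambda_{ij}:\mathbb{R}_+\times\mathbb{N}_0\to\mathbb{R}_+$ is a bounded measurable function; $\lambda_i(y,n):=\sum_{j\in\mathcal{X}\setminus\{i\}}\lambda_{ij}(y,n)$. These satisfy: (A1) with $c_i:=\sum_{j\in\mathcal{X}\setminus\{i\}}\|\lambda_{ij}\|_{L^\infty(\mathbb{R}_+\times\mathbb{N}_0)}$, one has $c:=\sup_i c_i<\infty$; (A2) for each $n\in\mathbb{N}_0$ and $i\in\mathcal{X}$, $\lim_{y\to\infty}\gamma_i(y,n)=\infty$, where $\gamma_i(y,n):=\int_0^y\lambda_i(y',n)\,dy'$. For each $(i,j)\in\mathcal{X}_2$, $\tilde\lambda_{ij}:\mathbb{R}_+\times\mathbb{N}_0\to\mathbb{R}_+$ is a measurable function such that $\lambda_{ij}(y,n)\le\tilde\lambda_{ij}(y,n)$ for each $y\in\mathbb{R}_+$, $n\in\mathbb{N}_0$, and $\tilde\lambda_{ij}(y,n)\le\|\lambda_{ij}\|_{L^\infty(\mathbb{R}_+\times\mathbb{N}_0)}$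 for almost every $y\in\mathbb{R}_+$ and $n\in\mathbb{N}_0$. For each $y,n$ a disjoint collection of intervals is defined by $$\Lambda_{ij}(y,n)=\Big(\sum_{(i',j')\prec_2(i,j)}\tilde\lambda_{i'j'}(y,n)\Big)+[0,\lambda_{ij}(y,n)),\qquad (i,j)\in\mathcal{X}_2,$$ where $a+B=\{a+b: b\in B\}$. The functions $h_\Lambda,g_\Lambda:\mathcal{X}\times\mathbb{R}_+\times\mathbb{N}_0\times\mathbb{R}\to\mathbb{R}$ are $$h_\Lambda(i,y,n,v):=\sum_{j\in\mathcal{X}\setminus\{i\}}(j-i)\mathbf{1}_{\Lambda_{ij}(y,n)}(v),\qquad g_\Lambda(i,y,n,v):=\sum_{j\in\mathcal{X}\setminus\{i\}}\mathbf{1}_{\Lambda_{ij}(y,n)}(v).$$ $\wp(du,dv)$ is a Poisson random measure on $\mathbb{R}_+\times\mathbb{R}$ with intensity $m_2(du,dv)$, defined on $(\Omega,\mathcal{F},P)$, and $\{\wp((0,t]\times dv)\}_{t\ge0}$ is adapted to $\{\mathcal{F}_t\}_{t\ge0}$. The initial values are $X_0\in\mathcal{X}$, $Y_0\in\mathbb{R}_+$, $N_0=0$. $\int_{0+}^t$ denotes integration over $(0,t]$. Transition parameters. For $i\in\mathcal{X}$, $n\in\mathbb{N}_0$, $y\in[0,\infty)$: $F(y\mid i,n):=1-e^{-\gamma_i(y,n)}$. For $y\in\mathbb{R}_+$, $n\in\mathbb{N}_0$: $p_{ij}(y,n):=\frac{\lambda_{ij}(y,n)}{\lambda_i(y,n)}\mathbf{1}_{(0,\infty)}(\lambda_i(y,n))$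 if $j\ne i$, and $p_{ii}(y,n):=\mathbf{1}_{\{0\}}(\lambda_i(y,n))$. *)

theory Defs
  imports "HOL-Probability.Probability"
begin

subsection \<open>States and transition rates\<close>

text \<open>States are positive naturals. Their embedding into the reals is the coercion
  \<^const>\<open>real\<close>.\<close>

definition states :: "nat set" where
  "states = {1..}"

definition state_pairs :: "(nat \<times> nat) set" where
  "state_pairs = {(i, j). i \<in> states \<and> j \<in> states \<and> i \<noteq> j}"

definition age_count_measure :: "(real \<times> nat) measure" where
  "age_count_measure = restrict_space lborel {0..} \<Otimes>\<^sub>M count_space UNIV"

definition Linf_norm :: "(real \<Rightarrow> nat \<Rightarrow> real) \<Rightarrow> ennreal" where
  "Linf_norm f = esssup age_count_measure (\<lambda>(y, n). ennreal \<bar>f y n\<bar>)"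

text \<open>In what follows, \<open>lam i j y n\<close> is the rate of the transition from \<open>i\<close> to \<open>j\<close> at age \<open>y\<close> after
  \<open>n\<close> transitions. The summability condition below implies that the sum defining \<open>exit_rate\<close>
  converges for every \<open>n\<close> and almost every \<open>y\<close>; on the exceptional null set, where the sum would be
  infinite, \<^const>\<open>infsum\<close> returns 0.\<close>

definition exit_rate :: "(nat \<Rightarrow> nat \<Rightarrow> real \<Rightarrow> nat \<Rightarrow> real) \<Rightarrow> nat \<Rightarrow> real \<Rightarrow> nat \<Rightarrow> real" where
  "exit_rate lam i y n = (\<Sum>\<^sub>\<infinity>j\<in>states - {i}. lam i j y n)"

definition cum_rate :: "(nat \<Rightarrow> nat \<Rightarrow> real \<Rightarrow> nat \<Rightarrow> real) \<Rightarrow> nat \<Rightarrow> real \<Rightarrow> nat \<Rightarrow> real" where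
  "cum_rate lam i y n = (LINT y':{0..y}|lborel. exit_rate lam i y' n)"

definition rates :: "(nat \<Rightarrow> nat \<Rightarrow> real \<Rightarrow> nat \<Rightarrow> real) \<Rightarrow> bool" where
  "rates lam \<longleftrightarrow> (\<forall>(i, j)\<in>state_pairs.
     (\<lambda>(y, n). lam i j y n) \<in> borel_measurable age_count_measure \<and>
     (\<forall>y\<ge>0. \<forall>n. 0 \<le> lam i j y n) \<and>
     (\<exists>K. \<forall>y\<ge>0. \<forall>n. lam i j y n \<le> K))"

definition rates_summable :: "(nat \<Rightarrow> nat \<Rightarrow> real \<Rightarrow> nat \<Rightarrow> real) \<Rightarrow> bool" where
  "rates_summable lam \<longleftrightarrow>
     (SUP i\<in>states. \<Sum>\<^sub>\<infinity>j\<in>states - {i}. Linf_norm (lam i j)) < \<infinity>"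

definition rates_diverge :: "(nat \<Rightarrow> nat \<Rightarrow> real \<Rightarrow> nat \<Rightarrow> real) \<Rightarrow> bool" where
  "rates_diverge lam \<longleftrightarrow>
     (\<forall>n. \<forall>i\<in>states. filterlim (\<lambda>y. cum_rate lam i y n) at_top at_top)"

definition rate_majorants ::
  "(nat \<Rightarrow> nat \<Rightarrow> real \<Rightarrow> nat \<Rightarrow> real) \<Rightarrow> (nat \<Rightarrow> nat \<Rightarrow> real \<Rightarrow> nat \<Rightarrow> real) \<Rightarrow> bool" where
  "rate_majorants lam lamt \<longleftrightarrow> (\<forall>(i, j)\<in>state_pairs.
     (\<lambda>(y, n). lamt i j y n) \<in> borel_measurable age_count_measure \<and>
     (\<forall>y\<ge>0. \<forall>n. lam i j y n \<le> lamt i j y n) \<and>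
     (AE (y, n) in age_count_measure. ennreal (lamt i j y n) \<le> Linf_norm (lam i j)))"

definition holding_cdf :: "(nat \<Rightarrow> nat \<Rightarrow> real \<Rightarrow> nat \<Rightarrow> real) \<Rightarrow> real \<Rightarrow> nat \<Rightarrow> nat \<Rightarrow> real" where
  "holding_cdf lam y i n = 1 - exp (- cum_rate lam i y n)"

definition trans_prob ::
  "(nat \<Rightarrow> nat \<Rightarrow> real \<Rightarrow> nat \<Rightarrow> real) \<Rightarrow> nat \<Rightarrow> nat \<Rightarrow> real \<Rightarrow> nat \<Rightarrow> real" where
  "trans_prob lam i j y n =
     (if j \<noteq> i then lam i j y n / exit_rate lam i y n * indicator {0<..} (exit_rate lam i y n)
      else indicator {0} (exit_rate lam i y n))"

subsection \<open>Intervals and coefficients\<close>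

text \<open>\<open>ord\<close> is the strict version of the given total order on the states, so \<open>ord <*lex*> ord\<close> is the
  induced strict order on pairs. The left endpoint of an interval is computed in the extended
  reals: for a general order the sum can have infinitely many terms. Where it is infinite, no real
  number belongs to the interval.\<close>

definition Lambda_start ::
  "(nat \<times> nat) set \<Rightarrow> (nat \<Rightarrow> nat \<Rightarrow> real \<Rightarrow> nat \<Rightarrow> real) \<Rightarrow> nat \<Rightarrow> nat \<Rightarrow> real \<Rightarrow> nat \<Rightarrow> ennreal" where
  "Lambda_start ord lamt i j y n =
     (\<Sum>\<^sub>\<infinity>(i', j') \<in> {p \<in> state_pairs. (p, (i, j)) \<in> ord <*lex*> ord}. ennreal (lamt i' j' y n))"

definition Lambda ::
  "(nat \<times> nat) set \<Rightarrow> (nat \<Rightarrow> nat \<Rightarrow> real \<Rightarrow> nat \<Rightarrow> real) \<Rightarrow> (nat \<Rightarrow> nat \<Rightarrow> real \<Rightarrow> nat \<Rightarrow> real)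
     \<Rightarrow> nat \<Rightarrow> nat \<Rightarrow> real \<Rightarrow> nat \<Rightarrow> real set" where
  "Lambda ord lam lamt i j y n =
     {v. \<exists>b\<in>{0..<lam i j y n}. ereal v = enn2ereal (Lambda_start ord lamt i j y n) + ereal b}"

text \<open>The intervals make sense as translates only where their left endpoints are finite. This is
  required for every \<open>n\<close> and almost every \<open>y\<close>. For the usual order of the naturals it follows
  from \<^const>\<open>rate_majorants\<close> and \<^const>\<open>rates_summable\<close>.\<close>

definition Lambda_well_defined ::
  "(nat \<times> nat) set \<Rightarrow> (nat \<Rightarrow> nat \<Rightarrow> real \<Rightarrow> nat \<Rightarrow> real) \<Rightarrow> bool" where
  "Lambda_well_defined ord lamt \<longleftrightarrow> (\<forall>(i, j)\<in>state_pairs.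
     AE (y, n) in age_count_measure. Lambda_start ord lamt i j y n < \<infinity>)"

definition h_Lambda ::
  "(nat \<times> nat) set \<Rightarrow> (nat \<Rightarrow> nat \<Rightarrow> real \<Rightarrow> nat \<Rightarrow> real) \<Rightarrow> (nat \<Rightarrow> nat \<Rightarrow> real \<Rightarrow> nat \<Rightarrow> real)
     \<Rightarrow> nat \<Rightarrow> real \<Rightarrow> nat \<Rightarrow> real \<Rightarrow> real" where
  "h_Lambda ord lam lamt i y n v =
     (\<Sum>\<^sub>\<infinity>j\<in>states - {i}. (real j - real i) * indicator (Lambda ord lam lamt i j y n) v)"

definition g_Lambda ::
  "(nat \<times> nat) set \<Rightarrow> (nat \<Rightarrow> nat \<Rightarrow> real \<Rightarrow> nat \<Rightarrow> real) \<Rightarrow> (nat \<Rightarrow> nat \<Rightarrow> real \<Rightarrow> nat \<Rightarrow> real)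
     \<Rightarrow> nat \<Rightarrow> real \<Rightarrow> nat \<Rightarrow> real \<Rightarrow> real" where
  "g_Lambda ord lam lamt i y n v =
     (\<Sum>\<^sub>\<infinity>j\<in>states - {i}. indicator (Lambda ord lam lamt i j y n) v)"

subsection \<open>Filtrations and Poisson random measures\<close>

text \<open>Only times \<open>t \<ge> 0\<close> matter. The library locale \<^const>\<open>filtration\<close> asks for a
  family indexed by all reals; every filtration on the half-line extends to one by \<open>F t = F 0\<close> for
  \<open>t < 0\<close>.\<close>

definition usual_filtration :: "'a measure \<Rightarrow> (real \<Rightarrow> 'a measure) \<Rightarrow> bool" where
  "usual_filtration M F \<longleftrightarrow>
     filtration (space M) F \<and> (\<forall>t\<ge>0. subalgebra M (F t)) \<and>
     complete_measure M \<and> null_sets M \<subseteq> sets (F 0) \<and>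
     (\<forall>t\<ge>0. sets (F t) = (\<Inter>s\<in>{t<..}. sets (F s)))"

definition poisson_random_measure ::
  "'a measure \<Rightarrow> 'b measure \<Rightarrow> ('a \<Rightarrow> 'b measure) \<Rightarrow> bool" where
  "poisson_random_measure M \<mu> P \<longleftrightarrow>
     (\<forall>\<omega>\<in>space M. sets (P \<omega>) = sets \<mu> \<and>
        (\<forall>A\<in>sets \<mu>. emeasure (P \<omega>) A \<in> insert \<infinity> (range of_nat))) \<and>
     (\<forall>A\<in>sets \<mu>. (\<lambda>\<omega>. emeasure (P \<omega>) A) \<in> borel_measurable M) \<and>
     (\<forall>A\<in>sets \<mu>. emeasure \<mu> A < \<infinity> \<longrightarrow>
        (\<forall>k::nat. \<P>(\<omega> in M. emeasure (P \<omega>) A = of_nat k) =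
           measure \<mu> A ^ k / fact k * exp (- measure \<mu> A))) \<and>
     (\<forall>A\<in>sets \<mu>. emeasure \<mu> A = \<infinity> \<longrightarrow> (AE \<omega> in M. emeasure (P \<omega>) A = \<infinity>)) \<and>
     (\<forall>(A :: nat \<Rightarrow> 'b set) k. range A \<subseteq> sets \<mu> \<longrightarrow> disjoint_family_on A {..<k} \<longrightarrow>
        prob_space.indep_vars M (\<lambda>_. borel) (\<lambda>l \<omega>. emeasure (P \<omega>) (A l)) {..<k})"

definition half_plane :: "(real \<times> real) measure" where
  "half_plane = restrict_space lborel ({0..} \<times> UNIV)"

definition random_measure_adapted ::
  "(real \<Rightarrow> 'a measure) \<Rightarrow> ('a \<Rightarrow> (real \<times> real) measure) \<Rightarrow> bool" where
  "random_measure_adapted F P \<longleftrightarrow>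
     (\<forall>t\<ge>0. \<forall>B\<in>sets borel. (\<lambda>\<omega>. emeasure (P \<omega>) ({0<..t} \<times> B)) \<in> borel_measurable (F t))"

subsection \<open>The stochastic differential equation\<close>

definition left_lim :: "(real \<Rightarrow> 'b::t2_space) \<Rightarrow> real \<Rightarrow> 'b" where
  "left_lim f t = Lim (at_left t) f"

definition cadlag :: "(real \<Rightarrow> 'b::t2_space) \<Rightarrow> bool" where
  "cadlag f \<longleftrightarrow> (\<forall>t\<ge>0. (f \<longlongrightarrow> f t) (at_right t)) \<and> (\<forall>t>0. \<exists>l. (f \<longlongrightarrow> l) (at_left t))"

text \<open>\<open>h_path\<close> and \<open>g_path\<close> are the coefficients along a path \<open>(X, Y, N)\<close>, as functions of the
  point \<open>(u, v)\<close> of the half-plane.\<close>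

definition h_path ::
  "(nat \<times> nat) set \<Rightarrow> (nat \<Rightarrow> nat \<Rightarrow> real \<Rightarrow> nat \<Rightarrow> real) \<Rightarrow> (nat \<Rightarrow> nat \<Rightarrow> real \<Rightarrow> nat \<Rightarrow> real)
     \<Rightarrow> (real \<Rightarrow> nat) \<Rightarrow> (real \<Rightarrow> real) \<Rightarrow> (real \<Rightarrow> nat) \<Rightarrow> real \<times> real \<Rightarrow> real" where
  "h_path ord lam lamt X Y N =
     (\<lambda>(u, v). h_Lambda ord lam lamt (left_lim X u) (left_lim Y u) (left_lim N u) v)"

definition g_path ::
  "(nat \<times> nat) set \<Rightarrow> (nat \<Rightarrow> nat \<Rightarrow> real \<Rightarrow> nat \<Rightarrow> real) \<Rightarrow> (nat \<Rightarrow> nat \<Rightarrow> real \<Rightarrow> nat \<Rightarrow> real)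
     \<Rightarrow> (real \<Rightarrow> nat) \<Rightarrow> (real \<Rightarrow> real) \<Rightarrow> (real \<Rightarrow> nat) \<Rightarrow> real \<times> real \<Rightarrow> real" where
  "g_path ord lam lamt X Y N =
     (\<lambda>(u, v). g_Lambda ord lam lamt (left_lim X u) (left_lim Y u) (left_lim N u) v)"

text \<open>The equations for one path, driven by one realization \<open>Q\<close> of the random measure. The
  integrability conditions say that the integrals exist; without them
  \<^const>\<open>lebesgue_integral\<close> would silently be 0.\<close>

definition solves_path ::
  "(nat \<times> nat) set \<Rightarrow> (nat \<Rightarrow> nat \<Rightarrow> real \<Rightarrow> nat \<Rightarrow> real) \<Rightarrow> (nat \<Rightarrow> nat \<Rightarrow> real \<Rightarrow> nat \<Rightarrow> real)
     \<Rightarrow> (real \<times> real) measure \<Rightarrow> (real \<Rightarrow> nat) \<Rightarrow> (real \<Rightarrow> real) \<Rightarrow> (real \<Rightarrow> nat) \<Rightarrow> bool" where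
  "solves_path ord lam lamt Q X Y N \<longleftrightarrow> (\<forall>t\<ge>0.
     set_integrable Q ({0<..t} \<times> UNIV) (h_path ord lam lamt X Y N) \<and>
     set_integrable Q ({0<..t} \<times> UNIV) (\<lambda>z. left_lim Y (fst z) * g_path ord lam lamt X Y N z) \<and>
     set_integrable Q ({0<..t} \<times> UNIV) (g_path ord lam lamt X Y N) \<and>
     real (X t) = real (X 0) + (LINT z:{0<..t} \<times> UNIV|Q. h_path ord lam lamt X Y N z) \<and>
     Y t = Y 0 + t - (LINT z:{0<..t} \<times> UNIV|Q. left_lim Y (fst z) * g_path ord lam lamt X Y N z) \<and>
     real (N t) = (LINT z:{0<..t} \<times> UNIV|Q. g_path ord lam lamt X Y N z))"

definition sde_solution ::
  "'a measure \<Rightarrow> (real \<Rightarrow> 'a measure) \<Rightarrow> (nat \<times> nat) set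
     \<Rightarrow> (nat \<Rightarrow> nat \<Rightarrow> real \<Rightarrow> nat \<Rightarrow> real) \<Rightarrow> (nat \<Rightarrow> nat \<Rightarrow> real \<Rightarrow> nat \<Rightarrow> real)
     \<Rightarrow> ('a \<Rightarrow> (real \<times> real) measure)
     \<Rightarrow> (real \<Rightarrow> 'a \<Rightarrow> nat) \<Rightarrow> (real \<Rightarrow> 'a \<Rightarrow> real) \<Rightarrow> (real \<Rightarrow> 'a \<Rightarrow> nat) \<Rightarrow> bool" where
  "sde_solution M F ord lam lamt P X Y N \<longleftrightarrow>
     (\<forall>t\<ge>0. X t \<in> measurable (F t) (count_space states) \<and>
            Y t \<in> measurable (F t) (restrict_space borel {0..}) \<and>
            N t \<in> measurable (F t) (count_space UNIV)) \<and>
     (AE \<omega> in M. cadlag (\<lambda>t. X t \<omega>) \<and> cadlag (\<lambda>t. Y t \<omega>) \<and> cadlag (\<lambda>t. N t \<omega>) \<and>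
        solves_path ord lam lamt (P \<omega>) (\<lambda>t. X t \<omega>) (\<lambda>t. Y t \<omega>) (\<lambda>t. N t \<omega>))"

text \<open>The initial values may be random, provided that they are independent of the driving random
  measure. For constant initial values this holds trivially.\<close>

definition initial_independent ::
  "'a measure \<Rightarrow> ('a \<Rightarrow> (real \<times> real) measure) \<Rightarrow> ('a \<Rightarrow> nat) \<Rightarrow> ('a \<Rightarrow> real) \<Rightarrow> bool" where
  "initial_independent M P X0 Y0 \<longleftrightarrow>
     prob_space.indep_set M
       (sets (vimage_algebra (space M) (\<lambda>\<omega>. (X0 \<omega>, Y0 \<omega>))
          (count_space states \<Otimes>\<^sub>M restrict_space borel {0..})))
       (sets (vimage_algebra (space M) (\<lambda>\<omega>. \<lambda>A\<in>sets half_plane. emeasure (P \<omega>) A)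
          (Pi\<^sub>M (sets half_plane) (\<lambda>_. borel))))"

subsection \<open>Jump times\<close>

text \<open>\<open>jump_time X n\<close> is the \<open>n\<close>-th jump time of the path \<open>X\<close>, with the convention that the 0-th one
  is 0. Under \<^const>\<open>rates_diverge\<close> a solution almost surely has infinitely many jumps, so the
  infimum is over a nonempty set.\<close>

primrec jump_time :: "(real \<Rightarrow> 'b::t2_space) \<Rightarrow> nat \<Rightarrow> real" where
  "jump_time X 0 = 0"
| "jump_time X (Suc n) = Inf {t. jump_time X n < t \<and> X t \<noteq> left_lim X t}"

definition post_jump_state :: "(real \<Rightarrow> 'a \<Rightarrow> nat) \<Rightarrow> nat \<Rightarrow> 'a \<Rightarrow> nat" where
  "post_jump_state X n \<omega> = X (jump_time (\<lambda>t. X t \<omega>) n) \<omega>"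

definition holding_time :: "(real \<Rightarrow> 'a \<Rightarrow> nat) \<Rightarrow> nat \<Rightarrow> 'a \<Rightarrow> real" where
  "holding_time X n \<omega> = jump_time (\<lambda>t. X t \<omega>) (Suc n) - jump_time (\<lambda>t. X t \<omega>) n"

end

theory Submission
  imports Defs
begin

text \<open>Let \<open>T\<^sub>n\<close> be the \<open>n\<close>-th jump time, so that for \<open>n \<ge> 1\<close>, at a time \<open>u\<close> between
  \<open>T\<^sub>n\<close> and \<open>T\<^sub>n\<^sub>+\<^sub>1\<close>, \<open>N = n\<close> and the age \<open>Y\<close> is \<open>u - T\<^sub>n\<close>. The filtration \<open>F\<close> of the statement may anticipate the driving measure, so the argument
  uses the history generated by the initial values and the points up to time \<open>t\<close>. By induction on
  \<open>n\<close>, a solution is determined by this history up to \<open>T\<^sub>n\<close>; hence the set of all \<open>(u, v)\<close> with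
  \<open>T\<^sub>n < u \<le> T\<^sub>n\<^sub>+\<^sub>1\<close>, \<open>X = i\<close> just before \<open>u\<close>, \<open>u - T\<^sub>n \<in> A\<close> and \<open>v\<close> in the interval of
  \<open>(i, j)\<close> is predictable. It carries a point exactly if \<open>X\<close> moves from \<open>i\<close> to \<open>j\<close> with a holding
  time in \<open>A\<close>. The Campbell formula, which equates the expected number of points in a predictable set
  with its expected area, therefore says that this event has probability
  \<open>\<integral>\<^sub>A \<lambda>\<^sub>i\<^sub>j(s, n) P(X = i at T\<^sub>n, T\<^sub>n\<^sub>+\<^sub>1 - T\<^sub>n \<ge> s) ds\<close>. Summing over \<open>j\<close> gives an integral equation
  for the survival function, whose solution is exponential, and comparing the densities for a single
  \<open>j\<close> and for the sum gives the transition probabilities. The formula also shows that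
  \<open>X\<close> almost surely jumps infinitely often: otherwise the expected area would be infinite.\<close>

subsection \<open>Transition rates and intervals\<close>

text \<open>The equation, the finiteness of counts on boxes and the absence of simultaneous points
  hold only almost surely, while predictability is a property of exact sets. Hence a null set is
  removed, pathwise facts are proved for all remaining outcomes, and completeness of
  \<open>M\<close> carries measurability of jump times and states back to the whole space. A
  realization of the random measure is not given as a sum of point masses. Its values are natural
  numbers or infinity, and vertical lines at positive times carry mass at most 1; the argument
  therefore compares masses of lines and regions, and integrality singles out the one target that is
  hit at an arrival. Measurability of the solution in the smaller history and the location of its
  next jump depend on each other. The circle is broken by regions that freeze state and count at
  \<open>T\<^sub>k\<close>, let the age run on and disregard later jumps: the mass of such a region
  decides whether level \<open>k + 1\<close> is reached by time \<open>t\<close>. The initial cycle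
  starts at age \<open>Y 0\<close>, all later ones at age 0. Measuring ages from a birth time treats
  both alike until \<open>n \<ge> 1\<close> is used.\<close>

lemma suminf_eq_infsum_ennreal:
  fixes f :: "nat \<Rightarrow> ennreal"
  shows "(\<Sum>j. f j) = infsum f UNIV"
proof -
  have "(f has_sum infsum f UNIV) UNIV"
    by (rule has_sum_infsum) (auto intro: nonneg_summable_on_complete)
  then have "f sums infsum f UNIV" by (rule has_sum_imp_sums)
  then show ?thesis by (simp add: sums_iff)
qed

lemma borel_measurable_infsum_ennreal:
  fixes f :: "'i::countable \<Rightarrow> 'a \<Rightarrow> ennreal"
  assumes "\<And>i. i \<in> I \<Longrightarrow> f i \<in> borel_measurable M"
  shows "(\<lambda>x. \<Sum>\<^sub>\<infinity>i\<in>I. f i x) \<in> borel_measurable M"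
proof -
  have "(\<lambda>x. \<Sum>\<^sub>\<infinity>i\<in>I. f i x) = (\<lambda>x. SUP F\<in>{F. finite F \<and> F \<subseteq> I}. \<Sum>i\<in>F. f i x)"
    by (rule ext, rule nonneg_infsum_complete) simp
  moreover have "countable {F. finite F \<and> F \<subseteq> I}"
    by (rule countable_Collect_finite_subset) simp
  ultimately show ?thesis
    using assms by (auto intro!: borel_measurable_SUP borel_measurable_sum)
qed

lemma ennreal_infsum_nonneg:
  fixes f :: "'i \<Rightarrow> real"
  assumes "\<And>i. i \<in> I \<Longrightarrow> 0 \<le> f i" and "f summable_on I"
  shows "ennreal (infsum f I) = (\<Sum>\<^sub>\<infinity>i\<in>I. ennreal (f i))"
proof -
  have "(\<Sum>\<^sub>\<infinity>i\<in>I. ennreal (f i)) = (SUP F\<in>{F. finite F \<and> F \<subseteq> I}. \<Sum>i\<in>F. ennreal (f i))"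
    by (rule nonneg_infsum_complete) simp
  also have "\<dots> = (SUP F\<in>{F. finite F \<and> F \<subseteq> I}. ennreal (sum f F))"
    using assms(1) by (intro SUP_cong refl sum_ennreal) auto
  also have "\<dots> = ennreal (infsum f I)"
    using infsum_nonneg_is_SUPREMUM_ennreal[of f I] assms by auto
  finally show ?thesis ..
qed

text \<open>On a divergent sum both sides are 0, by the conventions of \<^const>\<open>infsum\<close> and \<^const>\<open>enn2real\<close>.\<close>

lemma infsum_eq_enn2real:
  fixes f :: "'i \<Rightarrow> real"
  assumes "\<And>i. i \<in> I \<Longrightarrow> 0 \<le> f i"
  shows "infsum f I = enn2real (\<Sum>\<^sub>\<infinity>i\<in>I. ennreal (f i))"
proof (cases "f summable_on I")
  case True
  then show ?thesis
    using ennreal_infsum_nonneg[of I f] assms infsum_nonneg[of I f]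
    by (metis enn2real_ennreal)
next
  case False
  have "(\<Sum>\<^sub>\<infinity>i\<in>I. ennreal (f i)) = \<infinity>"
  proof (rule ccontr)
    assume fin: "(\<Sum>\<^sub>\<infinity>i\<in>I. ennreal (f i)) \<noteq> \<infinity>"
    define s where "s = enn2real (\<Sum>\<^sub>\<infinity>i\<in>I. ennreal (f i))"
    have s: "(\<Sum>\<^sub>\<infinity>i\<in>I. ennreal (f i)) = ennreal s"
      using fin by (simp add: s_def less_top)
    have "f summable_on I"
    proof (rule nonneg_bdd_above_summable_on)
      show "bdd_above (sum f ` {F. F \<subseteq> I \<and> finite F})"
      proof (rule bdd_aboveI2)
        fix F assume F: "F \<in> {F. F \<subseteq> I \<and> finite F}"
        have "ennreal (sum f F) = (\<Sum>i\<in>F. ennreal (f i))"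
          using F assms by (subst sum_ennreal) auto
        also have "\<dots> \<le> (\<Sum>\<^sub>\<infinity>i\<in>I. ennreal (f i))"
          using F by (subst nonneg_infsum_complete) (auto intro!: SUP_upper)
        finally show "sum f F \<le> s"
          unfolding s by (simp add: s_def)
      qed
    qed (rule assms)
    with False show False ..
  qed
  with False show ?thesis by (simp add: infsum_not_exists)
qed

lemma section_measurable:
  fixes f :: "real \<Rightarrow> nat \<Rightarrow> 'b::{second_countable_topology}"
  assumes "(\<lambda>(y, n). f y n) \<in> borel_measurable age_count_measure"
  shows "(\<lambda>y. f y n) \<in> borel_measurable (restrict_space borel {0..})"
proof -
  have "(\<lambda>y. (y, n)) \<in> measurable (restrict_space lborel {0..}) age_count_measure"
    unfolding age_count_measure_def by measurable
  from measurable_compose[OF this assms]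
  have "(\<lambda>y. f y n) \<in> borel_measurable (restrict_space lborel {0..})" by simp
  then show ?thesis
    by (subst measurable_cong_sets[OF _ refl, of _ "restrict_space lborel {0..}"])
      (auto intro!: sets_restrict_space_cong)
qed

text \<open>Points of the counting measure have positive mass, so Fubini yields a single null set of
  ages that serves all counts \<open>n\<close> simultaneously.\<close>

lemma AE_age_count_measure:
  assumes "AE (y, n) in age_count_measure. Q y n"
  shows "AE y in lborel. 0 \<le> y \<longrightarrow> (\<forall>n. Q y n)"
proof -
  interpret A: sigma_finite_measure "restrict_space lborel {0::real..}"
    by (rule sigma_finite_measure_restrict_space) (auto intro: lborel.sigma_finite_measure_axioms)
  interpret C: sigma_finite_measure "count_space (UNIV :: nat set)"
    by (rule sigma_finite_measure_count_space)
  interpret pair_sigma_finite "restrict_space lborel {0::real..}" "count_space (UNIV :: nat set)" ..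
  have "AE y in restrict_space lborel {0..}. AE n in count_space UNIV. Q y n"
    using AE_pair[of "\<lambda>(y, n). Q y n"] assms unfolding age_count_measure_def by simp
  then show ?thesis
    by (subst (asm) AE_restrict_space_iff) (auto simp: AE_count_space)
qed

section \<open>Exit rates and their integrals\<close>

text \<open>The value 0 at negative ages and for indices that are no targets gives functions on the
  whole line and sums over all naturals.\<close>

definition ext_rate :: "(nat \<Rightarrow> nat \<Rightarrow> real \<Rightarrow> nat \<Rightarrow> real) \<Rightarrow> nat \<Rightarrow> nat \<Rightarrow> nat \<Rightarrow> real \<Rightarrow> real" where
  "ext_rate lam n i j y = (if 0 \<le> y \<and> j \<in> states - {i} then lam i j y n else 0)"

text \<open>Unlike \<open>exit_rate\<close>, this keeps the value infinity where the sum diverges,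
  so sums and integrals can be exchanged without side conditions.\<close>

definition total_rate :: "(nat \<Rightarrow> nat \<Rightarrow> real \<Rightarrow> nat \<Rightarrow> real) \<Rightarrow> nat \<Rightarrow> nat \<Rightarrow> real \<Rightarrow> ennreal" where
  "total_rate lam n i y = (\<Sum>j. ennreal (ext_rate lam n i j y))"

lemma ratesD:
  assumes "rates lam" "i \<in> states" "j \<in> states - {i}"
  shows "(\<lambda>(y, n). lam i j y n) \<in> borel_measurable age_count_measure"
    and "0 \<le> y \<Longrightarrow> 0 \<le> lam i j y n"
  using assms unfolding rates_def state_pairs_def by auto

lemma ext_rate_nonneg: "rates lam \<Longrightarrow> i \<in> states \<Longrightarrow> 0 \<le> ext_rate lam n i j y"
  by (auto simp: ext_rate_def ratesD)

lemma ext_rate_measurable: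
  assumes "rates lam" "i \<in> states"
  shows "ext_rate lam n i j \<in> borel_measurable borel"
proof (cases "j \<in> states - {i}")
  case True
  have "(\<lambda>y. indicator {0..} y *\<^sub>R lam i j y n) \<in> borel_measurable borel"
    using section_measurable[OF ratesD(1)[OF assms True]]
    by (subst (asm) borel_measurable_restrict_space_iff) auto
  also have "(\<lambda>y. indicator {0..} y *\<^sub>R lam i j y n) = ext_rate lam n i j"
    using True by (auto simp: ext_rate_def fun_eq_iff indicator_def)
  finally show ?thesis .
next
  case False
  then have "ext_rate lam n i j = (\<lambda>_. 0)" by (auto simp: ext_rate_def fun_eq_iff)
  then show ?thesis by simp
qed

lemma total_rate_measurable:
  assumes "rates lam" "i \<in> states"
  shows "total_rate lam n i \<in> borel_measurable borel"
  unfolding total_rate_def using ext_rate_measurable[OF assms] by measurable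

lemma total_rate_eq:
  assumes "0 \<le> y"
  shows "total_rate lam n i y = (\<Sum>\<^sub>\<infinity>j\<in>states - {i}. ennreal (lam i j y n))"
  unfolding total_rate_def suminf_eq_infsum_ennreal
  by (rule infsum_cong_neutral) (use assms in \<open>auto simp: ext_rate_def\<close>)

lemma exit_rate_eq:
  assumes "rates lam" "i \<in> states" "0 \<le> y"
  shows "exit_rate lam i y n = enn2real (total_rate lam n i y)"
  unfolding exit_rate_def total_rate_eq[OF assms(3)]
  by (rule infsum_eq_enn2real) (use assms in \<open>auto intro: ratesD\<close>)

text \<open>The majorant passes its essential bound on to \<open>lam\<close>, so the constant is the
  sum of the \<open>Linf_norm\<close> values over the targets of \<open>i\<close>. The targets being
  countable, one null set suffices.\<close>

lemma AE_total_rate_bounded: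
  assumes "rates lam" "rates_summable lam" "rate_majorants lam lamt" "i \<in> states"
  shows "\<exists>C::real. 0 \<le> C \<and> (AE y in lborel. \<forall>n. total_rate lam n i y \<le> ennreal C)"
proof -
  define K where "K = (\<Sum>\<^sub>\<infinity>j\<in>states - {i}. Linf_norm (lam i j))"
  have "K \<le> (SUP i\<in>states. \<Sum>\<^sub>\<infinity>j\<in>states - {i}. Linf_norm (lam i j))"
    unfolding K_def by (rule SUP_upper) fact
  then have Kfin: "K < \<infinity>" using assms(2) unfolding rates_summable_def by (rule le_less_trans)
  have "\<forall>j\<in>states - {i}. AE (y, n) in age_count_measure. ennreal (lam i j y n) \<le> Linf_norm (lam i j)"
  proof
    fix j assume j: "j \<in> states - {i}"
    have majo: "AE (y, n) in age_count_measure. ennreal (lamt i j y n) \<le> Linf_norm (lam i j)"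
      and le: "\<And>y n. 0 \<le> y \<Longrightarrow> lam i j y n \<le> lamt i j y n"
      using assms(3,4) j unfolding rate_majorants_def state_pairs_def by auto
    have "AE (y, n) in age_count_measure. 0 \<le> y"
      by (rule AE_I2) (auto simp: age_count_measure_def space_pair_measure space_restrict_space)
    with majo show "AE (y, n) in age_count_measure. ennreal (lam i j y n) \<le> Linf_norm (lam i j)"
      by (rule eventually_elim2) (auto intro: order_trans[OF ennreal_leI[OF le]])
  qed
  then have "\<forall>j\<in>states - {i}. AE y in lborel. 0 \<le> y \<longrightarrow> (\<forall>n. ennreal (lam i j y n) \<le> Linf_norm (lam i j))"
    using AE_age_count_measure by blast
  then have "AE y in lborel. \<forall>j\<in>states - {i}. 0 \<le> y \<longrightarrow> (\<forall>n. ennreal (lam i j y n) \<le> Linf_norm (lam i j))"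
    by (subst AE_ball_countable) auto
  then have "AE y in lborel. \<forall>n. total_rate lam n i y \<le> ennreal (enn2real K)"
  proof eventually_elim
    case (elim y)
    show ?case
    proof
      fix n
      show "total_rate lam n i y \<le> ennreal (enn2real K)"
      proof (cases "0 \<le> y")
        case True
        have "total_rate lam n i y \<le> K"
          unfolding total_rate_eq[OF True] K_def
          by (rule infsum_mono) (use elim True in \<open>auto intro: nonneg_summable_on_complete\<close>)
        with Kfin show ?thesis by simp
      next
        case False
        then have "total_rate lam n i y = 0"
          by (simp add: total_rate_def ext_rate_def)
        then show ?thesis by simp
      qed
    qed
  qed
  then show ?thesis by (intro exI[of _ "enn2real K"]) simp
qed

text \<open>The real and the extended rate differ only where the sum over targets diverges, a null
  set. The essential bound gives integrability on \<open>{0..y}\<close>, without which the integral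
  in \<open>cum_rate\<close> would be 0 by default.\<close>

lemma cum_rate_eq:
  assumes "rates lam" "rates_summable lam" "rate_majorants lam lamt" "i \<in> states" "0 \<le> y"
  shows "ennreal (cum_rate lam i y n) = (\<integral>\<^sup>+s\<in>{0..y}. total_rate lam n i s \<partial>lborel)"
    and "0 \<le> cum_rate lam i y n"
proof -
  obtain C where C: "0 \<le> C" "AE y in lborel. \<forall>n. total_rate lam n i y \<le> ennreal C"
    using AE_total_rate_bounded[OF assms(1-4)] by auto
  have [measurable]: "total_rate lam n i \<in> borel_measurable borel"
    by (rule total_rate_measurable) fact+
  have eq: "cum_rate lam i y n = (LINT s|lborel. enn2real (total_rate lam n i s) * indicator {0..y} s)"
    unfolding cum_rate_def set_lebesgue_integral_def
    by (rule Bochner_Integration.integral_cong)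
      (auto simp: exit_rate_eq[OF assms(1,4)] indicator_def)
  then show "0 \<le> cum_rate lam i y n" by (simp add: integral_nonneg_AE)
  have "ennreal (cum_rate lam i y n) = (\<integral>\<^sup>+s. ennreal (enn2real (total_rate lam n i s) * indicator {0..y} s) \<partial>lborel)"
    unfolding eq
  proof (rule nn_integral_eq_integral[symmetric])
    show "integrable lborel (\<lambda>s. enn2real (total_rate lam n i s) * indicator {0..y} s)"
    proof (rule Bochner_Integration.integrable_bound)
      show "integrable lborel (\<lambda>s. C * indicator {0..y} s :: real)"
        by (intro integrable_mult_right integrable_real_indicator) (auto simp: emeasure_lborel_Icc_eq)
      show "AE s in lborel. norm (enn2real (total_rate lam n i s) * indicator {0..y} s) \<le> norm (C * indicator {0..y} s)"
        using C(2) by eventually_elim (auto simp: indicator_def \<open>0 \<le> C\<close> intro!: enn2real_leI)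
    qed measurable
  qed simp
  also have "\<dots> = (\<integral>\<^sup>+s\<in>{0..y}. total_rate lam n i s \<partial>lborel)"
  proof (rule nn_integral_cong_AE)
    show "AE s in lborel. ennreal (enn2real (total_rate lam n i s) * indicator {0..y} s) =
        total_rate lam n i s * indicator {0..y} s"
      using C(2)
    proof eventually_elim
      case (elim s)
      then have "total_rate lam n i s < \<infinity>" by (metis ennreal_less_top infinity_ennreal_def le_less_trans)
      then show ?case by (auto simp: indicator_def)
    qed
  qed
  finally show "ennreal (cum_rate lam i y n) = (\<integral>\<^sup>+s\<in>{0..y}. total_rate lam n i s \<partial>lborel)" .
qed


section \<open>Position, length and disjointness of the intervals\<close>

text \<open>Finiteness has to be stated separately: \<open>enn2real\<close> turns an infinite left
  endpoint into 0, whereas the interval is empty there.\<close>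

lemma mem_Lambda_iff:
  "v \<in> Lambda ord lam lamt i j y n \<longleftrightarrow>
     Lambda_start ord lamt i j y n < \<infinity> \<and>
     enn2real (Lambda_start ord lamt i j y n) \<le> v \<and>
     v < enn2real (Lambda_start ord lamt i j y n) + lam i j y n"
proof (cases "Lambda_start ord lamt i j y n")
  case (real a)
  then have "v \<in> Lambda ord lam lamt i j y n \<longleftrightarrow> (\<exists>b\<in>{0..<lam i j y n}. v = a + b)"
    unfolding Lambda_def by (simp add: enn2ereal_ennreal)
  also have "\<dots> \<longleftrightarrow> a \<le> v \<and> v < a + lam i j y n"
    by (auto intro!: bexI[of _ "v - a"])
  finally show ?thesis using real by simp
next
  case top
  then show ?thesis unfolding Lambda_def by simp
qed

lemma emeasure_Lambda:
  assumes "Lambda_start ord lamt i j y n < \<infinity>" "0 \<le> lam i j y n"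
  shows "emeasure lborel (Lambda ord lam lamt i j y n) = ennreal (lam i j y n)"
proof -
  have "Lambda ord lam lamt i j y n =
      {enn2real (Lambda_start ord lamt i j y n)..<enn2real (Lambda_start ord lamt i j y n) + lam i j y n}"
    using assms by (auto simp: mem_Lambda_iff)
  then show ?thesis using assms by simp
qed

text \<open>In the lexicographic order the pair \<open>(i, j)\<close> and all its predecessors come
  before \<open>(i, j')\<close>, so the later left endpoint is a sum of nonnegative terms over a
  larger set.\<close>

lemma Lambda_start_add:
  assumes "strict_linear_order_on states ord" "(i, j) \<in> state_pairs" "(i, j') \<in> state_pairs" "(j, j') \<in> ord"
  shows "Lambda_start ord lamt i j y n + ennreal (lamt i j y n) \<le> Lambda_start ord lamt i j' y n"
proof -
  have tr: "trans (ord <*lex*> ord)" and irr: "irrefl (ord <*lex*> ord)"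
    using assms(1) unfolding strict_linear_order_on_def by (auto simp: irrefl_def)
  let ?f = "\<lambda>(i', j'). ennreal (lamt i' j' y n)"
  let ?A = "{p \<in> state_pairs. (p, (i, j)) \<in> ord <*lex*> ord}"
  have "Lambda_start ord lamt i j y n + ennreal (lamt i j y n) = infsum ?f ?A + infsum ?f {(i, j)}"
    unfolding Lambda_start_def by simp
  also have "\<dots> = infsum ?f (?A \<union> {(i, j)})"
    using irr by (intro infsum_Un_disjoint[symmetric] nonneg_summable_on_complete) (auto simp: irrefl_def)
  also have "\<dots> \<le> Lambda_start ord lamt i j' y n"
    unfolding Lambda_start_def
  proof (rule infsum_mono_neutral)
    fix x assume "x \<in> ?A \<union> {(i, j)} - {p \<in> state_pairs. (p, i, j') \<in> ord <*lex*> ord}"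
    moreover have "((i, j), (i, j')) \<in> ord <*lex*> ord" using assms(4) by simp
    ultimately show "?f x \<le> 0" using transD[OF tr] assms(2) by blast
  qed (auto intro: nonneg_summable_on_complete)
  finally show ?thesis .
qed

text \<open>Of two intervals with finite endpoints, the later starts at least \<open>lamt\<close>
  beyond the start of the earlier, whose length \<open>lam\<close> is no larger than that.\<close>

lemma Lambda_disjoint:
  assumes "rates lam" "rate_majorants lam lamt" "strict_linear_order_on states ord"
    and "i \<in> states" "j \<in> states - {i}" "j' \<in> states - {i}" "j \<noteq> j'" "0 \<le> y"
  shows "Lambda ord lam lamt i j y n \<inter> Lambda ord lam lamt i j' y n = {}"
proof -
  have *: False
    if H: "j \<in> states - {i}" "j' \<in> states - {i}" "(j, j') \<in> ord"
      "v \<in> Lambda ord lam lamt i j y n" "v \<in> Lambda ord lam lamt i j' y n" for j j' v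
  proof -
    have le: "lam i j y n \<le> lamt i j y n" and nn: "0 \<le> lam i j y n"
      using assms(1,2,4,8) H(1) by (auto simp: rate_majorants_def state_pairs_def ratesD)
    obtain a b where ab: "Lambda_start ord lamt i j y n = ennreal a" "Lambda_start ord lamt i j' y n = ennreal b"
      "0 \<le> a" "0 \<le> b" "v < a + lam i j y n" "b \<le> v"
      using H(4,5) unfolding mem_Lambda_iff
      by (cases "Lambda_start ord lamt i j y n"; cases "Lambda_start ord lamt i j' y n") auto
    have "ennreal a + ennreal (lamt i j y n) \<le> ennreal b"
      using Lambda_start_add[OF assms(3), of i j j' lamt y n] H(1-3) assms(4) ab by (auto simp: state_pairs_def)
    then have "ennreal (a + lamt i j y n) \<le> ennreal b"
      using ab nn le by simp
    then have "a + lamt i j y n \<le> b"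
      using ab by (simp only: ennreal_le_iff)
    with ab le show False by simp
  qed
  have "(j, j') \<in> ord \<or> (j', j) \<in> ord"
    using assms(3,5-7) unfolding strict_linear_order_on_def total_on_def by auto
  then show ?thesis using *[of j j'] *[of j' j] assms(5,6) by blast
qed

text \<open>The region lies between the graph of the left endpoint, a countable sum of measurable
  functions, and the same graph raised by the rate.\<close>

lemma Lambda_region_measurable:
  assumes "rates lam" "rate_majorants lam lamt" "i \<in> states" "j \<in> states - {i}"
  shows "{(y, v). 0 \<le> y \<and> v \<in> Lambda ord lam lamt i j y n} \<in> sets borel"
proof -
  let ?P = "{p \<in> state_pairs. (p, (i, j)) \<in> ord <*lex*> ord}"
  have "(\<lambda>y. \<Sum>\<^sub>\<infinity>p\<in>?P. ennreal (lamt (fst p) (snd p) y n)) \<in> borel_measurable (restrict_space borel {0..})"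
  proof (rule borel_measurable_infsum_ennreal)
    fix p assume "p \<in> ?P"
    then have "(\<lambda>(y, n). lamt (fst p) (snd p) y n) \<in> borel_measurable age_count_measure"
      using assms(2) by (auto simp: rate_majorants_def)
    then show "(\<lambda>y. ennreal (lamt (fst p) (snd p) y n)) \<in> borel_measurable (restrict_space borel {0..})"
      by (intro measurable_compose[OF section_measurable measurable_ennreal])
  qed
  then have "(\<lambda>y. Lambda_start ord lamt i j y n) \<in> borel_measurable (restrict_space borel {0..})"
    by (simp only: Lambda_start_def case_prod_unfold)
  then have "(\<lambda>y. Lambda_start ord lamt i j y n * indicator {0..} y) \<in> borel_measurable borel"
    by (subst (asm) borel_measurable_restrict_space_iff_ennreal) auto
  moreover define s where "s y = Lambda_start ord lamt i j y n * indicator {0..} y" for y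
  ultimately have [measurable]: "s \<in> borel_measurable borel" by (simp add: s_def[abs_def])
  have [measurable]: "ext_rate lam n i j \<in> borel_measurable borel"
    by (rule ext_rate_measurable) fact+
  have "{(y, v). 0 \<le> y \<and> v \<in> Lambda ord lam lamt i j y n} =
      {z \<in> space (borel \<Otimes>\<^sub>M borel). 0 \<le> fst z \<and> s (fst z) < \<infinity> \<and> enn2real (s (fst z)) \<le> snd z \<and>
         snd z < enn2real (s (fst z)) + ext_rate lam n i j (fst z)}"
    using assms(4) by (auto simp: mem_Lambda_iff s_def ext_rate_def space_pair_measure)
  also have "\<dots> \<in> sets (borel \<Otimes>\<^sub>M borel)" by measurable
  finally show ?thesis unfolding borel_prod .
qed

lemma AE_Lambda_start_finite:
  assumes "Lambda_well_defined ord lamt"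
  shows "AE y in lborel. 0 \<le> y \<longrightarrow> (\<forall>(i, j)\<in>state_pairs. \<forall>n. Lambda_start ord lamt i j y n < \<infinity>)"
proof -
  have "\<forall>p\<in>state_pairs. AE y in lborel. 0 \<le> y \<longrightarrow> (\<forall>n. Lambda_start ord lamt (fst p) (snd p) y n < \<infinity>)"
    using assms AE_age_count_measure unfolding Lambda_well_defined_def by fastforce
  then have "AE y in lborel. \<forall>p\<in>state_pairs. 0 \<le> y \<longrightarrow> (\<forall>n. Lambda_start ord lamt (fst p) (snd p) y n < \<infinity>)"
    by (subst AE_ball_countable) auto
  then show ?thesis by eventually_elim auto
qed

lemma g_Lambda_eq:
  assumes "rates lam" "rate_majorants lam lamt" "strict_linear_order_on states ord" "i \<in> states" "0 \<le> y"
    and "j \<in> states - {i}" "v \<in> Lambda ord lam lamt i j y n"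
  shows "g_Lambda ord lam lamt i y n v = 1" "h_Lambda ord lam lamt i y n v = real j - real i"
proof -
  have nin: "v \<notin> Lambda ord lam lamt i j' y n" if "j' \<in> states - {i} - {j}" for j'
    using Lambda_disjoint[OF assms(1-4,6), of j' y n] assms(5,7) that by auto
  have "g_Lambda ord lam lamt i y n v = (\<Sum>\<^sub>\<infinity>j'\<in>{j}. 1)"
    unfolding g_Lambda_def by (rule infsum_cong_neutral) (use nin assms in auto)
  then show "g_Lambda ord lam lamt i y n v = 1" by simp
  have "h_Lambda ord lam lamt i y n v = (\<Sum>\<^sub>\<infinity>j'\<in>{j}. real j - real i)"
    unfolding h_Lambda_def by (rule infsum_cong_neutral) (use nin assms in auto)
  then show "h_Lambda ord lam lamt i y n v = real j - real i" by simp
qed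

lemma g_Lambda_eq_0:
  assumes "\<And>j. j \<in> states - {i} \<Longrightarrow> v \<notin> Lambda ord lam lamt i j y n"
  shows "g_Lambda ord lam lamt i y n v = 0" "h_Lambda ord lam lamt i y n v = 0"
  unfolding g_Lambda_def h_Lambda_def by (rule infsum_0; use assms in auto)+

subsection \<open>Paths of the equation\<close>

text \<open>Levels of the monotone counter \<open>N\<close> take the place of jumps of
  \<open>X\<close>, because the equation for \<open>N\<close> turns them into masses of the driving
  measure. For a level that is never reached, the infimum of the empty set carries no
  information.\<close>

definition arrival :: "(real \<Rightarrow> nat) \<Rightarrow> nat \<Rightarrow> real" where
  "arrival N k = Inf {t. 0 \<le> t \<and> k \<le> N t}"

lemma left_lim_eqI:
  fixes f :: "real \<Rightarrow> 'b::t2_space"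
  assumes "(f \<longlongrightarrow> l) (at_left u)"
  shows "left_lim f u = l"
  unfolding left_lim_def by (rule tendsto_Lim[OF _ assms]) (simp add: trivial_limit_at_left_real)

lemma tendsto_at_left_cong:
  fixes r u :: real
  assumes "r < u" "\<And>s. r < s \<Longrightarrow> s < u \<Longrightarrow> f s = g s" "(g \<longlongrightarrow> l) (at_left u)"
  shows "(f \<longlongrightarrow> l) (at_left u)"
proof -
  have "\<forall>\<^sub>F s in at_left u. f s = g s"
    unfolding eventually_at_left[OF assms(1)] using assms by auto
  with assms(3) show ?thesis by (simp add: tendsto_cong)
qed

lemma sets_half_plane: "A \<in> sets half_plane \<longleftrightarrow> A \<in> sets borel \<and> A \<subseteq> {0..} \<times> UNIV"
proof -
  have "{0..} \<times> UNIV \<in> sets (borel :: (real \<times> real) measure)"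
    by (intro borel_closed closed_Times) auto
  then show ?thesis
    unfolding half_plane_def by (subst sets_restrict_space_iff) auto
qed

lemma space_half_plane: "space half_plane = {0..} \<times> UNIV"
  by (simp add: half_plane_def space_restrict_space)

lemma Times_UNIV_borel [measurable]:
  "A \<in> sets borel \<Longrightarrow> A \<times> (UNIV :: real set) \<in> sets (borel :: (real \<times> real) measure)"
  unfolding borel_prod[symmetric] by simp

text \<open>A single realization, with no probability left. Mass at most 1 on vertical lines
  excludes simultaneous points, which could trigger two transitions at the same time.\<close>

locale sde_path =
  fixes ord :: "(nat \<times> nat) set" and lam lamt :: "nat \<Rightarrow> nat \<Rightarrow> real \<Rightarrow> nat \<Rightarrow> real"
    and Q :: "(real \<times> real) measure" and X :: "real \<Rightarrow> nat" and Y :: "real \<Rightarrow> real" and N :: "real \<Rightarrow> nat"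
  assumes rates: "rates lam" and majorants: "rate_majorants lam lamt"
    and order: "strict_linear_order_on states ord"
    and sets_Q: "sets Q = sets half_plane"
    and int_Q: "A \<in> sets Q \<Longrightarrow> emeasure Q A \<in> insert \<infinity> (range of_nat)"
    and simple_Q: "0 < u \<Longrightarrow> emeasure Q ({u} \<times> UNIV) \<le> 1"
    and cadlag: "cadlag X" "cadlag Y" "cadlag N"
    and sol: "solves_path ord lam lamt Q X Y N"
    and X_states: "0 \<le> t \<Longrightarrow> X t \<in> states" and Y_nonneg: "0 \<le> t \<Longrightarrow> 0 \<le> Y t"
begin

abbreviation "g_at \<equiv> g_path ord lam lamt X Y N"
abbreviation "h_at \<equiv> h_path ord lam lamt X Y N"
abbreviation "Lam i j y n \<equiv> Lambda ord lam lamt i j y n"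

lemma space_Q: "space Q = {0..} \<times> UNIV"
  using sets_eq_imp_space_eq[OF sets_Q] by (simp add: space_half_plane)

lemma in_sets_Q: "A \<in> sets Q \<longleftrightarrow> A \<in> sets borel \<and> A \<subseteq> {0..} \<times> UNIV"
  unfolding sets_Q by (rule sets_half_plane)

lemma left_lim_X_states: assumes "0 < u" shows "left_lim X u \<in> states"
proof -
  obtain l where l: "(X \<longlongrightarrow> l) (at_left u)" using cadlag(1) assms unfolding cadlag_def by auto
  have "\<forall>\<^sub>F s in at_left u. X s = l" using l by (simp add: tendsto_discrete)
  moreover have "\<forall>\<^sub>F s in at_left u. 0 < s"
    unfolding eventually_at_left[OF assms] using assms by auto
  ultimately have "\<forall>\<^sub>F s in at_left u. l \<in> states"
    by eventually_elim (use X_states in force)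
  then have "l \<in> states" by (simp add: trivial_limit_at_left_real)
  with left_lim_eqI[OF l] show ?thesis by simp
qed

lemma left_lim_Y_nonneg: assumes "0 < u" shows "0 \<le> left_lim Y u"
proof -
  obtain l where l: "(Y \<longlongrightarrow> l) (at_left u)" using cadlag(2) assms unfolding cadlag_def by auto
  have "\<forall>\<^sub>F s in at_left u. 0 < s"
    unfolding eventually_at_left[OF assms] using assms by auto
  then have "\<forall>\<^sub>F s in at_left u. 0 \<le> Y s"
    by eventually_elim (use Y_nonneg in force)
  then have "0 \<le> l" by (intro tendsto_lowerbound[OF l]) (auto simp: trivial_limit_at_left_real)
  with left_lim_eqI[OF l] show ?thesis by simp
qed

lemma g_at_cases:
  assumes "0 < fst z"
  obtains "g_at z = 0" "h_at z = 0"
  | j where "j \<in> states - {left_lim X (fst z)}"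
      "snd z \<in> Lam (left_lim X (fst z)) j (left_lim Y (fst z)) (left_lim N (fst z))"
      "g_at z = 1" "h_at z = real j - real (left_lim X (fst z))"
proof -
  let ?i = "left_lim X (fst z)" and ?y = "left_lim Y (fst z)" and ?n = "left_lim N (fst z)"
  have gh: "g_at z = g_Lambda ord lam lamt ?i ?y ?n (snd z)" "h_at z = h_Lambda ord lam lamt ?i ?y ?n (snd z)"
    unfolding g_path_def h_path_def by (simp_all add: case_prod_unfold)
  show ?thesis
  proof (cases "\<exists>j\<in>states - {?i}. snd z \<in> Lam ?i j ?y ?n")
    case True
    then obtain j where j: "j \<in> states - {?i}" "snd z \<in> Lam ?i j ?y ?n" by auto
    from g_Lambda_eq[OF rates majorants order left_lim_X_states[OF assms] left_lim_Y_nonneg[OF assms] j]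
    show ?thesis using that(2) j gh by auto
  next
    case False
    with g_Lambda_eq_0[of ?i "snd z" ord lam lamt ?y ?n] show ?thesis using that(1) gh by auto
  qed
qed

text \<open>Where a point triggers a transition of this path. At positive times outside this set
  both coefficients vanish.\<close>

definition active :: "real set \<Rightarrow> (real \<times> real) set" where
  "active A = {z. fst z \<in> A \<and> g_at z = 1}"

lemma set_integrableD:
  assumes "0 \<le> t"
  shows "set_integrable Q ({0<..t} \<times> UNIV) h_at"
    and "set_integrable Q ({0<..t} \<times> UNIV) (\<lambda>z. left_lim Y (fst z) * g_at z)"
    and "set_integrable Q ({0<..t} \<times> UNIV) g_at"
  using sol assms unfolding solves_path_def by auto

text \<open>Nothing is known yet about the regularity of \<open>g_at\<close>; measurability is read
  off from the integrability clause in \<open>solves_path\<close>.\<close>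

lemma active_Ioc_sets: assumes "0 \<le> t" shows "active {0<..t} \<in> sets Q"
proof -
  have [measurable]: "(\<lambda>z. indicator ({0<..t} \<times> UNIV) z *\<^sub>R g_at z) \<in> borel_measurable Q"
    using set_integrableD(3)[OF assms] unfolding set_integrable_def by simp
  have "active {0<..t} = {z \<in> space Q. indicator ({0<..t} \<times> UNIV) z *\<^sub>R g_at z = 1}"
    by (auto simp: active_def space_Q indicator_def split: if_splits)
  also have "\<dots> \<in> sets Q" by measurable
  finally show ?thesis .
qed

lemma active_sets: assumes "A \<in> sets borel" "A \<subseteq> {0<..t}" shows "active A \<in> sets Q"
proof (cases "0 \<le> t")
  case True
  have "active A = active {0<..t} \<inter> ({0<..t} \<inter> A) \<times> UNIV" using assms by (auto simp: active_def)
  moreover have "({0<..t} \<inter> A) \<times> UNIV \<in> sets Q"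
    unfolding in_sets_Q using assms(1) by (auto intro: Times_UNIV_borel)
  ultimately show ?thesis using active_Ioc_sets[OF True] by auto
next
  case False
  then have "active A = {}" using assms by (auto simp: active_def)
  then show ?thesis by simp
qed

lemma active_interval_sets:
  assumes "0 \<le> a" shows "active {a<..t} \<in> sets Q" "active {a<..<t} \<in> sets Q"
  by (rule active_sets[of _ t]; use assms in auto)+

text \<open>At positive times \<open>g_at\<close> is 0 or 1, hence the indicator of the active set,
  and the third equation makes \<open>N\<close> the count of active mass. Integrability excludes
  infinite mass, for which \<open>measure\<close> would return 0.\<close>

lemma emeasure_active_Ioc: assumes "0 \<le> t" shows "emeasure Q (active {0<..t}) = of_nat (N t)"
proof -
  have eq: "indicator ({0<..t} \<times> UNIV) z *\<^sub>R g_at z = indicator (active {0<..t}) z" for z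
  proof (cases "0 < fst z")
    case True
    show ?thesis by (rule g_at_cases[OF True]) (auto simp: active_def indicator_def mem_Times_iff)
  qed (auto simp: active_def indicator_def mem_Times_iff)
  have "integrable Q (indicator (active {0<..t}) :: _ \<Rightarrow> real)"
    using set_integrableD(3)[OF assms] unfolding set_integrable_def eq .
  then have fin: "emeasure Q (active {0<..t}) < \<infinity>"
    by (subst (asm) integrable_indicator_iff) (use active_Ioc_sets[OF assms] in \<open>auto simp: Int_absorb2 sets.sets_into_space\<close>)
  have "real (N t) = (LINT z:{0<..t} \<times> UNIV|Q. g_at z)"
    using sol assms unfolding solves_path_def by blast
  also have "\<dots> = measure Q (active {0<..t})"
    unfolding set_lebesgue_integral_def eq
    using active_Ioc_sets[OF assms] by (simp add: Int_absorb2 sets.sets_into_space)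
  finally have "real (N t) = measure Q (active {0<..t})" .
  then show ?thesis using fin by (simp add: emeasure_eq_ennreal_measure less_top ennreal_of_nat_eq_real_of_nat)
qed

lemma N_0: "N 0 = 0"
  using emeasure_active_Ioc[of 0] by (simp add: active_def)

lemma N_mono: assumes "0 \<le> s" "s \<le> t" shows "N s \<le> N t"
proof -
  have "emeasure Q (active {0<..s}) \<le> emeasure Q (active {0<..t})"
    using assms by (intro emeasure_mono active_Ioc_sets) (auto simp: active_def)
  then show ?thesis using assms by (simp add: emeasure_active_Ioc)
qed

section \<open>Arrival times as levels of the counter\<close>

abbreviation "\<tau> \<equiv> arrival N"
abbreviation "reach k \<equiv> \<exists>t\<ge>0. k \<le> N t"

lemma arrival_nonneg: "reach k \<Longrightarrow> 0 \<le> \<tau> k"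
  unfolding arrival_def by (rule cInf_greatest) auto

text \<open>Right-continuity into a discrete space makes \<open>N\<close> constant on a short
  interval after the infimum, so the infimum is attained.\<close>

lemma le_N_arrival: assumes "reach k" shows "k \<le> N (\<tau> k)"
proof -
  have "(N \<longlongrightarrow> N (\<tau> k)) (at_right (\<tau> k))"
    using cadlag(3) arrival_nonneg[OF assms] unfolding cadlag_def by auto
  then have "\<forall>\<^sub>F s in at_right (\<tau> k). N s = N (\<tau> k)" by (simp add: tendsto_discrete)
  then obtain b where b: "\<tau> k < b" "\<And>s. \<tau> k < s \<Longrightarrow> s < b \<Longrightarrow> N s = N (\<tau> k)"
    unfolding eventually_at_right_field by auto
  have "\<exists>s\<in>{t. 0 \<le> t \<and> k \<le> N t}. s < b"
    using assms b(1) unfolding arrival_def by (intro cInf_lessD) auto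
  then obtain s where s: "0 \<le> s" "k \<le> N s" "s < b" by auto
  have "\<tau> k \<le> s" unfolding arrival_def by (rule cInf_lower) (use s in auto)
  with s b show ?thesis by (cases "s = \<tau> k") auto
qed

lemma le_N_iff: assumes "reach k" "0 \<le> s" shows "k \<le> N s \<longleftrightarrow> \<tau> k \<le> s"
proof
  assume "k \<le> N s"
  then show "\<tau> k \<le> s" unfolding arrival_def using assms(2) by (intro cInf_lower) auto
next
  assume "\<tau> k \<le> s"
  with le_N_arrival[OF assms(1)] N_mono[OF arrival_nonneg[OF assms(1)]] show "k \<le> N s"
    by (meson order_trans)
qed

lemma reach_0: "reach 0" by auto

lemma reach_Suc: "reach (Suc k) \<Longrightarrow> reach k" by (meson Suc_leD)

lemma arrival_0: "\<tau> 0 = 0"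
  using le_N_iff[OF reach_0, of 0] arrival_nonneg[OF reach_0] by simp

lemma arrival_pos: assumes "reach (Suc k)" shows "0 < \<tau> (Suc k)"
  using le_N_iff[OF assms, of 0] arrival_nonneg[OF assms] N_0 by fastforce

lemma line_sets: "0 \<le> u \<Longrightarrow> {u} \<times> UNIV \<in> sets Q"
  unfolding in_sets_Q by (auto intro: Times_UNIV_borel)

lemma emeasure_line_le: assumes "0 < u" "A \<subseteq> {u} \<times> UNIV" shows "emeasure Q A \<le> 1"
  using emeasure_mono[OF assms(2), of Q] line_sets[of u] simple_Q[OF assms(1)] assms(1)
  by (auto intro: order_trans)

lemma emeasure_Q_nat: assumes "A \<in> sets Q" "emeasure Q A \<noteq> \<infinity>" obtains m where "emeasure Q A = of_nat m"
  using int_Q[OF assms(1)] assms(2) by auto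

text \<open>Continuity from below along the times \<open>\<tau> (Suc k) - 1 / Suc m\<close>, at
  which the counter is still at most \<open>k\<close>.\<close>

lemma emeasure_active_before: assumes "reach (Suc k)" shows "emeasure Q (active {0<..<\<tau> (Suc k)}) \<le> of_nat k"
proof -
  let ?u = "\<tau> (Suc k)"
  let ?B = "\<lambda>m. active {0<..?u - 1 / real (Suc m)}"
  have "(\<Union>m. ?B m) = active {0<..<?u}"
  proof (auto simp: active_def)
    fix a m assume "a \<le> ?u - 1 / (1 + real m)"
    moreover have "0 < 1 / (1 + real m)" by simp
    ultimately show "a < ?u" by linarith
  next
    fix a assume "a < ?u"
    then obtain m where "1 / real (Suc m) < ?u - a"
      using reals_Archimedean[of "?u - a"] by (auto simp: inverse_eq_divide)
    then show "\<exists>m. a \<le> ?u - 1 / (1 + real m)" by (intro exI[of _ m]) simp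
  qed
  moreover have "(SUP m. emeasure Q (?B m)) = emeasure Q (\<Union>m. ?B m)"
  proof (rule SUP_emeasure_incseq)
    show "range ?B \<subseteq> sets Q" by (auto intro!: active_sets)
    show "incseq ?B"
    proof (rule incseq_SucI)
      fix m
      have "1 / real (Suc (Suc m)) \<le> 1 / real (Suc m)" by (intro divide_left_mono) auto
      then show "?B m \<subseteq> ?B (Suc m)" unfolding active_def by auto
    qed
  qed
  moreover have "emeasure Q (?B m) \<le> of_nat k" for m
  proof (cases "0 \<le> ?u - 1 / real (Suc m)")
    case True
    have "\<not> Suc k \<le> N (?u - 1 / real (Suc m))"
      using le_N_iff[OF assms True] by simp
    then show ?thesis using emeasure_active_Ioc[OF True] by simp
  next
    case False
    then have "?B m = {}" by (auto simp: active_def)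
    then show ?thesis by simp
  qed
  ultimately show ?thesis by (metis SUP_least)
qed

text \<open>The mass before the arrival is at most \<open>k\<close>, the mass on its line is at most
  1, both are integers, and together they make at least \<open>k + 1\<close>. So both bounds are
  attained.\<close>

lemma arrival_facts:
  assumes "reach (Suc k)"
  shows "N (\<tau> (Suc k)) = Suc k"
    and "emeasure Q (active {\<tau> (Suc k)}) = 1"
    and "emeasure Q (active {0<..<\<tau> (Suc k)}) = of_nat k"
proof -
  let ?u = "\<tau> (Suc k)"
  have u: "0 < ?u" by (rule arrival_pos) fact
  have s1: "active {0<..<?u} \<in> sets Q" by (rule active_sets[of _ ?u]) auto
  have s2: "active {?u} \<in> sets Q" by (rule active_sets[of _ ?u]) (use u in auto)
  have b1: "emeasure Q (active {0<..<?u}) \<le> of_nat k" by (rule emeasure_active_before) fact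
  have b2: "emeasure Q (active {?u}) \<le> 1" by (rule emeasure_line_le[OF u]) (auto simp: active_def)
  obtain a where a: "emeasure Q (active {0<..<?u}) = of_nat a"
    by (rule emeasure_Q_nat[OF s1]) (use b1 in \<open>auto simp: top_unique\<close>)
  obtain b where b: "emeasure Q (active {?u}) = of_nat b"
    by (rule emeasure_Q_nat[OF s2]) (use b2 in \<open>auto simp: top_unique\<close>)
  have "active {0<..?u} = active {0<..<?u} \<union> active {?u}" using u by (auto simp: active_def)
  then have "emeasure Q (active {0<..?u}) = emeasure Q (active {0<..<?u}) + emeasure Q (active {?u})"
    using s1 s2 by (simp add: plus_emeasure active_def disjoint_iff)
  then have "of_nat (N ?u) = (of_nat (a + b) :: ennreal)"
    using u by (simp add: emeasure_active_Ioc a b)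
  then have N: "N ?u = a + b" by (simp only: of_nat_eq_iff)
  have ak: "a \<le> k" using b1 unfolding a by simp
  have "of_nat b \<le> (of_nat 1 :: ennreal)" using b2 unfolding b by simp
  then have b1: "b \<le> 1" by (simp only: of_nat_le_iff)
  show "N ?u = Suc k" "emeasure Q (active {?u}) = 1" "emeasure Q (active {0<..<?u}) = of_nat k"
    using N ak b1 le_N_arrival[OF assms] a b by (auto simp: le_Suc_eq)
qed

lemma N_arrival: assumes "reach k" shows "N (\<tau> k) = k"
  using arrival_facts(1) assms by (cases k) (auto simp: arrival_0 N_0)

lemma arrival_less: assumes "reach (Suc k)" shows "\<tau> k < \<tau> (Suc k)"
proof -
  have r: "reach k" using assms by (rule reach_Suc)
  have "\<tau> k \<le> \<tau> (Suc k)"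
    using le_N_iff[OF r, of "\<tau> (Suc k)"] N_arrival[OF assms] arrival_pos[OF assms] by simp
  moreover have "\<tau> k \<noteq> \<tau> (Suc k)" using N_arrival[OF assms] N_arrival[OF r] by auto
  ultimately show ?thesis by simp
qed

text \<open>The times whose left limits belong to the \<open>k\<close>-th cycle. The closing arrival
  is included, since coefficients are evaluated at left limits, and the set is unbounded if no
  further arrival occurs.\<close>

definition live :: "nat \<Rightarrow> real set" where
  "live k = {u. \<tau> k < u \<and> (\<forall>s. 0 \<le> s \<and> s < u \<longrightarrow> N s \<le> k)}"

lemma live_reach: assumes "reach (Suc k)" shows "live k = {\<tau> k<..\<tau> (Suc k)}"
proof -
  have "(\<forall>s. 0 \<le> s \<and> s < u \<longrightarrow> N s \<le> k) \<longleftrightarrow> u \<le> \<tau> (Suc k)" for u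
  proof
    assume *: "\<forall>s. 0 \<le> s \<and> s < u \<longrightarrow> N s \<le> k"
    show "u \<le> \<tau> (Suc k)"
      using *[rule_format, of "\<tau> (Suc k)"] arrival_nonneg[OF assms] N_arrival[OF assms] by fastforce
  next
    assume "u \<le> \<tau> (Suc k)"
    moreover have "N s \<le> k" if "0 \<le> s" "s < \<tau> (Suc k)" for s
      using le_N_iff[OF assms that(1)] that(2) by auto
    ultimately show "\<forall>s. 0 \<le> s \<and> s < u \<longrightarrow> N s \<le> k" by auto
  qed
  then show ?thesis unfolding live_def by auto
qed

lemma live_not_reach: "\<not> reach (Suc k) \<Longrightarrow> live k = {\<tau> k<..}"
  unfolding live_def using not_less_eq_eq by auto

lemma emeasure_active_gap:
  assumes "reach k" "\<tau> k \<le> t" "N t \<le> k"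
  shows "emeasure Q (active {\<tau> k<..t}) = 0"
proof -
  have nn: "0 \<le> \<tau> k" by (rule arrival_nonneg) fact
  have "active {0<..t} = active {0<..\<tau> k} \<union> active {\<tau> k<..t}" using nn assms(2) by (auto simp: active_def)
  moreover have "active {0<..\<tau> k} \<in> sets Q" "active {\<tau> k<..t} \<in> sets Q"
    using active_interval_sets[OF nn] active_Ioc_sets[OF nn] by auto
  ultimately have "emeasure Q (active {0<..t}) = emeasure Q (active {0<..\<tau> k}) + emeasure Q (active {\<tau> k<..t})"
    by (simp add: plus_emeasure active_def disjoint_iff)
  moreover have "N t = k" using assms N_mono[OF nn assms(2)] N_arrival[OF assms(1)] by simp
  ultimately show ?thesis
    using nn assms(2) by (simp add: emeasure_active_Ioc N_arrival[OF assms(1)])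
qed

lemma emeasure_active_open_gap:
  assumes "reach (Suc k)"
  shows "emeasure Q (active {\<tau> k<..<\<tau> (Suc k)}) = 0"
proof -
  have r: "reach k" using assms by (rule reach_Suc)
  have nn: "0 \<le> \<tau> k" using r by (rule arrival_nonneg)
  have lt: "\<tau> k < \<tau> (Suc k)" using assms by (rule arrival_less)
  have "active {0<..<\<tau> (Suc k)} = active {0<..\<tau> k} \<union> active {\<tau> k<..<\<tau> (Suc k)}" using nn lt by (auto simp: active_def)
  moreover have "active {0<..\<tau> k} \<in> sets Q" "active {\<tau> k<..<\<tau> (Suc k)} \<in> sets Q"
    using active_interval_sets[OF nn] active_Ioc_sets[OF nn] by auto
  ultimately have "emeasure Q (active {0<..<\<tau> (Suc k)}) = emeasure Q (active {0<..\<tau> k}) + emeasure Q (active {\<tau> k<..<\<tau> (Suc k)})"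
    by (simp add: plus_emeasure active_def disjoint_iff)
  then show ?thesis
    using nn by (simp add: emeasure_active_Ioc N_arrival[OF r] arrival_facts(3)[OF assms])
qed

lemma increments:
  assumes "0 \<le> s" "s \<le> t"
  shows "real (X t) = real (X s) + (LINT z:{s<..t} \<times> UNIV|Q. h_at z)"
    and "Y t = Y s + (t - s) - (LINT z:{s<..t} \<times> UNIV|Q. left_lim Y (fst z) * g_at z)"
proof -
  have t: "0 \<le> t" using assms by simp
  have U: "{0<..t} \<times> UNIV = {0<..s} \<times> UNIV \<union> {s<..t} \<times> (UNIV :: real set)" using assms by auto
  have D: "{0<..s} \<times> UNIV \<inter> {s<..t} \<times> (UNIV :: real set) = {}" by auto
  have S: "{s<..t} \<times> UNIV \<in> sets Q" using assms(1) unfolding in_sets_Q by (auto intro: Times_UNIV_borel)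
  have *: "(LINT z:{0<..t} \<times> UNIV|Q. f z) = (LINT z:{0<..s} \<times> UNIV|Q. f z) + (LINT z:{s<..t} \<times> UNIV|Q. f z)"
    if f: "set_integrable Q ({0<..t} \<times> UNIV) f" "set_integrable Q ({0<..s} \<times> UNIV) f" for f :: "_ \<Rightarrow> real"
    unfolding U
    by (rule set_integral_Un[OF D f(2)]) (rule set_integrable_subset[OF f(1) S], use assms in auto)
  note eqs = sol[unfolded solves_path_def, rule_format]
  show "real (X t) = real (X s) + (LINT z:{s<..t} \<times> UNIV|Q. h_at z)"
    using eqs[OF t] eqs[OF assms(1)] *[OF set_integrableD(1)[OF t] set_integrableD(1)[OF assms(1)]] by linarith
  show "Y t = Y s + (t - s) - (LINT z:{s<..t} \<times> UNIV|Q. left_lim Y (fst z) * g_at z)"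
    using eqs[OF t] eqs[OF assms(1)] *[OF set_integrableD(2)[OF t] set_integrableD(2)[OF assms(1)]] by linarith
qed

text \<open>No active mass lies between the arrival and \<open>t\<close>, so both integrands vanish
  almost everywhere with respect to \<open>Q\<close>, and only the drift of the age remains.\<close>

lemma between_arrivals:
  assumes "reach k" "\<tau> k \<le> t" "N t \<le> k"
  shows "N t = k" "X t = X (\<tau> k)" "Y t = Y (\<tau> k) + (t - \<tau> k)"
proof -
  have nn: "0 \<le> \<tau> k" by (rule arrival_nonneg) fact
  show "N t = k" using assms N_mono[OF nn assms(2)] N_arrival[OF assms(1)] by simp
  have "active {\<tau> k<..t} \<in> null_sets Q"
    using emeasure_active_gap[OF assms] active_interval_sets[OF nn] by (auto simp: null_sets_def)
  then have ae: "AE z in Q. z \<notin> active {\<tau> k<..t}" by (rule AE_not_in)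
  have "(LINT z:{\<tau> k<..t} \<times> UNIV|Q. h_at z) = 0"
    unfolding set_lebesgue_integral_def
  proof (rule integral_eq_zero_AE)
    show "AE z in Q. indicator ({\<tau> k<..t} \<times> UNIV) z *\<^sub>R h_at z = 0"
      using ae
    proof eventually_elim
      case (elim z)
      show ?case
      proof (cases "\<tau> k < fst z")
        case True
        then have "0 < fst z" using nn by simp
        then show ?thesis by (rule g_at_cases) (use elim in \<open>auto simp: active_def indicator_def mem_Times_iff\<close>)
      qed (auto simp: indicator_def mem_Times_iff)
    qed
  qed
  then show "X t = X (\<tau> k)" using increments(1)[OF nn assms(2)] by simp
  have "(LINT z:{\<tau> k<..t} \<times> UNIV|Q. left_lim Y (fst z) * g_at z) = 0"
    unfolding set_lebesgue_integral_def
  proof (rule integral_eq_zero_AE)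
    show "AE z in Q. indicator ({\<tau> k<..t} \<times> UNIV) z *\<^sub>R (left_lim Y (fst z) * g_at z) = 0"
      using ae
    proof eventually_elim
      case (elim z)
      show ?case
      proof (cases "\<tau> k < fst z")
        case True
        then have "0 < fst z" using nn by simp
        then show ?thesis by (rule g_at_cases) (use elim in \<open>auto simp: active_def indicator_def mem_Times_iff\<close>)
      qed (auto simp: indicator_def mem_Times_iff)
    qed
  qed
  then show "Y t = Y (\<tau> k) + (t - \<tau> k)" using increments(2)[OF nn assms(2)] by simp
qed

lemma left_lims:
  assumes "reach k" "u \<in> live k"
  shows "left_lim X u = X (\<tau> k)" "left_lim N u = k" "left_lim Y u = Y (\<tau> k) + (u - \<tau> k)"
proof -
  have nn: "0 \<le> \<tau> k" by (rule arrival_nonneg) fact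
  have lt: "\<tau> k < u" and N: "\<And>s. 0 \<le> s \<Longrightarrow> s < u \<Longrightarrow> N s \<le> k"
    using assms(2) unfolding live_def by auto
  have *: "N s = k" "X s = X (\<tau> k)" "Y s = Y (\<tau> k) + (s - \<tau> k)" if "\<tau> k < s" "s < u" for s
    using between_arrivals[OF assms(1), of s] N[of s] nn that by auto
  show "left_lim X u = X (\<tau> k)"
    by (rule left_lim_eqI, rule tendsto_at_left_cong[OF lt, of _ "\<lambda>_. X (\<tau> k)"]) (auto simp: *)
  show "left_lim N u = k"
    by (rule left_lim_eqI, rule tendsto_at_left_cong[OF lt, of _ "\<lambda>_. k"]) (auto simp: *)
  show "left_lim Y u = Y (\<tau> k) + (u - \<tau> k)"
    by (rule left_lim_eqI, rule tendsto_at_left_cong[OF lt, of _ "\<lambda>s. Y (\<tau> k) + (s - \<tau> k)"])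
      (auto simp: * intro!: tendsto_intros)
qed

section \<open>The transition that ends a cycle\<close>

text \<open>State, count and age are extrapolated from \<open>\<tau> k\<close> as if no later jump
  occurred. The region is therefore fixed by what is known at \<open>\<tau> k\<close>, and it agrees
  with the actual coefficients on \<open>live k\<close>.\<close>

definition jump_region :: "nat \<Rightarrow> nat \<Rightarrow> (real \<times> real) set" where
  "jump_region k j = {(u, v). \<tau> k < u \<and> v \<in> Lam (X (\<tau> k)) j (Y (\<tau> k) + (u - \<tau> k)) k}"

abbreviation "targets k \<equiv> states - {X (\<tau> k)}"

lemma jump_region_borel: assumes "reach k" "j \<in> targets k" shows "jump_region k j \<in> sets borel"
proof -
  let ?L = "{(y, v). 0 \<le> y \<and> v \<in> Lam (X (\<tau> k)) j y k}"
  have nn: "0 \<le> Y (\<tau> k)" "X (\<tau> k) \<in> states" using arrival_nonneg[OF assms(1)] by (auto intro: Y_nonneg X_states)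
  have L: "?L \<in> sets (borel \<Otimes>\<^sub>M borel)"
    using Lambda_region_measurable[OF rates majorants nn(2) assms(2), of ord k] unfolding borel_prod .
  have "(\<lambda>z. (Y (\<tau> k) + (fst z - \<tau> k), snd z)) \<in> borel \<Otimes>\<^sub>M borel \<rightarrow>\<^sub>M borel \<Otimes>\<^sub>M borel" by measurable
  from measurable_sets[OF this L]
  have "(\<lambda>z. (Y (\<tau> k) + (fst z - \<tau> k), snd z)) -` ?L \<inter> ({\<tau> k<..} \<times> UNIV) \<in> sets (borel \<Otimes>\<^sub>M borel)"
    by (auto simp: space_pair_measure)
  also have "(\<lambda>z. (Y (\<tau> k) + (fst z - \<tau> k), snd z)) -` ?L \<inter> ({\<tau> k<..} \<times> UNIV) = jump_region k j"
    using nn by (auto simp: jump_region_def)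
  finally show ?thesis unfolding borel_prod .
qed

lemma jump_region_sets:
  assumes "reach k" "j \<in> targets k" "A \<in> sets borel"
  shows "jump_region k j \<inter> A \<times> UNIV \<in> sets Q"
  using jump_region_borel[OF assms(1,2)] assms(3) arrival_nonneg[OF assms(1)] unfolding in_sets_Q
  by (auto intro!: sets.Int Times_UNIV_borel simp: jump_region_def)

lemma jump_region_disjoint:
  assumes "reach k" "j \<in> targets k" "j' \<in> targets k" "j \<noteq> j'"
  shows "jump_region k j \<inter> jump_region k j' = {}"
proof -
  have nn: "0 \<le> Y (\<tau> k)" "X (\<tau> k) \<in> states" using arrival_nonneg[OF assms(1)] by (auto intro: Y_nonneg X_states)
  have "Lam (X (\<tau> k)) j y k \<inter> Lam (X (\<tau> k)) j' y k = {}" if "0 \<le> y" for y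
    by (rule Lambda_disjoint[OF rates majorants order nn(2) assms(2-4) that])
  then have "Lam (X (\<tau> k)) j (Y (\<tau> k) + (u - \<tau> k)) k \<inter> Lam (X (\<tau> k)) j' (Y (\<tau> k) + (u - \<tau> k)) k = {}"
    if "\<tau> k < u" for u using nn(1) that by simp
  then show ?thesis unfolding jump_region_def by auto
qed

lemma live_cases:
  assumes "reach k" "fst z \<in> live k"
  obtains "g_at z = 0" "h_at z = 0" "\<And>j. j \<in> targets k \<Longrightarrow> z \<notin> jump_region k j"
  | j where "j \<in> targets k" "z \<in> jump_region k j" "g_at z = 1" "h_at z = real j - real (X (\<tau> k))"
proof -
  have nn: "0 \<le> \<tau> k" by (rule arrival_nonneg) fact
  have lt: "\<tau> k < fst z" using assms(2) unfolding live_def by auto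
  have pos: "0 < fst z" "0 \<le> Y (\<tau> k) + (fst z - \<tau> k)" "X (\<tau> k) \<in> states"
    using nn lt Y_nonneg[OF nn] by (auto intro: X_states)
  have gh: "g_at z = g_Lambda ord lam lamt (X (\<tau> k)) (Y (\<tau> k) + (fst z - \<tau> k)) k (snd z)"
    "h_at z = h_Lambda ord lam lamt (X (\<tau> k)) (Y (\<tau> k) + (fst z - \<tau> k)) k (snd z)"
    unfolding g_path_def h_path_def by (simp_all add: case_prod_unfold left_lims[OF assms])
  have mem: "z \<in> jump_region k j \<longleftrightarrow> snd z \<in> Lam (X (\<tau> k)) j (Y (\<tau> k) + (fst z - \<tau> k)) k" for j
    using lt by (cases z) (simp add: jump_region_def)
  show ?thesis
  proof (cases "\<exists>j\<in>targets k. z \<in> jump_region k j")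
    case True
    then obtain j where j: "j \<in> targets k" "z \<in> jump_region k j" by auto
    then show ?thesis
      using that(2)[OF j] g_Lambda_eq[OF rates majorants order pos(3,2) j(1) j(2)[unfolded mem]] gh by auto
  next
    case False
    then have "g_at z = 0" "h_at z = 0"
      using g_Lambda_eq_0[of "X (\<tau> k)" "snd z" ord lam lamt] gh unfolding mem by auto
    then show ?thesis using that(1) False by auto
  qed
qed

text \<open>The active mass 1 on the line is split among countably many disjoint regions, each of
  integer mass, so it sits in exactly one of them. The increment of \<open>X\<close> is then the
  displacement to that target, and the integral in the equation for \<open>Y\<close> cancels the age
  reached.\<close>

lemma arrival_Suc:
  assumes "reach (Suc k)"
  shows "X (\<tau> (Suc k)) \<in> targets k" and "Y (\<tau> (Suc k)) = 0"
    and "\<And>j'. j' \<in> targets k \<Longrightarrow>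
      emeasure Q (jump_region k j' \<inter> {\<tau> (Suc k)} \<times> UNIV) = of_bool (j' = X (\<tau> (Suc k)))"
proof -
  let ?u = "\<tau> (Suc k)" and ?y = "Y (\<tau> k) + (\<tau> (Suc k) - \<tau> k)"
  let ?R = "\<lambda>j. jump_region k j \<inter> {?u} \<times> UNIV"
  have r: "reach k" using assms by (rule reach_Suc)
  have nn: "0 \<le> \<tau> k" using r by (rule arrival_nonneg)
  have lt: "\<tau> k < ?u" using assms by (rule arrival_less)
  have live: "live k = {\<tau> k<..?u}" using assms by (rule live_reach)
  have Rs: "?R j \<in> sets Q" if "j \<in> targets k" for j using jump_region_sets[OF r that] by auto
  have G: "active {?u} = (\<Union>j\<in>targets k. ?R j)"
  proof (intro set_eqI)
    fix z
    show "z \<in> active {?u} \<longleftrightarrow> z \<in> (\<Union>j\<in>targets k. ?R j)"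
    proof (cases "fst z = ?u")
      case True
      then have "fst z \<in> live k" using lt by (simp add: live)
      then show ?thesis by (rule live_cases[OF r]) (use True in \<open>auto simp: active_def mem_Times_iff\<close>)
    qed (auto simp: active_def)
  qed
  have "\<exists>j\<in>targets k. emeasure Q (?R j) \<noteq> 0"
  proof (rule ccontr)
    assume "\<not> ?thesis"
    then have "(\<Union>j\<in>targets k. ?R j) \<in> null_sets Q"
      using Rs by (intro null_sets_UN') auto
    then show False using arrival_facts(2)[OF assms] unfolding G by auto
  qed
  then obtain j where j: "j \<in> targets k" "emeasure Q (?R j) \<noteq> 0" by auto
  have le1: "emeasure Q A \<le> 1" if "A \<subseteq> {?u} \<times> UNIV" for A
    using nn lt that by (intro emeasure_line_le[of ?u]) auto
  obtain m where m: "emeasure Q (?R j) = of_nat m"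
    by (rule emeasure_Q_nat[OF Rs[OF j(1)]]) (use le1[of "?R j"] in \<open>auto simp: top_unique\<close>)
  have "of_nat m \<le> (of_nat 1 :: ennreal)" using le1[of "?R j"] m by simp
  then have "m \<le> 1" by (simp only: of_nat_le_iff)
  with j m have one: "emeasure Q (?R j) = 1" by (cases m) auto
  have zero: "emeasure Q (?R j') = 0" if j': "j' \<in> targets k" "j' \<noteq> j" for j'
  proof -
    have "emeasure Q (?R j) + emeasure Q (?R j') = emeasure Q (?R j \<union> ?R j')"
      using jump_region_disjoint[OF r j(1) j'(1)] j' Rs j by (intro plus_emeasure) auto
    also have "\<dots> \<le> 1 + 0" using le1[of "?R j \<union> ?R j'"] by auto
    finally show ?thesis unfolding one by (subst (asm) ennreal_add_left_cancel_le) auto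
  qed
  have "active {\<tau> k<..<?u} \<in> null_sets Q"
    using emeasure_active_open_gap[OF assms] active_interval_sets[OF nn] by (auto simp: null_sets_def)
  then have ae1: "AE z in Q. z \<notin> active {\<tau> k<..<?u}" by (rule AE_not_in)
  have "(\<Union>j'\<in>targets k - {j}. ?R j') \<in> null_sets Q"
    using zero Rs by (intro null_sets_UN') auto
  then have ae2: "AE z in Q. z \<notin> (\<Union>j'\<in>targets k - {j}. ?R j')" by (rule AE_not_in)
  \<comment> \<open>Off the two null sets, a point of the cycle that triggers anything lies on the
    closing line and in the region of \<open>j\<close>, and there the left limit of \<open>Y\<close>
    is the constant \<open>?y\<close>.\<close>
  have key: "(indicator ({\<tau> k<..?u} \<times> UNIV) z *\<^sub>R h_at z = (real j - real (X (\<tau> k))) * indicator (?R j) z) \<and>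
      (indicator ({\<tau> k<..?u} \<times> UNIV) z *\<^sub>R (left_lim Y (fst z) * g_at z) = ?y * indicator (?R j) z)"
    if z: "z \<notin> active {\<tau> k<..<?u}" "z \<notin> (\<Union>j'\<in>targets k - {j}. ?R j')" for z
  proof (cases "fst z \<in> live k")
    case True
    show ?thesis
    proof (rule live_cases[OF r True])
      fix j' assume j': "j' \<in> targets k" "z \<in> jump_region k j'" "g_at z = 1" "h_at z = real j' - real (X (\<tau> k))"
      have "fst z = ?u" using z(1) j'(3) True unfolding live by (auto simp: active_def)
      moreover then have "j' = j" using z(2) j' by (auto simp: mem_Times_iff)
      moreover have "left_lim Y (fst z) = ?y" using left_lims(3)[OF r True] \<open>fst z = ?u\<close> by simp
      ultimately show ?thesis using j' lt by (auto simp: mem_Times_iff indicator_def)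
    qed (use j in \<open>auto simp: indicator_def\<close>)
  next
    case False
    then show ?thesis using lt by (auto simp: live indicator_def)
  qed
  have meas: "measure Q (?R j) = 1" using one by (simp add: measure_def)
  have ind: "(LINT z|Q. c * indicator (?R j) z) = c" for c :: real
  proof -
    have "?R j \<inter> space Q = ?R j" using sets.sets_into_space[OF Rs[OF j(1)]] by auto
    then show ?thesis using meas by simp
  qed
  have "(LINT z:{\<tau> k<..?u} \<times> UNIV|Q. h_at z) = (LINT z|Q. (real j - real (X (\<tau> k))) * indicator (?R j) z)"
    unfolding set_lebesgue_integral_def
  proof (rule integral_cong_AE)
    show "(\<lambda>z. indicator ({\<tau> k<..?u} \<times> UNIV) z *\<^sub>R h_at z) \<in> borel_measurable Q"
    proof -
      have "set_integrable Q ({\<tau> k<..?u} \<times> UNIV) h_at"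
        by (rule set_integrable_subset[OF set_integrableD(1)[of ?u]])
          (use nn lt in \<open>auto simp: in_sets_Q intro: Times_UNIV_borel\<close>)
      then show ?thesis unfolding set_integrable_def by simp
    qed
    show "AE z in Q. indicator ({\<tau> k<..?u} \<times> UNIV) z *\<^sub>R h_at z = (real j - real (X (\<tau> k))) * indicator (?R j) z"
      using ae1 ae2 by eventually_elim (use key in blast)
  qed (use Rs[OF j(1)] in auto)
  then have "real (X ?u) = real j" using increments(1)[OF nn less_imp_le[OF lt]] unfolding ind by simp
  then have X: "X ?u = j" by simp
  have "(LINT z:{\<tau> k<..?u} \<times> UNIV|Q. left_lim Y (fst z) * g_at z) = (LINT z|Q. ?y * indicator (?R j) z)"
    unfolding set_lebesgue_integral_def
  proof (rule integral_cong_AE)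
    show "(\<lambda>z. indicator ({\<tau> k<..?u} \<times> UNIV) z *\<^sub>R (left_lim Y (fst z) * g_at z)) \<in> borel_measurable Q"
    proof -
      have "set_integrable Q ({\<tau> k<..?u} \<times> UNIV) (\<lambda>z. left_lim Y (fst z) * g_at z)"
        by (rule set_integrable_subset[OF set_integrableD(2)[of ?u]])
          (use nn lt in \<open>auto simp: in_sets_Q intro: Times_UNIV_borel\<close>)
      then show ?thesis unfolding set_integrable_def by simp
    qed
    show "AE z in Q. indicator ({\<tau> k<..?u} \<times> UNIV) z *\<^sub>R (left_lim Y (fst z) * g_at z) = ?y * indicator (?R j) z"
      using ae1 ae2 by eventually_elim (use key in blast)
  qed (use Rs[OF j(1)] in auto)
  then show "Y ?u = 0" using increments(2)[OF nn less_imp_le[OF lt]] unfolding ind by simp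
  show "X ?u \<in> targets k" using j X by simp
  show "emeasure Q (?R j') = of_bool (j' = X ?u)" if "j' \<in> targets k" for j'
    using zero[OF that] one X by (cases "j' = j") auto
qed

text \<open>All active mass of the cycle sits on its closing line, where \<open>arrival_Suc\<close>
  locates it. If no further arrival occurs, the live part of the region is covered by countably many
  active sets of mass 0.\<close>

lemma emeasure_jump_region_live:
  assumes "reach k" "j \<in> targets k" "A \<in> sets borel"
  shows "emeasure Q (jump_region k j \<inter> (live k \<inter> A) \<times> UNIV) =
    of_bool (reach (Suc k) \<and> \<tau> (Suc k) \<in> A \<and> X (\<tau> (Suc k)) = j)"
proof (cases "reach (Suc k)")
  case True
  let ?u = "\<tau> (Suc k)"
  have nn: "0 \<le> \<tau> k" using assms(1) by (rule arrival_nonneg)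
  have lt: "\<tau> k < ?u" using True by (rule arrival_less)
  have live: "live k = {\<tau> k<..?u}" using True by (rule live_reach)
  have "active {\<tau> k<..<?u} \<in> null_sets Q"
    using emeasure_active_open_gap[OF True] active_interval_sets[OF nn] by (auto simp: null_sets_def)
  then have "AE z in Q. z \<notin> active {\<tau> k<..<?u}" by (rule AE_not_in)
  then have "AE z in Q. z \<in> jump_region k j \<inter> (live k \<inter> A) \<times> UNIV \<longleftrightarrow> z \<in> jump_region k j \<inter> ({?u} \<inter> A) \<times> UNIV"
  proof eventually_elim
    case (elim z)
    have "fst z = ?u" if "z \<in> jump_region k j" "fst z \<in> live k"
      by (rule live_cases[OF assms(1) that(2)]) (use that elim assms(2) in \<open>auto simp: active_def live\<close>)
    then show ?case using lt by (auto simp: mem_Times_iff live)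
  qed
  then have "emeasure Q (jump_region k j \<inter> (live k \<inter> A) \<times> UNIV) = emeasure Q (jump_region k j \<inter> ({?u} \<inter> A) \<times> UNIV)"
    by (rule emeasure_eq_AE) (auto intro!: jump_region_sets assms simp: live)
  also have "\<dots> = of_bool (?u \<in> A \<and> X ?u = j)"
    using arrival_Suc(3)[OF True assms(2)] by (cases "?u \<in> A") auto
  finally show ?thesis using True by simp
next
  case False
  have live: "live k = {\<tau> k<..}" using False by (rule live_not_reach)
  have nn: "0 \<le> \<tau> k" using assms(1) by (rule arrival_nonneg)
  have "active {\<tau> k<..\<tau> k + real m} \<in> null_sets Q" for m
  proof -
    have "N (\<tau> k + real m) \<le> k" using False nn by (auto simp: not_less_eq_eq)
    then show ?thesis
      using emeasure_active_gap[OF assms(1)] active_interval_sets[OF nn] nn by (auto simp: null_sets_def)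
  qed
  then have null: "(\<Union>m. active {\<tau> k<..\<tau> k + real m}) \<in> null_sets Q" by (rule null_sets_UN)
  have "jump_region k j \<inter> (live k \<inter> A) \<times> UNIV \<subseteq> (\<Union>m. active {\<tau> k<..\<tau> k + real m})"
  proof
    fix z assume z: "z \<in> jump_region k j \<inter> (live k \<inter> A) \<times> UNIV"
    then have zl: "fst z \<in> live k" by auto
    obtain m where "fst z - \<tau> k \<le> real m" using real_arch_simple by blast
    moreover have "g_at z = 1" by (rule live_cases[OF assms(1) zl]) (use z assms(2) in auto)
    ultimately show "z \<in> (\<Union>m. active {\<tau> k<..\<tau> k + real m})"
      using zl by (auto simp: active_def live intro!: exI[of _ m])
  qed
  moreover have "jump_region k j \<inter> (live k \<inter> A) \<times> UNIV \<in> sets Q"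
    using assms by (intro jump_region_sets) (auto simp: live)
  ultimately have "emeasure Q (jump_region k j \<inter> (live k \<inter> A) \<times> UNIV) = 0"
    using null by (meson null_sets_subset null_setsD1)
  with False show ?thesis by auto
qed

lemma Suc_le_N_iff:
  assumes "reach k" "0 \<le> t"
  shows "Suc k \<le> N t \<longleftrightarrow> emeasure Q ((\<Union>j\<in>targets k. jump_region k j) \<inter> {0<..t} \<times> UNIV) \<noteq> 0"
proof
  have S: "(\<Union>j\<in>targets k. jump_region k j) \<inter> {0<..t} \<times> UNIV \<in> sets Q"
    unfolding in_sets_Q using jump_region_borel[OF assms(1)] by (auto intro!: sets.Int sets.countable_UN' Times_UNIV_borel)
  {
    assume N: "Suc k \<le> N t"
    then have r: "reach (Suc k)" using assms(2) by auto
    then have u: "0 < \<tau> (Suc k)" "\<tau> (Suc k) \<le> t" using le_N_iff[OF r assms(2)] arrival_pos[OF r] N by auto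
    obtain j where j: "j \<in> targets k" "emeasure Q (jump_region k j \<inter> {\<tau> (Suc k)} \<times> UNIV) = 1"
      using arrival_Suc(1,3)[OF r] by simp
    have "emeasure Q (jump_region k j \<inter> {\<tau> (Suc k)} \<times> UNIV) \<le> emeasure Q ((\<Union>j\<in>targets k. jump_region k j) \<inter> {0<..t} \<times> UNIV)"
      using j(1) u by (intro emeasure_mono S) auto
    then show "emeasure Q ((\<Union>j\<in>targets k. jump_region k j) \<inter> {0<..t} \<times> UNIV) \<noteq> 0"
      unfolding j(2) by auto
  }
  {
    assume ne: "emeasure Q ((\<Union>j\<in>targets k. jump_region k j) \<inter> {0<..t} \<times> UNIV) \<noteq> 0"
    show "Suc k \<le> N t"
    proof (rule ccontr)
      assume "\<not> Suc k \<le> N t"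
      then have N: "N t \<le> k" by simp
      have sub: "(\<Union>j\<in>targets k. jump_region k j) \<inter> {0<..t} \<times> UNIV \<subseteq> active {\<tau> k<..t}"
      proof
        fix z assume z: "z \<in> (\<Union>j\<in>targets k. jump_region k j) \<inter> {0<..t} \<times> UNIV"
        then have u: "\<tau> k < fst z" "fst z \<le> t" by (auto simp: jump_region_def)
        have zl: "fst z \<in> live k" unfolding live_def using u N N_mono[of _ t] by (fastforce intro: order_trans)
        have "g_at z = 1" by (rule live_cases[OF assms(1) zl]) (use z in auto)
        then show "z \<in> active {\<tau> k<..t}" using u by (auto simp: active_def)
      qed
      have "emeasure Q (active {\<tau> k<..t}) = 0"
      proof (cases "\<tau> k \<le> t")
        case True then show ?thesis using emeasure_active_gap[OF assms(1) _ N] by simp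
      next
        case False then have "active {\<tau> k<..t} = {}" by (auto simp: active_def)
        then show ?thesis by simp
      qed
      moreover have "active {\<tau> k<..t} \<in> sets Q"
        using active_interval_sets[OF arrival_nonneg[OF assms(1)]] by auto
      ultimately show False using ne emeasure_mono[OF sub, of Q] by simp
    qed
  }
qed

text \<open>\<open>X\<close> keeps its value strictly between arrivals and changes at each of them,
  because a target differs from the current state. So the infimum in \<open>jump_time\<close> is
  attained at the next arrival.\<close>

lemma jump_time_eq_arrival:
  assumes "\<And>k. reach k"
  shows "jump_time X k = \<tau> k"
proof (induction k)
  case 0
  show ?case by (simp add: arrival_0)
next
  case (Suc k)
  have live: "live k = {\<tau> k<..\<tau> (Suc k)}" using assms by (rule live_reach)
  have lt: "\<tau> k < \<tau> (Suc k)" using assms by (rule arrival_less)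
  have "Inf {t. \<tau> k < t \<and> X t \<noteq> left_lim X t} = \<tau> (Suc k)"
  proof (rule cInf_eq_minimum)
    have "left_lim X (\<tau> (Suc k)) = X (\<tau> k)" using left_lims(1)[OF assms, of "\<tau> (Suc k)" k] lt live by auto
    moreover have "X (\<tau> (Suc k)) \<noteq> X (\<tau> k)" using arrival_Suc(1)[OF assms, of k] by auto
    ultimately show "\<tau> (Suc k) \<in> {t. \<tau> k < t \<and> X t \<noteq> left_lim X t}" using lt by auto
  next
    fix t assume t: "t \<in> {t. \<tau> k < t \<and> X t \<noteq> left_lim X t}"
    show "\<tau> (Suc k) \<le> t"
    proof (rule ccontr)
      assume "\<not> \<tau> (Suc k) \<le> t"
      then have t2: "\<tau> k < t" "t < \<tau> (Suc k)" using t by auto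
      have "0 \<le> t" using arrival_nonneg[OF assms, of k] t2 by simp
      then have "N t \<le> k" using le_N_iff[OF assms, of t "Suc k"] t2 by auto
      then have "X t = X (\<tau> k)" using between_arrivals[OF assms] t2 by auto
      moreover have "left_lim X t = X (\<tau> k)" using left_lims(1)[OF assms, of t k] t2 live by auto
      ultimately show False using t by auto
    qed
  qed
  then show ?case using Suc.IH by simp
qed

end

subsection \<open>Poisson random measures\<close>

lemma emeasure_half_plane:
  assumes "B \<in> sets half_plane" shows "emeasure half_plane B = emeasure lborel B"
  unfolding half_plane_def
  by (rule emeasure_restrict_space)
    (use assms in \<open>auto simp: sets_half_plane intro: Times_UNIV_borel\<close>)

lemma emeasure_lborel_Times:
  assumes "A \<in> sets borel" "B \<in> sets borel"
  shows "emeasure (lborel :: (real \<times> real) measure) (A \<times> B) = emeasure lborel A * emeasure lborel B"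
  unfolding lborel_prod[symmetric] using assms by (simp add: lborel.emeasure_pair_measure_Times)

lemma Times_half_plane:
  assumes "A \<in> sets borel" "B \<in> sets borel" "A \<subseteq> {0..}"
  shows "A \<times> B \<in> sets half_plane"
proof -
  have "A \<times> B \<in> sets (borel \<Otimes>\<^sub>M borel :: (real \<times> real) measure)" using assms by simp
  then show ?thesis unfolding sets_half_plane borel_prod using assms by auto
qed

locale poisson_measure = prob_space M for M :: "'a measure" +
  fixes P :: "'a \<Rightarrow> (real \<times> real) measure"
  assumes poisson: "poisson_random_measure M half_plane P"
begin

lemma sets_P: "\<omega> \<in> space M \<Longrightarrow> sets (P \<omega>) = sets half_plane"
  using poisson unfolding poisson_random_measure_def by auto

lemma P_int: "\<omega> \<in> space M \<Longrightarrow> A \<in> sets half_plane \<Longrightarrow> emeasure (P \<omega>) A \<in> insert \<infinity> (range of_nat)"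
  using poisson unfolding poisson_random_measure_def by auto

lemma P_measurable [measurable]: "A \<in> sets half_plane \<Longrightarrow> (\<lambda>\<omega>. emeasure (P \<omega>) A) \<in> borel_measurable M"
  using poisson unfolding poisson_random_measure_def by auto

lemma prob_P_eq:
  "A \<in> sets half_plane \<Longrightarrow> emeasure half_plane A < \<infinity> \<Longrightarrow>
    \<P>(\<omega> in M. emeasure (P \<omega>) A = of_nat k) = measure half_plane A ^ k / fact k * exp (- measure half_plane A)"
  using poisson unfolding poisson_random_measure_def by auto

lemma indep_vars_P:
  "(\<And>l. A l \<in> sets half_plane) \<Longrightarrow> disjoint_family_on A {..<k} \<Longrightarrow>
    indep_vars (\<lambda>_. borel) (\<lambda>l \<omega>. emeasure (P \<omega>) (A l)) {..<k}"
  for A :: "nat \<Rightarrow> _"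
  using poisson unfolding poisson_random_measure_def by blast

text \<open>The Poisson weights already sum to 1, which leaves no probability for an infinite
  count.\<close>

lemma AE_P_nat:
  assumes "A \<in> sets half_plane" "emeasure half_plane A < \<infinity>"
  shows "AE \<omega> in M. emeasure (P \<omega>) A \<in> range of_nat"
proof -
  let ?m = "measure half_plane A"
  have "(\<lambda>k. prob {\<omega> \<in> space M. emeasure (P \<omega>) A = of_nat k}) sums prob (\<Union>k. {\<omega> \<in> space M. emeasure (P \<omega>) A = of_nat k})"
    using assms by (intro finite_measure_UNION) (auto simp: disjoint_family_on_def)
  moreover have "(\<lambda>k. ?m ^ k /\<^sub>R fact k * exp (- ?m)) sums (exp ?m * exp (- ?m))"
    by (intro sums_mult2 exp_converges)
  then have "(\<lambda>k. prob {\<omega> \<in> space M. emeasure (P \<omega>) A = of_nat k}) sums 1"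
    unfolding prob_P_eq[OF assms] by (simp add: exp_minus field_simps)
  ultimately have "prob (\<Union>k. {\<omega> \<in> space M. emeasure (P \<omega>) A = of_nat k}) = 1"
    by (rule sums_unique2)
  then have "AE \<omega> in M. \<omega> \<in> (\<Union>k. {\<omega> \<in> space M. emeasure (P \<omega>) A = of_nat k})"
    using assms by (subst (asm) prob_eq_1) auto
  then show ?thesis by eventually_elim auto
qed

lemma AE_boxes_finite:
  "AE \<omega> in M. \<forall>K::nat. emeasure (P \<omega>) ({0<..real K} \<times> {- real K..real K}) < \<infinity>"
  unfolding AE_all_countable
proof
  fix K :: nat
  have B: "{0<..real K} \<times> {- real K..real K} \<in> sets half_plane" by (rule Times_half_plane) auto
  have "emeasure half_plane ({0<..real K} \<times> {- real K..real K}) < \<infinity>"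
    by (simp add: emeasure_half_plane[OF B] emeasure_lborel_Times flip: ennreal_mult')
  from AE_P_nat[OF B this] show "AE \<omega> in M. emeasure (P \<omega>) ({0<..real K} \<times> {- real K..real K}) < \<infinity>"
    by eventually_elim (auto simp: ennreal_of_nat_eq_real_of_nat)
qed

text \<open>The counts 0 and 1 leave the probability \<open>1 - exp (- a) * (1 + a)\<close>, which
  \<open>1 - a \<le> exp (- a)\<close> bounds by \<open>1 - (1 - a) * (1 + a)\<close>.\<close>

lemma prob_P_multiple:
  assumes "A \<in> sets half_plane" "emeasure half_plane A = ennreal a" "0 \<le> a"
  shows "prob {\<omega> \<in> space M. \<not> emeasure (P \<omega>) A \<le> 1} \<le> a\<^sup>2"
proof -
  have m: "measure half_plane A = a" "emeasure half_plane A < \<infinity>" using assms(2,3) by (auto simp: measure_def)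
  let ?E = "\<lambda>k::nat. {\<omega> \<in> space M. emeasure (P \<omega>) A = of_nat k}"
  have E[measurable]: "?E k \<in> events" for k using assms(1) by measurable
  have "{\<omega> \<in> space M. \<not> emeasure (P \<omega>) A \<le> 1} \<subseteq> space M - (?E 0 \<union> ?E 1)" by auto
  moreover have "space M - (?E 0 \<union> ?E 1) \<in> events" using E[of 0] E[of 1] by (intro sets.Diff sets.Un) auto
  ultimately have "prob {\<omega> \<in> space M. \<not> emeasure (P \<omega>) A \<le> 1} \<le> prob (space M - (?E 0 \<union> ?E 1))"
    by (rule finite_measure_mono)
  also have "\<dots> = 1 - (prob (?E 0) + prob (?E 1))"
  proof -
    have "prob (?E 0 \<union> ?E 1) = prob (?E 0) + prob (?E 1)"
      by (rule finite_measure_Union[OF E E]) auto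
    then show ?thesis using prob_compl[OF sets.Un[OF E[of 0] E[of 1]]] by simp
  qed
  also have "\<dots> = 1 - exp (- a) * (1 + a)"
    using prob_P_eq[OF assms(1) m(2), of 0] prob_P_eq[OF assms(1) m(2), of 1] by (simp add: m field_simps)
  also have "(1 - a) * (1 + a) \<le> exp (- a) * (1 + a)"
    using exp_ge_add_one_self[of "- a"] assms(3) by (intro mult_right_mono) auto
  then have "1 - exp (- a) * (1 + a) \<le> a\<^sup>2" by (simp add: algebra_simps power2_eq_square)
  finally show ?thesis .
qed

text \<open>Almost surely no two atoms are simultaneous: cut the time axis into \<open>n\<close> pieces; the
  probability that some piece carries two atoms is \<open>O(1/n)\<close>.\<close>

lemma AE_P_simple_box:
  fixes K :: nat
  shows "AE \<omega> in M. \<forall>u. 0 < u \<and> u \<le> real K \<longrightarrow> emeasure (P \<omega>) ({u} \<times> {- real K..real K}) \<le> 1"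
proof -
  define strip where "strip n l = {real l * real K / real n<..real (Suc l) * real K / real n} \<times> {- real K..real K}" for n l :: nat
  define bad where "bad n = (\<Union>l<n. {\<omega> \<in> space M. \<not> emeasure (P \<omega>) (strip n l) \<le> 1})" for n
  have strip: "strip n l \<in> sets half_plane" for n l
  proof -
    have "0 \<le> real l * real K / real n" by simp
    then have "{real l * real K / real n<..real (Suc l) * real K / real n} \<subseteq> {0..}"
      unfolding subset_iff greaterThanAtMost_iff atLeast_iff by (meson less_imp_le order_trans)
    then show ?thesis unfolding strip_def by (intro Times_half_plane) auto
  qed
  have bad_ev: "bad n \<in> events" for n
    unfolding bad_def using strip by (intro sets.finite_UN) auto
  \<comment> \<open>A strip has area \<open>2 * K\<^sup>2 / n\<close>; squaring this and adding
    \<open>n\<close> such terms gives the constant \<open>4 * K ^ 4\<close>.\<close>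
  have bad_prob: "prob (bad n) \<le> 4 * real K ^ 4 / real n" if n: "0 < n" for n
  proof -
    have "prob {\<omega> \<in> space M. \<not> emeasure (P \<omega>) (strip n l) \<le> 1} \<le> (2 * (real K)\<^sup>2 / real n)\<^sup>2" for l
    proof (rule prob_P_multiple[OF strip])
      have "real l * real K / real n \<le> real (Suc l) * real K / real n"
        by (intro divide_right_mono mult_right_mono) auto
      then have "emeasure half_plane (strip n l) = ennreal ((real (Suc l) * real K / real n - real l * real K / real n) * (2 * real K))"
        unfolding emeasure_half_plane[OF strip] unfolding strip_def by (simp add: emeasure_lborel_Times ennreal_mult')
      also have "(real (Suc l) * real K / real n - real l * real K / real n) * (2 * real K) = 2 * (real K)\<^sup>2 / real n"
        by (simp add: diff_divide_distrib[symmetric]) (simp add: distrib_right power2_eq_square)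
      finally show "emeasure half_plane (strip n l) = ennreal (2 * (real K)\<^sup>2 / real n)" .
    qed simp
    then have "prob (bad n) \<le> (\<Sum>l<n. (2 * (real K)\<^sup>2 / real n)\<^sup>2)"
      unfolding bad_def using strip
      by (intro order_trans[OF finite_measure_subadditive_finite] sum_mono) auto
    also have "\<dots> = 4 * real K ^ 4 / real n"
      using n by (simp add: field_simps power2_eq_square power4_eq_xxxx)
    finally show ?thesis .
  qed
  \<comment> \<open>An outcome with some line of mass above 1 is bad at every resolution, so a
    single intersection of events takes care of uncountably many \<open>u\<close>.\<close>
  have "prob (\<Inter>n\<in>{1..}. bad n) \<le> 0"
  proof (rule tendsto_lowerbound[of "\<lambda>n. 4 * real K ^ 4 / real n" _ sequentially])
    show "(\<lambda>n. 4 * real K ^ 4 / real n) \<longlonglongrightarrow> 0" by (rule lim_const_over_n)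
    show "\<forall>\<^sub>F n in sequentially. prob (\<Inter>n\<in>{1..}. bad n) \<le> 4 * real K ^ 4 / real n"
      using eventually_gt_at_top[of "0::nat"]
    proof eventually_elim
      case (elim n)
      have "prob (\<Inter>n\<in>{1..}. bad n) \<le> prob (bad n)"
        using elim bad_ev by (intro finite_measure_mono) auto
      with bad_prob[OF elim] show ?case by simp
    qed
  qed simp
  then have "prob (\<Inter>n\<in>{1..}. bad n) = 0" using measure_nonneg by (intro antisym) auto
  moreover have "(\<Inter>n\<in>{1..}. bad n) \<in> events" using bad_ev by (intro sets.countable_INT') auto
  ultimately have "AE \<omega> in M. \<omega> \<notin> (\<Inter>n\<in>{1..}. bad n)" by (simp add: prob_eq_0)
  with AE_space show ?thesis
  proof eventually_elim
    case (elim \<omega>)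
    then obtain n where n: "1 \<le> n" "\<omega> \<notin> bad n" by auto
    have le1: "emeasure (P \<omega>) (strip n l) \<le> 1" if "l < n" for l
      using n(2) that elim(1) unfolding bad_def by auto
    show ?case
    proof (intro allI impI)
      fix u assume u: "0 < u \<and> u \<le> real K"
      then have K: "0 < real K" by linarith
      \<comment> \<open>The strips are open on the left and closed on the right, hence the ceiling
        minus 1.\<close>
      define l where "l = nat (\<lceil>u * real n / real K\<rceil> - 1)"
      have pos: "0 < u * real n / real K" using u n K by auto
      then have c: "1 \<le> \<lceil>u * real n / real K\<rceil>" by simp
      then have rl: "real l = of_int \<lceil>u * real n / real K\<rceil> - 1" unfolding l_def by simp
      have "real l < u * real n / real K" "u * real n / real K \<le> real l + 1"
        unfolding rl by linarith+
      then have in_strip: "real l * real K / real n < u" "u \<le> real (Suc l) * real K / real n"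
        using n K by (simp_all add: field_simps)
      have "u * real n / real K \<le> real n" using u K by (simp add: pos_divide_le_eq mult_right_mono mult.commute)
      then have "real l < real n" using \<open>real l < u * real n / real K\<close> by linarith
      then have l: "l < n" by simp
      have "emeasure (P \<omega>) ({u} \<times> {- real K..real K}) \<le> emeasure (P \<omega>) (strip n l)"
        using strip sets_P[OF elim(1)] in_strip by (intro emeasure_mono) (auto simp: strip_def)
      with le1[OF l] show "emeasure (P \<omega>) ({u} \<times> {- real K..real K}) \<le> 1" by simp
    qed
  qed
qed

lemma AE_P_simple: "AE \<omega> in M. \<forall>u>0. emeasure (P \<omega>) ({u} \<times> UNIV) \<le> 1"
proof -
  have "AE \<omega> in M. \<forall>K::nat. \<forall>u. 0 < u \<and> u \<le> real K \<longrightarrow> emeasure (P \<omega>) ({u} \<times> {- real K..real K}) \<le> 1"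
    unfolding AE_all_countable using AE_P_simple_box by blast
  with AE_space show ?thesis
  proof eventually_elim
    case (elim \<omega>)
    show ?case
    proof (intro allI impI)
      fix u :: real assume u: "0 < u"
      let ?B = "\<lambda>K::nat. {u} \<times> {- real K..real K}"
      have "(SUP K. emeasure (P \<omega>) (?B K)) = emeasure (P \<omega>) (\<Union>K. ?B K)"
      proof (rule SUP_emeasure_incseq)
        show "range ?B \<subseteq> sets (P \<omega>)"
          unfolding sets_P[OF elim(1)] using u by (auto intro!: Times_half_plane)
        show "incseq ?B" by (auto simp: incseq_def)
      qed
      also have "(\<Union>K. ?B K) = {u} \<times> UNIV"
      proof -
        have "\<exists>K::nat. - real K \<le> v \<and> v \<le> real K" for v
        proof -
          obtain K :: nat where "\<bar>v\<bar> \<le> real K" using real_arch_simple by blast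
          then show ?thesis by (intro exI[of _ K]) auto
        qed
        then show ?thesis by auto
      qed
      finally have eq: "emeasure (P \<omega>) ({u} \<times> UNIV) = (SUP K. emeasure (P \<omega>) (?B K))" ..
      show "emeasure (P \<omega>) ({u} \<times> UNIV) \<le> 1"
        unfolding eq
      proof (rule SUP_least)
        fix K :: nat
        obtain K' :: nat where K': "u \<le> real K'" using real_arch_simple by blast
        have "emeasure (P \<omega>) (?B K) \<le> emeasure (P \<omega>) (?B (max K K'))"
          using u by (intro emeasure_mono) (auto simp: sets_P[OF elim(1)] intro!: Times_half_plane)
        also have "\<dots> \<le> 1" using elim(2)[rule_format, of u "max K K'"] u K' by linarith
        finally show "emeasure (P \<omega>) (?B K) \<le> 1" .
      qed
    qed
  qed
qed

section \<open>Independence of the history and later counts\<close>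

definition cylinders :: "real \<Rightarrow> 'a set set" where
  "cylinders t = {{\<omega> \<in> space M. \<forall>(A, E)\<in>S. emeasure (P \<omega>) A \<in> E} | S. finite S \<and>
     (\<forall>(A, E)\<in>S. A \<in> sets half_plane \<and> A \<subseteq> {0<..t} \<times> UNIV \<and> E \<in> sets borel)}"

lemma cylindersE:
  assumes "c \<in> cylinders t"
  obtains S where "finite S" "\<forall>(A, E)\<in>S. A \<in> sets half_plane \<and> A \<subseteq> {0<..t} \<times> UNIV \<and> E \<in> sets borel"
    "c = {\<omega> \<in> space M. \<forall>(A, E)\<in>S. emeasure (P \<omega>) A \<in> E}"
  using assms unfolding cylinders_def by fast

text \<open>The independence of a Poisson random measure is postulated for disjoint sets; the sets
  defining a cylinder event are reduced to the atoms of the algebra they generate.\<close>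

lemma indep_cylinders:
  assumes c: "c \<in> cylinders s" and B: "B \<in> sets half_plane" "B \<inter> {0<..s} \<times> UNIV = {}" and U: "U \<in> sets borel"
  shows "prob (c \<inter> {\<omega> \<in> space M. emeasure (P \<omega>) B \<in> U}) = prob c * prob {\<omega> \<in> space M. emeasure (P \<omega>) B \<in> U}"
proof -
  from c obtain S where fin: "finite S"
    and S_all: "\<forall>(A, E)\<in>S. A \<in> sets half_plane \<and> A \<subseteq> {0<..s} \<times> UNIV \<and> E \<in> sets borel"
    and c_eq: "c = {\<omega> \<in> space M. \<forall>(A, E)\<in>S. emeasure (P \<omega>) A \<in> E}"
    by (rule cylindersE)
  have S: "finite S" "\<And>A E. (A, E) \<in> S \<Longrightarrow> A \<in> sets half_plane \<and> A \<subseteq> {0<..s} \<times> UNIV \<and> E \<in> sets borel"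
    using fin S_all by auto
  define F where "F = fst ` S"
  have F: "finite F" unfolding F_def using S(1) by simp
  have F2: "A \<in> sets half_plane" "A \<subseteq> {0<..s} \<times> UNIV" if "A \<in> F" for A
    using that S(2) unfolding F_def by force+
  \<comment> \<open>Independence is postulated for sequences of sets, hence this enumeration of all
    subsets of \<open>F\<close>, each of which names one atom.\<close>
  obtain h where h: "bij_betw h {0..<card (Pow F)} (Pow F)"
    using ex_bij_betw_nat_finite[of "Pow F"] F by auto
  define n where "n = card (Pow F)"
  define atom where "atom I = {z \<in> {0<..s} \<times> UNIV. \<forall>A\<in>F. z \<in> A \<longleftrightarrow> A \<in> I}" for I :: "(real \<times> real) set set"
  have hP: "h m \<subseteq> F" if "m < n" for m using h that unfolding n_def bij_betw_def by auto
  have hinj: "h m \<noteq> h m'" if "m < n" "m' < n" "m \<noteq> m'" for m m'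
    using h that unfolding n_def bij_betw_def inj_on_def by auto
  have hsurj: "\<exists>m<n. h m = I" if "I \<subseteq> F" for I
  proof -
    have "I \<in> h ` {0..<card (Pow F)}" using h that unfolding bij_betw_def by auto
    then show ?thesis unfolding n_def by auto
  qed
  have strip: "{0<..s} \<times> UNIV \<in> sets half_plane" by (rule Times_half_plane) auto
  have atom_sets: "atom I \<in> sets half_plane" for I
  proof -
    have "z \<in> (if A \<in> I then A else space half_plane - A) \<longleftrightarrow> z \<in> space half_plane \<and> (z \<in> A \<longleftrightarrow> A \<in> I)"
      if "A \<in> F" for A z using F2(1)[OF that, THEN sets.sets_into_space] by auto
    then have eq: "atom I = ({0<..s} \<times> UNIV) \<inter> (\<Inter>A\<in>F. if A \<in> I then A else space half_plane - A) \<inter> space half_plane"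
      using strip[THEN sets.sets_into_space] unfolding atom_def by blast
    have mem: "(\<Inter>A\<in>F. if A \<in> I then A else space half_plane - A) \<inter> space half_plane \<in> sets half_plane"
    proof (cases "F = {}")
      case False
      then show ?thesis using F F2 by (intro sets.Int sets.finite_INT) auto
    qed auto
    show ?thesis unfolding eq Int_assoc by (rule sets.Int[OF strip mem])
  qed
  \<comment> \<open>The atoms occupy the indices below \<open>n\<close> and the set \<open>B\<close>
    the index \<open>n\<close>; the empty set pads the rest.\<close>
  define D where "D m = (if m < n then atom (h m) else if m = n then B else {})" for m
  have D_sets: "D m \<in> sets half_plane" for m unfolding D_def using atom_sets B by auto
  have atom_disj: "atom (h m) \<inter> atom (h m') = {}" if "m < n" "m' < n" "m \<noteq> m'" for m m'
    using hinj[OF that] hP[OF that(1)] hP[OF that(2)] unfolding atom_def by blast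
  have D_disj: "disjoint_family_on D {..<Suc n}"
    unfolding disjoint_family_on_def
  proof (intro ballI impI)
    fix m m' assume m: "m \<in> {..<Suc n}" "m' \<in> {..<Suc n}" "m \<noteq> m'"
    have "atom I \<inter> B = {}" for I using B(2) unfolding atom_def by auto
    then show "D m \<inter> D m' = {}" using m atom_disj[of m m'] unfolding D_def by auto
  qed
  have ind: "indep_vars (\<lambda>_. borel) (\<lambda>m \<omega>. emeasure (P \<omega>) (D m)) {..<Suc n}"
    by (rule indep_vars_P[OF D_sets D_disj])
  have iv: "indep_var (PiM {..<n} (\<lambda>_. borel)) (\<lambda>\<omega>. \<lambda>m\<in>{..<n}. emeasure (P \<omega>) (D m))
      (PiM {n} (\<lambda>_. borel)) (\<lambda>\<omega>. \<lambda>m\<in>{n}. emeasure (P \<omega>) (D m))"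
    by (rule indep_var_restrict[OF ind]) auto
  define V where "V = {x \<in> space (PiM {..<n} (\<lambda>_. borel :: ennreal measure)).
    \<forall>q\<in>S. (\<Sum>m | m < n \<and> fst q \<in> h m. x m) \<in> snd q}"
  define W where "W = {x \<in> space (PiM {n} (\<lambda>_. borel :: ennreal measure)). x n \<in> U}"
  have V: "V \<in> sets (PiM {..<n} (\<lambda>_. borel))"
    unfolding V_def
  proof (rule sets.sets_Collect_finite_All[OF _ S(1)])
    fix q assume q: "q \<in> S"
    have "snd q \<in> sets borel" using S(2)[of "fst q" "snd q"] q by simp
    moreover have "(\<lambda>x. \<Sum>m | m < n \<and> fst q \<in> h m. x m) \<in> borel_measurable (PiM {..<n} (\<lambda>_. borel :: ennreal measure))"
      by (intro borel_measurable_sum measurable_component_singleton) auto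
    ultimately show "{x \<in> space (PiM {..<n} (\<lambda>_. borel)). (\<Sum>m | m < n \<and> fst q \<in> h m. x m) \<in> snd q} \<in> sets (PiM {..<n} (\<lambda>_. borel))"
      by measurable
  qed
  have W: "W \<in> sets (PiM {n} (\<lambda>_. borel))"
    unfolding W_def using U by measurable
  \<comment> \<open>Each \<open>A\<close> in \<open>F\<close> is the disjoint union of the atoms
    whose names contain it, so its count is a function of the counts of atoms.\<close>
  have sumP: "emeasure (P \<omega>) A = (\<Sum>m | m < n \<and> A \<in> h m. emeasure (P \<omega>) (D m))"
    if \<omega>: "\<omega> \<in> space M" and A: "A \<in> F" for \<omega> A
  proof -
    have A_eq: "A = (\<Union>m\<in>{m. m < n \<and> A \<in> h m}. D m)"
    proof (intro set_eqI iffI)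
      fix z assume z: "z \<in> A"
      obtain m where m: "m < n" "h m = {A' \<in> F. z \<in> A'}" using hsurj[of "{A' \<in> F. z \<in> A'}"] by auto
      have "z \<in> atom (h m)" unfolding atom_def m(2) using F2(2)[OF A] z by auto
      then show "z \<in> (\<Union>m\<in>{m. m < n \<and> A \<in> h m}. D m)"
        using m A z unfolding D_def by auto
    next
      fix z assume "z \<in> (\<Union>m\<in>{m. m < n \<and> A \<in> h m}. D m)"
      then show "z \<in> A" using A unfolding D_def atom_def by auto
    qed
    have "(\<Sum>m | m < n \<and> A \<in> h m. emeasure (P \<omega>) (D m)) = emeasure (P \<omega>) (\<Union>m\<in>{m. m < n \<and> A \<in> h m}. D m)"
      using D_disj D_sets sets_P[OF \<omega>]
      by (intro sum_emeasure) (auto simp: disjoint_family_on_def)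
    then show ?thesis using A_eq by simp
  qed
  have c_V: "c = (\<lambda>\<omega>. \<lambda>m\<in>{..<n}. emeasure (P \<omega>) (D m)) -` V \<inter> space M"
  proof -
    have "(\<Sum>m | m < n \<and> A \<in> h m. (\<lambda>m\<in>{..<n}. emeasure (P \<omega>) (D m)) m) = emeasure (P \<omega>) A"
      if "\<omega> \<in> space M" "(A, E) \<in> S" for \<omega> A E
    proof -
      have "A \<in> F" using that(2) unfolding F_def by force
      from sumP[OF that(1) this] show ?thesis by (auto intro: sum.cong)
    qed
    then show ?thesis
      unfolding c_eq V_def by (auto simp: space_PiM split: prod.splits)
  qed
  have B_W: "{\<omega> \<in> space M. emeasure (P \<omega>) B \<in> U} = (\<lambda>\<omega>. \<lambda>m\<in>{n}. emeasure (P \<omega>) (D m)) -` W \<inter> space M"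
    unfolding W_def by (auto simp: space_PiM D_def)
  have "c \<inter> {\<omega> \<in> space M. emeasure (P \<omega>) B \<in> U} =
    (\<lambda>\<omega>. (\<lambda>m\<in>{..<n}. emeasure (P \<omega>) (D m), \<lambda>m\<in>{n}. emeasure (P \<omega>) (D m))) -` (V \<times> W) \<inter> space M"
    unfolding c_V B_W by auto
  then show ?thesis
    using indep_varD[OF iv V W] unfolding c_V[symmetric] B_W[symmetric] by simp
qed

lemma Int_stable_cylinders: "Int_stable (cylinders t)"
proof (rule Int_stableI)
  fix a b assume "a \<in> cylinders t" "b \<in> cylinders t"
  then obtain S S' where S: "finite S" "\<forall>(A, E)\<in>S. A \<in> sets half_plane \<and> A \<subseteq> {0<..t} \<times> UNIV \<and> E \<in> sets borel"
      "a = {\<omega> \<in> space M. \<forall>(A, E)\<in>S. emeasure (P \<omega>) A \<in> E}"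
    and S': "finite S'" "\<forall>(A, E)\<in>S'. A \<in> sets half_plane \<and> A \<subseteq> {0<..t} \<times> UNIV \<and> E \<in> sets borel"
      "b = {\<omega> \<in> space M. \<forall>(A, E)\<in>S'. emeasure (P \<omega>) A \<in> E}"
    by (elim cylindersE)
  show "a \<inter> b \<in> cylinders t"
    unfolding cylinders_def by (rule CollectI, rule exI[of _ "S \<union> S'"]) (use S S' in auto)
qed

lemma cylinders_space: "space M \<in> cylinders t"
  unfolding cylinders_def by (rule CollectI, rule exI[of _ "{}"]) auto

lemma cylinders_single:
  assumes "A \<in> sets half_plane" "A \<subseteq> {0<..t} \<times> UNIV" "E \<in> sets borel"
  shows "{\<omega> \<in> space M. emeasure (P \<omega>) A \<in> E} \<in> cylinders t"
  unfolding cylinders_def by (rule CollectI, rule exI[of _ "{(A, E)}"]) (use assms in auto)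

lemma cylinders_mono: "s \<le> t \<Longrightarrow> cylinders s \<subseteq> cylinders t"
  unfolding cylinders_def by fastforce

abbreviation "path_events \<equiv> sets (vimage_algebra (space M) (\<lambda>\<omega>. \<lambda>A\<in>sets half_plane. emeasure (P \<omega>) A)
          (Pi\<^sub>M (sets half_plane) (\<lambda>_. borel)))"

lemma path_eventsI:
  assumes "A \<in> sets half_plane" "E \<in> sets borel"
  shows "{\<omega> \<in> space M. emeasure (P \<omega>) A \<in> E} \<in> path_events"
proof -
  let ?V = "vimage_algebra (space M) (\<lambda>\<omega>. \<lambda>A\<in>sets half_plane. emeasure (P \<omega>) A) (Pi\<^sub>M (sets half_plane) (\<lambda>_. borel :: ennreal measure))"
  have "(\<lambda>\<omega>. \<lambda>A\<in>sets half_plane. emeasure (P \<omega>) A) \<in> measurable ?V (Pi\<^sub>M (sets half_plane) (\<lambda>_. borel))"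
    by (rule measurable_vimage_algebra1) (auto simp: space_PiM)
  from measurable_compose[OF this measurable_component_singleton[OF assms(1)]]
  have "(\<lambda>\<omega>. emeasure (P \<omega>) A) \<in> borel_measurable ?V" using assms(1) by simp
  from measurable_sets[OF this assms(2)]
  have "(\<lambda>\<omega>. emeasure (P \<omega>) A) -` E \<inter> space M \<in> path_events" by simp
  also have "(\<lambda>\<omega>. emeasure (P \<omega>) A) -` E \<inter> space M = {\<omega> \<in> space M. emeasure (P \<omega>) A \<in> E}" by auto
  finally show ?thesis .
qed

lemma cylinders_path_events: "cylinders t \<subseteq> path_events"
proof
  fix c assume "c \<in> cylinders t"
  then obtain S where S: "finite S" "\<forall>(A, E)\<in>S. A \<in> sets half_plane \<and> A \<subseteq> {0<..t} \<times> UNIV \<and> E \<in> sets borel"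
    and c: "c = {\<omega> \<in> space M. \<forall>(A, E)\<in>S. emeasure (P \<omega>) A \<in> E}"
    by (rule cylindersE)
  let ?V = "vimage_algebra (space M) (\<lambda>\<omega>. \<lambda>A\<in>sets half_plane. emeasure (P \<omega>) A) (Pi\<^sub>M (sets half_plane) (\<lambda>_. borel :: ennreal measure))"
  have "{\<omega> \<in> space ?V. \<forall>q\<in>S. emeasure (P \<omega>) (fst q) \<in> snd q} \<in> sets ?V"
    by (rule sets.sets_Collect_finite_All[OF _ S(1)]) (use S(2) path_eventsI in auto)
  then show "c \<in> path_events" unfolding c by (simp add: case_prod_unfold)
qed

end

text \<open>\<open>init\<close> stands for the events of the initial values. They are independent of
  the whole realization jointly, not just of single counts.\<close>

locale poisson_initial = poisson_measure +
  fixes init :: "'a set set"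
  assumes init_indep: "indep_set init path_events"
    and init_stable: "Int_stable init" and init_space: "space M \<in> init"
begin

text \<open>Only a pi-system of generators, on which independence can be checked by multiplication.
  The information up to time \<open>t\<close> is the sigma-algebra generated by it.\<close>

definition history :: "real \<Rightarrow> 'a set set" where
  "history t = {a \<inter> c | a c. a \<in> init \<and> c \<in> cylinders t}"

lemma history_events: "history t \<subseteq> events"
  using indep_setD_ev1[OF init_indep] indep_setD_ev2[OF init_indep] cylinders_path_events[of t]
  unfolding history_def by blast

lemma Int_stable_history: "Int_stable (history t)"
proof (rule Int_stableI)
  fix x y assume "x \<in> history t" "y \<in> history t"
  then obtain a c b d where "x = a \<inter> c" "y = b \<inter> d" "a \<in> init" "b \<in> init" "c \<in> cylinders t" "d \<in> cylinders t"
    unfolding history_def by blast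
  then have "x \<inter> y = (a \<inter> b) \<inter> (c \<inter> d)" "a \<inter> b \<in> init" "c \<inter> d \<in> cylinders t"
    using Int_stableD[OF init_stable] Int_stableD[OF Int_stable_cylinders] by blast+
  then show "x \<inter> y \<in> history t" unfolding history_def by blast
qed

lemma history_mono: "s \<le> t \<Longrightarrow> history s \<subseteq> history t"
  using cylinders_mono[of s t] unfolding history_def by blast

lemma init_history: assumes "a \<in> init" shows "a \<in> history t"
proof -
  have "a \<subseteq> space M" using assms indep_setD_ev1[OF init_indep] sets.sets_into_space by blast
  then have "a = a \<inter> space M" by auto
  then show ?thesis unfolding history_def using assms cylinders_space by blast
qed

lemma cylinders_history: assumes "c \<in> cylinders t" shows "c \<in> history t"
proof -
  have "c \<subseteq> space M" using assms unfolding cylinders_def by auto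
  then have "c = space M \<inter> c" by auto
  then show ?thesis unfolding history_def using assms init_space by blast
qed

text \<open>On a generator \<open>a \<inter> c\<close> the probability factors in two rounds:
  \<open>a\<close> splits off because the initial values are independent of all counts, then
  \<open>c\<close> from the count of \<open>B\<close>. Stability under intersection extends this to
  the generated sigma-algebra.\<close>

lemma indep_history:
  assumes A: "A \<in> sigma_sets (space M) (history s)"
    and B: "B \<in> sets half_plane" "B \<inter> {0<..s} \<times> UNIV = {}" and U: "U \<in> sets borel"
  shows "prob (A \<inter> {\<omega> \<in> space M. emeasure (P \<omega>) B \<in> U}) = prob A * prob {\<omega> \<in> space M. emeasure (P \<omega>) B \<in> U}"
proof -
  let ?f = "{\<omega> \<in> space M. emeasure (P \<omega>) B \<in> U}"
  have f: "?f \<in> path_events" by (rule path_eventsI) fact+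
  have "indep_set (history s) {?f}"
  proof (rule indep_setI)
    show "{?f} \<subseteq> events" using B U by auto
    fix x f assume "x \<in> history s" "f \<in> {?f}"
    then obtain a c where x: "x = a \<inter> c" "a \<in> init" "c \<in> cylinders s" and ff: "f = ?f" unfolding history_def by blast
    have c: "c \<in> path_events" using x cylinders_path_events by blast
    have "prob (x \<inter> f) = prob (a \<inter> (c \<inter> ?f))" unfolding x ff by (simp add: Int_assoc)
    also have "\<dots> = prob a * prob (c \<inter> ?f)"
      using x c f by (intro indep_setD[OF init_indep]) auto
    also have "\<dots> = prob a * prob c * prob ?f" using indep_cylinders[OF x(3) B U] by simp
    also have "prob a * prob c = prob x" unfolding x(1) using indep_setD[OF init_indep x(2) c] by simp
    finally show "prob (x \<inter> f) = prob x * prob f" unfolding ff .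
  qed (rule history_events)
  then have "indep_set (sigma_sets (space M) (history s)) (sigma_sets (space M) {?f})"
    by (rule indep_set_sigma_sets[OF _ Int_stable_history]) (simp add: Int_stable_def)
  from indep_setD[OF this A, of ?f] show ?thesis by auto
qed

text \<open>The finite area makes the count almost surely a natural number, so it can be expanded
  over its values; independence then leaves the mean of a Poisson variable.\<close>

lemma nn_integral_history:
  assumes A: "A \<in> sigma_sets (space M) (history s)"
    and B: "B \<in> sets half_plane" "B \<inter> {0<..s} \<times> UNIV = {}" "emeasure half_plane B < \<infinity>"
  shows "(\<integral>\<^sup>+\<omega>\<in>A. emeasure (P \<omega>) B \<partial>M) = emeasure M A * emeasure half_plane B"
proof -
  let ?m = "measure half_plane B"
  let ?E = "\<lambda>k::nat. {\<omega> \<in> space M. emeasure (P \<omega>) B = of_nat k}"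
  have A_ev: "A \<in> events" using A history_events sets.sigma_sets_subset by blast
  have E_ev: "?E k \<in> events" for k using B(1) by measurable
  have "AE \<omega> in M. emeasure (P \<omega>) B * indicator A \<omega> = (\<Sum>k. of_nat k * indicator (A \<inter> ?E k) \<omega>)"
    using AE_P_nat[OF B(1,3)] AE_space
  proof eventually_elim
    case (elim \<omega>)
    then obtain k where k: "emeasure (P \<omega>) B = of_nat k" by auto
    have "(\<Sum>k'. of_nat k' * indicator (A \<inter> ?E k') \<omega>) = (\<Sum>k'\<in>{k}. of_nat k' * indicator (A \<inter> ?E k') \<omega> :: ennreal)"
      by (rule suminf_finite) (use k elim in \<open>auto simp: indicator_def\<close>)
    then show ?case using k elim by (auto simp: indicator_def)
  qed
  then have "(\<integral>\<^sup>+\<omega>\<in>A. emeasure (P \<omega>) B \<partial>M) = (\<integral>\<^sup>+\<omega>. (\<Sum>k. of_nat k * indicator (A \<inter> ?E k) \<omega>) \<partial>M)"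
    by (rule nn_integral_cong_AE)
  also have "\<dots> = (\<Sum>k. of_nat k * emeasure M (A \<inter> ?E k))"
    using A_ev E_ev by (subst nn_integral_suminf) (auto simp: nn_integral_cmult_indicator)
  also have "\<dots> = (\<Sum>k. ennreal (prob A * (real k * (?m ^ k / fact k * exp (- ?m)))))"
  proof (rule suminf_cong)
    fix k
    have "prob (A \<inter> ?E k) = prob A * (?m ^ k / fact k * exp (- ?m))"
      using indep_history[OF A B(1,2), of "{of_nat k}"] prob_P_eq[OF B(1,3), of k] by simp
    then show "of_nat k * emeasure M (A \<inter> ?E k) = ennreal (prob A * (real k * (?m ^ k / fact k * exp (- ?m))))"
      by (simp add: emeasure_eq_measure ennreal_of_nat_eq_real_of_nat mult_ac flip: ennreal_mult)
  qed
  also have "\<dots> = ennreal (prob A * ?m)"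
  proof -
    \<comment> \<open>\<open>Suc k * m ^ Suc k / fact (Suc k)\<close> equals
      \<open>m * (m ^ k / fact k)\<close>, so the series for the mean is a shifted exponential
      series; its term at 0 vanishes.\<close>
    have "(\<lambda>k. ?m * ((?m ^ k /\<^sub>R fact k) * exp (- ?m))) sums (?m * (exp ?m * exp (- ?m)))"
      by (intro sums_mult sums_mult2 exp_converges)
    then have "(\<lambda>k. real (Suc k) * (?m ^ Suc k / fact (Suc k) * exp (- ?m))) sums ?m"
      by (simp add: exp_minus field_simps del: of_nat_Suc)
    then have "(\<lambda>k. real k * (?m ^ k / fact k * exp (- ?m))) sums ?m"
      by (subst (asm) sums_Suc_iff) simp
    then have "(\<lambda>k. prob A * (real k * (?m ^ k / fact k * exp (- ?m)))) sums (prob A * ?m)"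
      by (rule sums_mult)
    then show ?thesis by (intro suminf_ennreal_eq) auto
  qed
  also have "\<dots> = emeasure M A * emeasure half_plane B"
    using B(3) by (simp add: emeasure_eq_measure emeasure_eq_ennreal_measure ennreal_mult' less_top)
  finally show ?thesis .
qed

end

subsection \<open>Predictable sets and the Campbell formula\<close>

text \<open>The Campbell formula uses no Poisson law, only that on each event of \<open>G s\<close>
  the counts after \<open>s\<close> have the area as their mean. Counts on boxes are finite for
  every outcome, so they can be subtracted without exceptional sets.\<close>

locale compensated_measure = prob_space M for M :: "'a measure" +
  fixes G :: "real \<Rightarrow> 'a measure" and P :: "'a \<Rightarrow> (real \<times> real) measure"
  assumes space_G: "space (G t) = space M"
    and sets_G: "sets (G t) \<subseteq> sets M"
    and mono_G: "s \<le> t \<Longrightarrow> sets (G s) \<subseteq> sets (G t)"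
    and sets_P: "\<omega> \<in> space M \<Longrightarrow> sets (P \<omega>) = sets half_plane"
    and finite_P: "\<omega> \<in> space M \<Longrightarrow> emeasure (P \<omega>) ({0<..real K} \<times> {- real K..real K}) < \<infinity>"
    and adapted_P: "0 \<le> t \<Longrightarrow> B \<in> sets half_plane \<Longrightarrow> B \<subseteq> {0<..t} \<times> UNIV \<Longrightarrow>
      (\<lambda>\<omega>. emeasure (P \<omega>) B) \<in> borel_measurable (G t)"
    and compensator: "0 \<le> s \<Longrightarrow> A \<in> sets (G s) \<Longrightarrow> B \<in> sets half_plane \<Longrightarrow> B \<subseteq> {s<..} \<times> UNIV \<Longrightarrow>
      emeasure half_plane B < \<infinity> \<Longrightarrow>
      (\<integral>\<^sup>+\<omega>\<in>A. emeasure (P \<omega>) B \<partial>M) = emeasure M A * emeasure half_plane B"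
begin

text \<open>Rectangles that open strictly after \<open>s\<close> and use information from time
  \<open>s\<close> only. Extending them to infinity makes the family closed under intersection, with
  the later of the two starting times.\<close>

definition pred_gen :: "('a \<times> (real \<times> real)) set set" where
  "pred_gen = {A \<times> ({s<..} \<times> C) | A s C. 0 \<le> s \<and> A \<in> sets (G s) \<and> C \<in> sets borel}"

definition pred :: "('a \<times> (real \<times> real)) measure" where
  "pred = sigma (space M \<times> ({0<..} \<times> UNIV)) pred_gen"

lemma G_sets_into: "A \<in> sets (G s) \<Longrightarrow> A \<subseteq> space M"
  using sets_G sets.sets_into_space by blast

lemma pred_gen_subset: "pred_gen \<subseteq> Pow (space M \<times> ({0<..} \<times> UNIV))"
  unfolding pred_gen_def by (auto dest: G_sets_into)

lemma space_pred: "space pred = space M \<times> ({0<..} \<times> UNIV)"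
  unfolding pred_def using pred_gen_subset by (simp add: space_measure_of)

lemma sets_pred: "sets pred = sigma_sets (space M \<times> ({0<..} \<times> UNIV)) pred_gen"
  unfolding pred_def using pred_gen_subset by (simp add: sets_measure_of)

lemma predI: "0 \<le> s \<Longrightarrow> A \<in> sets (G s) \<Longrightarrow> C \<in> sets borel \<Longrightarrow> A \<times> ({s<..} \<times> C) \<in> sets pred"
  unfolding sets_pred pred_gen_def by (intro sigma_sets.Basic) auto

lemma Int_stable_pred_gen: "Int_stable pred_gen"
proof (rule Int_stableI)
  fix a b assume "a \<in> pred_gen" "b \<in> pred_gen"
  then obtain A s C A' s' C' where *: "a = A \<times> ({s<..} \<times> C)" "0 \<le> s" "A \<in> sets (G s)" "C \<in> sets borel"
    "b = A' \<times> ({s'<..} \<times> C')" "0 \<le> s'" "A' \<in> sets (G s')" "C' \<in> sets borel"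
    unfolding pred_gen_def by blast
  have "a \<inter> b = (A \<inter> A') \<times> ({max s s'<..} \<times> (C \<inter> C'))" unfolding * by auto
  moreover have "A \<in> sets (G (max s s'))" "A' \<in> sets (G (max s s'))"
    using * mono_G[of s "max s s'"] mono_G[of s' "max s s'"] by auto
  ultimately show "a \<inter> b \<in> pred_gen"
    unfolding pred_gen_def using * by (intro CollectI exI[of _ "A \<inter> A'"] exI[of _ "max s s'"] exI[of _ "C \<inter> C'"]) auto
qed

lemma pred_subset_product: "sets pred \<subseteq> sets (M \<Otimes>\<^sub>M borel)"
proof -
  have s: "space M \<times> ({0<..} \<times> UNIV) \<in> sets (M \<Otimes>\<^sub>M (borel :: (real \<times> real) measure))"
    by (intro pair_measureI Times_UNIV_borel) auto
  have g: "pred_gen \<subseteq> sets (M \<Otimes>\<^sub>M borel)"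
    unfolding pred_gen_def
  proof safe
    fix A s and C :: "real set" assume "A \<in> sets (G s)" "C \<in> sets borel"
    then have "{s<..} \<times> C \<in> sets (borel \<Otimes>\<^sub>M borel)" "A \<in> sets M" using sets_G by auto
    then show "A \<times> {s<..} \<times> C \<in> sets (M \<Otimes>\<^sub>M borel)" unfolding borel_prod by auto
  qed
  show ?thesis
  proof
    fix S assume "S \<in> sets pred"
    then have "S \<in> sigma_sets (space M \<times> ({0<..} \<times> UNIV)) pred_gen" by (simp add: sets_pred)
    then show "S \<in> sets (M \<Otimes>\<^sub>M borel)"
    proof induction
      case (Compl a)
      then show ?case using s by auto
    qed (use g in auto)
  qed
qed

abbreviation "sec S \<omega> \<equiv> Pair \<omega> -` S"

lemma sec_borel: "S \<in> sets pred \<Longrightarrow> sec S \<omega> \<in> sets borel"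
  using pred_subset_product by (auto intro: sets_Pair1)

lemma sec_pos: "S \<in> sets pred \<Longrightarrow> sec S \<omega> \<subseteq> {0<..} \<times> UNIV"
  using sets.sets_into_space[of S pred] by (auto simp: space_pred)

lemma sec_half_plane: "S \<in> sets pred \<Longrightarrow> sec S \<omega> \<in> sets half_plane"
  using sec_borel[of S \<omega>] sec_pos[of S \<omega>] unfolding sets_half_plane by auto

text \<open>Truncation to finite mass and finite area, which permits subtraction in the complement
  steps of the Dynkin arguments.\<close>

definition box :: "real \<Rightarrow> nat \<Rightarrow> (real \<times> real) set" where
  "box t K = {0<..min t (real K)} \<times> {- real K..real K}"

lemma box_half_plane: "box t K \<in> sets half_plane"
  unfolding box_def by (rule Times_half_plane) auto

lemma emeasure_box_P: "\<omega> \<in> space M \<Longrightarrow> emeasure (P \<omega>) (box t K) < \<infinity>"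
  using finite_P[of \<omega> K] emeasure_mono[of "box t K" "{0<..real K} \<times> {- real K..real K}" "P \<omega>"]
  by (rule order.strict_trans1[rotated])
    (auto simp: sets_P box_def intro!: Times_half_plane)

lemma emeasure_box: "emeasure half_plane (box t K) < \<infinity>"
  unfolding emeasure_half_plane[OF box_half_plane] unfolding box_def
  by (cases "0 \<le> min t (real K)") (simp_all add: emeasure_lborel_Times ennreal_mult_less_top)

abbreviation "pts S t K \<omega> \<equiv> emeasure (P \<omega>) (sec S \<omega> \<inter> box t K)"
abbreviation "area S t K \<omega> \<equiv> emeasure lborel (sec S \<omega> \<inter> box t K)"

lemma pred_gen_section:
  assumes "\<omega> \<in> space M"
  shows "pts (A \<times> ({s<..} \<times> C)) t K \<omega> =
    emeasure (P \<omega>) (({s<..} \<times> C) \<inter> box t K) * indicator A \<omega>"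
  by (cases "\<omega> \<in> A") (auto simp: vimage_def)

text \<open>Dynkin's argument. A generator opening after \<open>t\<close> misses the box, one
  opening earlier uses an event of \<open>G t\<close>, and complements are differences of finite
  counts.\<close>

lemma adapted_box:
  assumes t: "0 \<le> t" and S: "S \<in> sets pred"
  shows "(\<lambda>\<omega>. pts S t K \<omega>) \<in> borel_measurable (G t)"
  using S unfolding sets_pred
proof (rule sigma_sets_induct_disjoint[OF Int_stable_pred_gen pred_gen_subset])
  fix a assume "a \<in> pred_gen"
  then obtain A s C where a: "a = A \<times> ({s<..} \<times> C)" "0 \<le> s" "A \<in> sets (G s)" "C \<in> sets borel"
    unfolding pred_gen_def by blast
  have B: "({s<..} \<times> C) \<inter> box t K \<in> sets half_plane" "({s<..} \<times> C) \<inter> box t K \<subseteq> {0<..t} \<times> UNIV"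
  proof -
    have "({s<..} \<times> C) \<inter> box t K = ({s<..} \<inter> {0<..min t (real K)}) \<times> (C \<inter> {- real K..real K})"
      unfolding box_def by auto
    also have "\<dots> \<in> sets half_plane" using a by (intro Times_half_plane) auto
    finally show "({s<..} \<times> C) \<inter> box t K \<in> sets half_plane" .
  qed (auto simp: box_def)
  have "(\<lambda>\<omega>. emeasure (P \<omega>) (({s<..} \<times> C) \<inter> box t K) * indicator A \<omega>) \<in> borel_measurable (G t)"
  proof (cases "s \<le> t")
    case True
    have "A \<in> sets (G t)" using a mono_G[OF True] by auto
    then show ?thesis using adapted_P[OF t B] by measurable
  next
    case False
    then have "({s<..} \<times> C) \<inter> box t K = {}" unfolding box_def by auto
    then show ?thesis by simp
  qed
  then show "(\<lambda>\<omega>. pts a t K \<omega>) \<in> borel_measurable (G t)"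
    by (rule measurable_cong[THEN iffD2, rotated]) (simp add: a pred_gen_section space_G)
next
  fix S assume S: "S \<in> sigma_sets (space M \<times> ({0<..} \<times> UNIV)) pred_gen"
    and IH: "(\<lambda>\<omega>. pts S t K \<omega>) \<in> borel_measurable (G t)"
  have "(\<lambda>\<omega>. emeasure (P \<omega>) (box t K)) \<in> borel_measurable (G t)"
    by (rule adapted_P[OF t box_half_plane]) (auto simp: box_def)
  then have "(\<lambda>\<omega>. emeasure (P \<omega>) (box t K) - pts S t K \<omega>) \<in> borel_measurable (G t)"
    using IH by measurable
  moreover have "pts (space M \<times> ({0<..} \<times> UNIV) - S) t K \<omega> =
      emeasure (P \<omega>) (box t K) - pts S t K \<omega>" if \<omega>: "\<omega> \<in> space (G t)" for \<omega>
  proof -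
    have "sec (space M \<times> ({0<..} \<times> UNIV) - S) \<omega> \<inter> box t K = box t K - (sec S \<omega> \<inter> box t K)"
      using \<omega> by (auto simp: space_G box_def)
    also have "emeasure (P \<omega>) (box t K - (sec S \<omega> \<inter> box t K)) =
        emeasure (P \<omega>) (box t K) - pts S t K \<omega>"
    proof (rule emeasure_Diff)
      have "pts S t K \<omega> \<le> emeasure (P \<omega>) (box t K)"
        using \<omega> by (intro emeasure_mono) (auto simp: sets_P space_G box_half_plane)
      then show "pts S t K \<omega> \<noteq> \<infinity>"
        using emeasure_box_P[of \<omega> t K] \<omega> by (auto simp: space_G)
      show "sec S \<omega> \<inter> box t K \<in> sets (P \<omega>)"
        using sec_half_plane[of S \<omega>] S box_half_plane \<omega> by (auto simp: sets_pred sets_P space_G)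
    qed (use \<omega> in \<open>auto simp: sets_P space_G box_half_plane\<close>)
    finally show ?thesis .
  qed
  ultimately show "(\<lambda>\<omega>. pts (space M \<times> ({0<..} \<times> UNIV) - S) t K \<omega>) \<in> borel_measurable (G t)"
    by (simp cong: measurable_cong)
next
  fix A :: "nat \<Rightarrow> _" assume A: "disjoint_family A" "range A \<subseteq> sigma_sets (space M \<times> ({0<..} \<times> UNIV)) pred_gen"
    and IH: "\<And>i. (\<lambda>\<omega>. pts (A i) t K \<omega>) \<in> borel_measurable (G t)"
  have "pts (\<Union>i. A i) t K \<omega> = (\<Sum>i. pts (A i) t K \<omega>)"
    if \<omega>: "\<omega> \<in> space (G t)" for \<omega>
  proof -
    have "(\<Sum>i. pts (A i) t K \<omega>) = emeasure (P \<omega>) (\<Union>i. sec (A i) \<omega> \<inter> box t K)"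
    proof (rule suminf_emeasure)
      show "range (\<lambda>i. sec (A i) \<omega> \<inter> box t K) \<subseteq> sets (P \<omega>)"
        using sec_half_plane[of "A _" \<omega>] A(2) box_half_plane \<omega> by (auto simp: sets_pred sets_P space_G subset_iff)
      show "disjoint_family (\<lambda>i. sec (A i) \<omega> \<inter> box t K)"
        using A(1) unfolding disjoint_family_on_def by blast
    qed
    also have "(\<Union>i. sec (A i) \<omega> \<inter> box t K) = sec (\<Union>i. A i) \<omega> \<inter> box t K" by auto
    finally show ?thesis ..
  qed
  moreover have "(\<lambda>\<omega>. \<Sum>i. pts (A i) t K \<omega>) \<in> borel_measurable (G t)"
    using IH by measurable
  ultimately show "(\<lambda>\<omega>. pts (\<Union>i. A i) t K \<omega>) \<in> borel_measurable (G t)"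
    by (simp cong: measurable_cong)
qed simp

lemma SUP_box:
  assumes "sets Q = sets half_plane" "B \<in> sets half_plane" "B \<subseteq> {0<..} \<times> UNIV"
  shows "(SUP K. emeasure Q (B \<inter> box t K)) = emeasure Q (B \<inter> {0<..t} \<times> UNIV)"
    and "(SUP K. emeasure Q (B \<inter> box (real K) K)) = emeasure Q B"
proof -
  have bd: "\<exists>K::nat. \<bar>u\<bar> \<le> real K \<and> \<bar>v\<bar> \<le> real K" for u v :: real
  proof -
    obtain K1 K2 :: nat where "\<bar>u\<bar> \<le> real K1" "\<bar>v\<bar> \<le> real K2" using real_arch_simple by blast
    then show ?thesis by (intro exI[of _ "max K1 K2"]) auto
  qed
  have "(SUP K. emeasure Q (B \<inter> box t K)) = emeasure Q (\<Union>K. B \<inter> box t K)"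
  proof (rule SUP_emeasure_incseq)
    show "range (\<lambda>K. B \<inter> box t K) \<subseteq> sets Q" using assms box_half_plane by auto
    show "incseq (\<lambda>K. B \<inter> box t K)" unfolding box_def incseq_def by auto
  qed
  also have "(\<Union>K. B \<inter> box t K) = B \<inter> {0<..t} \<times> UNIV"
  proof (intro set_eqI iffI)
    fix z assume z: "z \<in> B \<inter> {0<..t} \<times> UNIV"
    obtain K :: nat where "\<bar>fst z\<bar> \<le> real K \<and> \<bar>snd z\<bar> \<le> real K" using bd by blast
    then show "z \<in> (\<Union>K. B \<inter> box t K)" using z unfolding box_def by (cases z) (auto intro!: exI[of _ K])
  qed (auto simp: box_def)
  finally show "(SUP K. emeasure Q (B \<inter> box t K)) = emeasure Q (B \<inter> {0<..t} \<times> UNIV)" .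
  have "(SUP K. emeasure Q (B \<inter> box (real K) K)) = emeasure Q (\<Union>K. B \<inter> box (real K) K)"
  proof (rule SUP_emeasure_incseq)
    show "range (\<lambda>K. B \<inter> box (real K) K) \<subseteq> sets Q" using assms box_half_plane by auto
    show "incseq (\<lambda>K. B \<inter> box (real K) K)" unfolding box_def incseq_def by auto
  qed
  also have "(\<Union>K. B \<inter> box (real K) K) = B"
  proof (intro set_eqI iffI)
    fix z assume z: "z \<in> B"
    obtain K :: nat where "\<bar>fst z\<bar> \<le> real K \<and> \<bar>snd z\<bar> \<le> real K" using bd by blast
    then show "z \<in> (\<Union>K. B \<inter> box (real K) K)" using z assms(3) unfolding box_def by (cases z) (auto intro!: exI[of _ K])
  qed auto
  finally show "(SUP K. emeasure Q (B \<inter> box (real K) K)) = emeasure Q B" .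
qed

lemma adapted_sec:
  assumes t: "0 \<le> t" and S: "S \<in> sets pred"
  shows "(\<lambda>\<omega>. emeasure (P \<omega>) (sec S \<omega> \<inter> {0<..t} \<times> UNIV)) \<in> borel_measurable (G t)"
proof -
  have "(\<lambda>\<omega>. SUP K. pts S t K \<omega>) \<in> borel_measurable (G t)"
    using adapted_box[OF assms] by measurable
  moreover have "emeasure (P \<omega>) (sec S \<omega> \<inter> {0<..t} \<times> UNIV) = (SUP K. pts S t K \<omega>)"
    if "\<omega> \<in> space (G t)" for \<omega>
    using that SUP_box(1)[OF sets_P sec_half_plane[OF S] sec_pos[OF S]] by (simp add: space_G)
  ultimately show ?thesis by (simp cong: measurable_cong)
qed

lemma G_measurable: "f \<in> borel_measurable (G t) \<Longrightarrow> f \<in> borel_measurable M"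
  using measurable_mono[OF order_refl refl sets_G space_G[of t], of borel] by auto

lemma lborel_sec_measurable:
  assumes "S \<in> sets pred" "B \<in> sets borel"
  shows "(\<lambda>\<omega>. emeasure lborel (sec S \<omega> \<inter> B)) \<in> borel_measurable M"
proof -
  have "S \<inter> space M \<times> B \<in> sets (M \<Otimes>\<^sub>M lborel)"
    using assms pred_subset_product by (intro sets.Int) (auto cong: sets_pair_measure_cong)
  from lborel.measurable_emeasure_Pair[OF this]
  have "(\<lambda>\<omega>. emeasure lborel (sec (S \<inter> space M \<times> B) \<omega>)) \<in> borel_measurable M" .
  moreover have "sec (S \<inter> space M \<times> B) \<omega> = sec S \<omega> \<inter> B" if "\<omega> \<in> space M" for \<omega> using that by auto
  ultimately show ?thesis by (simp cong: measurable_cong)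
qed

text \<open>Dynkin's argument again: the generators are covered by \<open>compensator\<close>, and
  for a complement the finite expectation belonging to \<open>S\<close> is cancelled from two
  expressions for the full box.\<close>

lemma Campbell_box:
  assumes t: "0 \<le> t" and S: "S \<in> sets pred"
  shows "(\<integral>\<^sup>+\<omega>. pts S t K \<omega> \<partial>M) = (\<integral>\<^sup>+\<omega>. area S t K \<omega> \<partial>M)"
  using S unfolding sets_pred
proof (rule sigma_sets_induct_disjoint[OF Int_stable_pred_gen pred_gen_subset])
  fix a assume "a \<in> pred_gen"
  then obtain A s C where a: "a = A \<times> ({s<..} \<times> C)" "0 \<le> s" "A \<in> sets (G s)" "C \<in> sets borel"
    unfolding pred_gen_def by blast
  let ?B = "({s<..} \<times> C) \<inter> box t K"
  have A: "A \<in> sets M" using a sets_G by auto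
  have B: "?B \<in> sets half_plane"
  proof -
    have "?B = ({s<..} \<inter> {0<..min t (real K)}) \<times> (C \<inter> {- real K..real K})"
      unfolding box_def by auto
    also have "\<dots> \<in> sets half_plane" using a by (intro Times_half_plane) auto
    finally show ?thesis .
  qed
  have "emeasure half_plane ?B \<le> emeasure half_plane (box t K)"
    by (intro emeasure_mono box_half_plane) auto
  then have fin: "emeasure half_plane ?B < \<infinity>" using emeasure_box le_less_trans by blast
  have "(\<integral>\<^sup>+\<omega>. pts a t K \<omega> \<partial>M) = (\<integral>\<^sup>+\<omega>\<in>A. emeasure (P \<omega>) ?B \<partial>M)"
    by (rule nn_integral_cong) (simp add: a pred_gen_section)
  also have "\<dots> = emeasure M A * emeasure half_plane ?B"
    by (rule compensator[OF a(2,3) B _ fin]) auto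
  also have "\<dots> = (\<integral>\<^sup>+\<omega>. emeasure lborel ?B * indicator A \<omega> \<partial>M)"
    using nn_integral_cmult_indicator[OF A, of "emeasure lborel ?B"]
    by (simp add: emeasure_half_plane[OF B] mult.commute)
  also have "\<dots> = (\<integral>\<^sup>+\<omega>. area a t K \<omega> \<partial>M)"
    by (rule nn_integral_cong) (auto simp: a indicator_def vimage_def)
  finally show "(\<integral>\<^sup>+\<omega>. pts a t K \<omega> \<partial>M) = (\<integral>\<^sup>+\<omega>. area a t K \<omega> \<partial>M)" .
next
  fix S assume S: "S \<in> sigma_sets (space M \<times> ({0<..} \<times> UNIV)) pred_gen"
    and IH: "(\<integral>\<^sup>+\<omega>. pts S t K \<omega> \<partial>M) = (\<integral>\<^sup>+\<omega>. area S t K \<omega> \<partial>M)"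
  let ?S' = "space M \<times> ({0<..} \<times> UNIV) - S"
  have S': "?S' \<in> sets pred" "S \<in> sets pred" using S unfolding sets_pred by (auto intro: sigma_sets.Compl)
  have T: "space M \<times> ({0<..} \<times> UNIV) \<in> sets pred" using space_pred sets.top by metis
  have box_b: "box t K \<in> sets borel" using box_half_plane sets_half_plane by auto
  have split: "emeasure Q (sec S \<omega> \<inter> box t K) + emeasure Q (sec ?S' \<omega> \<inter> box t K) = emeasure Q (box t K)"
    if "sets Q = sets half_plane \<or> sets Q = sets borel" "\<omega> \<in> space M" for Q \<omega>
  proof -
    have "emeasure Q (sec S \<omega> \<inter> box t K) + emeasure Q (sec ?S' \<omega> \<inter> box t K) =
      emeasure Q ((sec S \<omega> \<inter> box t K) \<union> (sec ?S' \<omega> \<inter> box t K))"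
      using that(1) sec_half_plane[OF S'(1), of \<omega>] sec_half_plane[OF S'(2), of \<omega>] box_half_plane[of t K]
        sec_borel[OF S'(1), of \<omega>] sec_borel[OF S'(2), of \<omega>] box_b
      by (intro plus_emeasure) auto
    also have "(sec S \<omega> \<inter> box t K) \<union> (sec ?S' \<omega> \<inter> box t K) = box t K"
      using that(2) by (auto simp: box_def)
    finally show ?thesis .
  qed
  have mP: "(\<lambda>\<omega>. pts T t K \<omega>) \<in> borel_measurable M" if "T \<in> sets pred" for T
    using adapted_box[OF t that] by (rule G_measurable)
  have mL: "(\<lambda>\<omega>. area T t K \<omega>) \<in> borel_measurable M" if "T \<in> sets pred" for T
    by (rule lborel_sec_measurable[OF that box_b])
  have tot: "(\<integral>\<^sup>+\<omega>. emeasure (P \<omega>) (box t K) \<partial>M) = emeasure half_plane (box t K)"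
    using compensator[OF order_refl, of "space M" "box t K"] box_half_plane emeasure_box
      sets.top[of "G 0"] by (simp add: space_G box_def emeasure_space_1 Times_subset_cancel2 subset_iff cong: nn_integral_cong)
  let ?x = "\<integral>\<^sup>+\<omega>. pts S t K \<omega> \<partial>M"
  let ?y = "\<integral>\<^sup>+\<omega>. pts ?S' t K \<omega> \<partial>M"
  let ?y' = "\<integral>\<^sup>+\<omega>. area ?S' t K \<omega> \<partial>M"
  have "?x + ?y = (\<integral>\<^sup>+\<omega>. emeasure (P \<omega>) (box t K) \<partial>M)"
    unfolding nn_integral_add[OF mP[OF S'(2)] mP[OF S'(1)], symmetric]
    by (rule nn_integral_cong, rule split) (auto simp: sets_P)
  then have e1: "?x + ?y = emeasure half_plane (box t K)" unfolding tot .
  have "?x + ?y' = (\<integral>\<^sup>+\<omega>. emeasure lborel (box t K) \<partial>M)"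
    unfolding IH nn_integral_add[OF mL[OF S'(2)] mL[OF S'(1)], symmetric]
    by (rule nn_integral_cong, rule split) auto
  then have e2: "?x + ?y' = emeasure half_plane (box t K)"
    by (simp add: emeasure_space_1 emeasure_half_plane[OF box_half_plane])
  have "?x \<le> ?x + ?y" by simp
  then have "?x \<noteq> \<top>" unfolding e1 using emeasure_box[of t K] by (auto simp: top_unique)
  moreover have "?x + ?y = ?x + ?y'" unfolding e1 e2 ..
  ultimately show "?y = ?y'" by (simp only: ennreal_add_left_cancel infinity_ennreal_def simp_thms)
next
  fix A :: "nat \<Rightarrow> _" assume A: "disjoint_family A" "range A \<subseteq> sigma_sets (space M \<times> ({0<..} \<times> UNIV)) pred_gen"
    and IH: "\<And>i. (\<integral>\<^sup>+\<omega>. pts (A i) t K \<omega> \<partial>M) = (\<integral>\<^sup>+\<omega>. area (A i) t K \<omega> \<partial>M)"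
  have Ai: "A i \<in> sets pred" for i using A(2) unfolding sets_pred by auto
  have box_b: "box t K \<in> sets borel" using box_half_plane sets_half_plane by auto
  have split: "emeasure Q (sec (\<Union>i. A i) \<omega> \<inter> box t K) = (\<Sum>i. emeasure Q (sec (A i) \<omega> \<inter> box t K))"
    if "sets Q = sets half_plane \<or> sets Q = sets borel" for Q \<omega>
  proof -
    have "(\<Sum>i. emeasure Q (sec (A i) \<omega> \<inter> box t K)) = emeasure Q (\<Union>i. sec (A i) \<omega> \<inter> box t K)"
    proof (rule suminf_emeasure)
      show "range (\<lambda>i. sec (A i) \<omega> \<inter> box t K) \<subseteq> sets Q"
        using sec_half_plane[OF Ai, where \<omega>=\<omega>] sec_borel[OF Ai, where \<omega>=\<omega>] box_half_plane[of t K] box_b that by auto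
      show "disjoint_family (\<lambda>i. sec (A i) \<omega> \<inter> box t K)"
        using A(1) unfolding disjoint_family_on_def by blast
    qed
    also have "(\<Union>i. sec (A i) \<omega> \<inter> box t K) = sec (\<Union>i. A i) \<omega> \<inter> box t K" by auto
    finally show ?thesis ..
  qed
  have "(\<integral>\<^sup>+\<omega>. pts (\<Union>i. A i) t K \<omega> \<partial>M) = (\<integral>\<^sup>+\<omega>. (\<Sum>i. pts (A i) t K \<omega>) \<partial>M)"
    by (rule nn_integral_cong) (simp add: split sets_P)
  also have "\<dots> = (\<Sum>i. \<integral>\<^sup>+\<omega>. pts (A i) t K \<omega> \<partial>M)"
    by (rule nn_integral_suminf) (rule G_measurable[OF adapted_box[OF t Ai]])
  also have "\<dots> = (\<Sum>i. \<integral>\<^sup>+\<omega>. area (A i) t K \<omega> \<partial>M)" unfolding IH ..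
  also have "\<dots> = (\<integral>\<^sup>+\<omega>. (\<Sum>i. area (A i) t K \<omega>) \<partial>M)"
    by (rule nn_integral_suminf[symmetric]) (rule lborel_sec_measurable[OF Ai box_b])
  also have "\<dots> = (\<integral>\<^sup>+\<omega>. area (\<Union>i. A i) t K \<omega> \<partial>M)"
    by (rule nn_integral_cong) (simp add: split)
  finally show "(\<integral>\<^sup>+\<omega>. pts (\<Union>i. A i) t K \<omega> \<partial>M) =
      (\<integral>\<^sup>+\<omega>. area (\<Union>i. A i) t K \<omega> \<partial>M)" .
qed simp

text \<open>Monotone convergence along boxes that grow in time and mark together removes the
  truncation.\<close>

theorem Campbell:
  assumes S: "S \<in> sets pred"
  shows "(\<integral>\<^sup>+\<omega>. emeasure (P \<omega>) (sec S \<omega>) \<partial>M) = (\<integral>\<^sup>+\<omega>. emeasure lborel (sec S \<omega>) \<partial>M)"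
proof -
  have box_b: "box t K \<in> sets borel" for t K using box_half_plane sets_half_plane by auto
  have inc: "box (real K) K \<subseteq> box (real K') K'" if "K \<le> K'" for K K'
    using that unfolding box_def by auto
  have "(\<integral>\<^sup>+\<omega>. emeasure (P \<omega>) (sec S \<omega>) \<partial>M) = (\<integral>\<^sup>+\<omega>. (SUP K. pts S (real K) K \<omega>) \<partial>M)"
    by (rule nn_integral_cong) (simp add: SUP_box(2)[OF sets_P sec_half_plane[OF S] sec_pos[OF S]])
  also have "\<dots> = (SUP K. \<integral>\<^sup>+\<omega>. pts S (real K) K \<omega> \<partial>M)"
  proof (rule nn_integral_monotone_convergence_SUP_AE)
    show "(\<lambda>\<omega>. pts S (real K) K \<omega>) \<in> borel_measurable M" for K
      by (rule G_measurable[OF adapted_box[OF _ S]]) simp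
    show "AE \<omega> in M. pts S (real K) K \<omega> \<le> pts S (real (Suc K)) (Suc K) \<omega>" for K
      by (rule AE_I2, rule emeasure_mono)
        (use inc[of K "Suc K"] sec_half_plane[OF S] box_half_plane in \<open>auto simp: sets_P\<close>)
  qed
  also have "\<dots> = (SUP K. \<integral>\<^sup>+\<omega>. area S (real K) K \<omega> \<partial>M)"
    by (simp add: Campbell_box[OF _ S])
  also have "\<dots> = (\<integral>\<^sup>+\<omega>. (SUP K. area S (real K) K \<omega>) \<partial>M)"
  proof (rule nn_integral_monotone_convergence_SUP_AE[symmetric])
    show "(\<lambda>\<omega>. area S (real K) K \<omega>) \<in> borel_measurable M" for K
      by (rule lborel_sec_measurable[OF S box_b])
    show "AE \<omega> in M. area S (real K) K \<omega> \<le> area S (real (Suc K)) (Suc K) \<omega>" for K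
      by (rule AE_I2, rule emeasure_mono)
        (use inc[of K "Suc K"] sec_borel[OF S] box_b in auto)
  qed
  also have "\<dots> = (\<integral>\<^sup>+\<omega>. emeasure lborel (sec S \<omega>) \<partial>M)"
  proof (rule nn_integral_cong)
    fix \<omega> assume "\<omega> \<in> space M"
    have "(SUP K. emeasure half_plane (sec S \<omega> \<inter> box (real K) K)) = emeasure half_plane (sec S \<omega>)"
      by (rule SUP_box(2)[OF refl sec_half_plane[OF S] sec_pos[OF S]])
    then show "(SUP K. area S (real K) K \<omega>) = emeasure lborel (sec S \<omega>)"
      using sec_half_plane[OF S] box_half_plane by (simp add: emeasure_half_plane)
  qed
  finally show ?thesis .
qed

lemma P_sec_measurable:
  assumes S: "S \<in> sets pred"
  shows "(\<lambda>\<omega>. emeasure (P \<omega>) (sec S \<omega>)) \<in> borel_measurable M"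
proof -
  have "(\<lambda>\<omega>. pts S (real K) K \<omega>) \<in> borel_measurable M" for K
    by (rule G_measurable[OF adapted_box[OF _ S]]) simp
  then have "(\<lambda>\<omega>. SUP K. pts S (real K) K \<omega>) \<in> borel_measurable M"
    by measurable
  then show ?thesis
    by (rule measurable_cong[THEN iffD1, rotated])
      (simp add: SUP_box(2)[OF sets_P sec_half_plane[OF S] sec_pos[OF S]])
qed

lemma pred_time_measurable [measurable]: "(\<lambda>z. fst (snd z)) \<in> borel_measurable pred"
proof (rule borel_measurableI_greater)
  fix s :: real
  have "{z \<in> space pred. s < fst (snd z)} = space M \<times> ({max 0 s<..} \<times> UNIV)"
    unfolding space_pred by auto
  also have "\<dots> \<in> sets pred"
    using sets.top[of "G (max 0 s)"] by (intro predI) (auto simp: space_G)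
  finally show "{z \<in> space pred. s < fst (snd z)} \<in> sets pred" .
qed

lemma pred_mark_measurable [measurable]: "(\<lambda>z. snd (snd z)) \<in> borel_measurable pred"
proof (rule measurableI)
  fix C :: "real set" assume "C \<in> sets borel"
  then have "space M \<times> ({0<..} \<times> C) \<in> sets pred"
    using sets.top[of "G 0"] by (intro predI) (auto simp: space_G)
  also have "space M \<times> ({0<..} \<times> C) = (\<lambda>z. snd (snd z)) -` C \<inter> space pred"
    unfolding space_pred by auto
  finally show "(\<lambda>z. snd (snd z)) -` C \<inter> space pred \<in> sets pred" .
qed simp

text \<open>Strictness of \<open>q < u\<close> makes the set predictable: it is a countable union of
  generators that open after \<open>q\<close> and use an event of \<open>G q\<close>.\<close>

lemma pred_after:
  assumes "\<And>q. 0 \<le> q \<Longrightarrow> E q \<in> sets (G q)"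
  shows "{z \<in> space pred. \<exists>q\<in>\<rat>. 0 \<le> q \<and> q < fst (snd z) \<and> fst z \<in> E q} \<in> sets pred"
proof -
  have "{z \<in> space pred. \<exists>q\<in>\<rat>. 0 \<le> q \<and> q < fst (snd z) \<and> fst z \<in> E q} =
      (\<Union>q\<in>\<rat> \<inter> {0..}. E q \<times> ({q<..} \<times> UNIV))"
    using G_sets_into[OF assms] by (fastforce simp: space_pred)
  also have "\<dots> \<in> sets pred"
    by (rule sets.countable_UN'') (auto intro: countable_Int1 countable_rat predI assms)
  finally show ?thesis .
qed

end

subsection \<open>The law of a transition\<close>

lemma AE_lborel_translation:
  fixes b :: real
  assumes "AE y in lborel. R y"
  shows "AE u in lborel. R (u - b)"
proof -
  obtain N where N: "{y \<in> space lborel. \<not> R y} \<subseteq> N" "emeasure lborel N = 0" "N \<in> sets lborel"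
    using assms by (rule AE_E)
  then have "N \<in> null_sets lborel" by auto
  then have "{u. u - b \<in> N} \<in> null_sets lborel" by (rule null_sets_translation)
  then show ?thesis by (rule AE_I') (use N(1) in auto)
qed

lemma UN_select:
  "x \<in> S \<Longrightarrow> (\<Union>i\<in>S. \<Union>j\<in>S - {i}. if x = i then f j else {}) = (\<Union>j\<in>S - {x}. f j)"
proof (intro equalityI subsetI)
  fix z assume "z \<in> (\<Union>i\<in>S. \<Union>j\<in>S - {i}. if x = i then f j else {})"
  then obtain i j where "j \<in> S - {i}" "z \<in> (if x = i then f j else {})" by blast
  then show "z \<in> (\<Union>j\<in>S - {x}. f j)" by (cases "x = i") auto
next
  fix z assume x: "x \<in> S" and "z \<in> (\<Union>j\<in>S - {x}. f j)"
  then obtain j where j: "j \<in> S - {x}" "z \<in> f j" by blast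
  show "z \<in> (\<Union>i\<in>S. \<Union>j\<in>S - {i}. if x = i then f j else {})"
    by (rule UN_I[OF x], rule UN_I[OF j(1)]) (simp add: j(2))
qed

locale sde_flow = compensated_measure M G P for M :: "'a measure" and G P +
  fixes ord :: "(nat \<times> nat) set" and lam lamt :: "nat \<Rightarrow> nat \<Rightarrow> real \<Rightarrow> nat \<Rightarrow> real"
    and X :: "real \<Rightarrow> 'a \<Rightarrow> nat" and Y :: "real \<Rightarrow> 'a \<Rightarrow> real" and N :: "real \<Rightarrow> 'a \<Rightarrow> nat"
  assumes rates: "rates lam" and majorants: "rate_majorants lam lamt"
    and order: "strict_linear_order_on states ord"
    and summable: "rates_summable lam" and diverge: "rates_diverge lam"
    and well_defined: "Lambda_well_defined ord lamt"
    and path: "\<omega> \<in> space M \<Longrightarrow> sde_path ord lam lamt (P \<omega>) (\<lambda>t. X t \<omega>) (\<lambda>t. Y t \<omega>) (\<lambda>t. N t \<omega>)"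
    and initial: "{\<omega> \<in> space M. X 0 \<omega> = i \<and> a \<le> Y 0 \<omega>} \<in> sets (G 0)"
begin

section \<open>The cycles as random variables\<close>

definition T :: "nat \<Rightarrow> 'a \<Rightarrow> real" where "T k \<omega> = arrival (\<lambda>t. N t \<omega>) k"
definition xs :: "nat \<Rightarrow> 'a \<Rightarrow> nat" where "xs k \<omega> = X (T k \<omega>) \<omega>"
text \<open>The virtual time at which the current age would have been 0. At reached levels it is
  \<open>T k\<close> for \<open>k \<ge> 1\<close> and \<open>- Y 0\<close> for \<open>k = 0\<close>,
  so that the age at \<open>u\<close> in the cycle is always
  \<open>u - birth k \<omega>\<close>.\<close>

definition birth :: "nat \<Rightarrow> 'a \<Rightarrow> real" where "birth k \<omega> = T k \<omega> - Y (T k \<omega>) \<omega>"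
definition reached :: "nat \<Rightarrow> 'a \<Rightarrow> bool" where "reached k \<omega> \<longleftrightarrow> (\<exists>t\<ge>0. k \<le> N t \<omega>)"
text \<open>Strictly before \<open>u\<close>, in keeping with left limits: as a function of
  \<open>u\<close> the indicator is left-continuous.\<close>

definition before :: "nat \<Rightarrow> 'a \<Rightarrow> real \<Rightarrow> bool" where "before k \<omega> u \<longleftrightarrow> (\<exists>s. 0 \<le> s \<and> s < u \<and> k \<le> N s \<omega>)"
abbreviation "live k \<omega> \<equiv> sde_path.live (\<lambda>t. N t \<omega>) k"
abbreviation "jump_region k j \<omega> \<equiv> sde_path.jump_region ord lam lamt (\<lambda>t. X t \<omega>) (\<lambda>t. Y t \<omega>) (\<lambda>t. N t \<omega>) k j"

lemma reached_0: "reached 0 \<omega>"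
  unfolding reached_def by auto

lemma reached_mono: "reached k \<omega> \<Longrightarrow> l \<le> k \<Longrightarrow> reached l \<omega>"
  unfolding reached_def by (meson order_trans)

context
  fixes \<omega> assumes \<omega>: "\<omega> \<in> space M"
begin

interpretation p: sde_path ord lam lamt "P \<omega>" "\<lambda>t. X t \<omega>" "\<lambda>t. Y t \<omega>" "\<lambda>t. N t \<omega>"
  by (rule path[OF \<omega>])

lemma T_nonneg: "reached k \<omega> \<Longrightarrow> 0 \<le> T k \<omega>"
  unfolding T_def reached_def by (rule p.arrival_nonneg)

lemma T_0: "T 0 \<omega> = 0"
  unfolding T_def by (rule p.arrival_0)

lemma T_less: "reached (Suc k) \<omega> \<Longrightarrow> T k \<omega> < T (Suc k) \<omega>"
  unfolding T_def reached_def by (rule p.arrival_less)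

lemma le_N_iff: "reached k \<omega> \<Longrightarrow> 0 \<le> t \<Longrightarrow> k \<le> N t \<omega> \<longleftrightarrow> T k \<omega> \<le> t"
  unfolding T_def reached_def by (rule p.le_N_iff)

lemma N_mono: "0 \<le> s \<Longrightarrow> s \<le> t \<Longrightarrow> N s \<omega> \<le> N t \<omega>"
  by (rule p.N_mono)

lemma xs_states: "reached k \<omega> \<Longrightarrow> xs k \<omega> \<in> states"
  unfolding xs_def by (rule p.X_states) (rule T_nonneg)

lemma xs_Suc: "reached (Suc k) \<omega> \<Longrightarrow> xs (Suc k) \<omega> \<in> states - {xs k \<omega>}"
  unfolding xs_def T_def reached_def by (rule p.arrival_Suc(1))

lemma birth_Suc: "reached (Suc k) \<omega> \<Longrightarrow> birth (Suc k) \<omega> = T (Suc k) \<omega>"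
  unfolding birth_def T_def reached_def using p.arrival_Suc(2) by simp

lemma birth_0: "birth 0 \<omega> = - Y 0 \<omega>"
  unfolding birth_def T_0 by simp

lemma birth_le: "reached k \<omega> \<Longrightarrow> birth k \<omega> \<le> T k \<omega>"
  unfolding birth_def using p.Y_nonneg[OF T_nonneg] by simp

lemma before_iff: "before k \<omega> u \<longleftrightarrow> reached k \<omega> \<and> T k \<omega> < u"
proof
  assume "before k \<omega> u"
  then obtain s where s: "0 \<le> s" "s < u" "k \<le> N s \<omega>" unfolding before_def by auto
  then have r: "reached k \<omega>" unfolding reached_def by auto
  with s show "reached k \<omega> \<and> T k \<omega> < u" using le_N_iff[OF r s(1)] by auto
next
  assume "reached k \<omega> \<and> T k \<omega> < u"
  then show "before k \<omega> u"
    unfolding before_def using le_N_iff[of k "T k \<omega>"] T_nonneg[of k] by (intro exI[of _ "T k \<omega>"]) auto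
qed

lemma before_rat: "before k \<omega> u \<longleftrightarrow> (\<exists>q\<in>\<rat>. 0 \<le> q \<and> q < u \<and> k \<le> N q \<omega>)"
proof
  assume "before k \<omega> u"
  then obtain s where s: "0 \<le> s" "s < u" "k \<le> N s \<omega>" unfolding before_def by auto
  obtain q where q: "q \<in> \<rat>" "s < q" "q < u" using Rats_dense_in_real[OF s(2)] by auto
  then show "\<exists>q\<in>\<rat>. 0 \<le> q \<and> q < u \<and> k \<le> N q \<omega>"
    using s N_mono[of s q] by (intro bexI[of _ q]) auto
qed (auto simp: before_def)

lemma live_iff: "reached k \<omega> \<Longrightarrow> u \<in> live k \<omega> \<longleftrightarrow> before k \<omega> u \<and> \<not> before (Suc k) \<omega> u"
  unfolding before_iff[of k] p.live_def T_def[symmetric] by (auto simp: before_def not_less_eq_eq)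

lemma live_eq:
  "reached (Suc k) \<omega> \<Longrightarrow> live k \<omega> = {T k \<omega><..T (Suc k) \<omega>}"
  "\<not> reached (Suc k) \<omega> \<Longrightarrow> live k \<omega> = {T k \<omega><..}"
  unfolding T_def reached_def by (rule p.live_reach, assumption) (rule p.live_not_reach, assumption)

lemma mem_jump_region: "(u, v) \<in> jump_region k j \<omega> \<longleftrightarrow> T k \<omega> < u \<and> v \<in> Lambda ord lam lamt (xs k \<omega>) j (u - birth k \<omega>) k"
proof -
  have eq: "u - birth k \<omega> = Y (T k \<omega>) \<omega> + (u - T k \<omega>)" unfolding birth_def by simp
  show ?thesis unfolding eq unfolding p.jump_region_def xs_def T_def by simp
qed

lemma Suc_le_N: "reached k \<omega> \<Longrightarrow> 0 \<le> t \<Longrightarrow>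
    Suc k \<le> N t \<omega> \<longleftrightarrow> emeasure (P \<omega>) ((\<Union>j\<in>states - {xs k \<omega>}. jump_region k j \<omega>) \<inter> {0<..t} \<times> UNIV) \<noteq> 0"
  unfolding xs_def T_def reached_def by (rule p.Suc_le_N_iff)

lemma P_jump_region_live: "reached k \<omega> \<Longrightarrow> j \<in> states - {xs k \<omega>} \<Longrightarrow> A \<in> sets borel \<Longrightarrow>
    emeasure (P \<omega>) (jump_region k j \<omega> \<inter> (live k \<omega> \<inter> A) \<times> UNIV) =
      of_bool (reached (Suc k) \<omega> \<and> T (Suc k) \<omega> \<in> A \<and> xs (Suc k) \<omega> = j)"
  unfolding xs_def T_def reached_def by (rule p.emeasure_jump_region_live)

lemma jump_time_eq: "(\<And>k. reached k \<omega>) \<Longrightarrow> jump_time (\<lambda>t. X t \<omega>) k = T k \<omega>"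
  unfolding T_def reached_def by (rule p.jump_time_eq_arrival)

end

abbreviation "Lam \<equiv> Lambda ord lam lamt"

section \<open>Predictability of the solution\<close>

text \<open>In terms of \<open>T k\<close>, this says that \<open>T k\<close> is a stopping time of
  \<open>G\<close> and that the state and the birth time at level \<open>k\<close> belong to the
  information available at \<open>T k\<close>.\<close>

definition known :: "nat \<Rightarrow> bool" where
  "known k \<longleftrightarrow> (\<forall>t\<ge>0. \<forall>i a. {\<omega> \<in> space M. k \<le> N t \<omega> \<and> xs k \<omega> = i \<and> birth k \<omega> \<le> a} \<in> sets (G t))"

lemma knownD: "known k \<Longrightarrow> 0 \<le> t \<Longrightarrow> {\<omega> \<in> space M. k \<le> N t \<omega> \<and> xs k \<omega> = i \<and> birth k \<omega> \<le> a} \<in> sets (G t)"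
  unfolding known_def by auto

lemma ex_nat_ge: "\<exists>m::nat. (x :: real) \<le> real m"
  using real_arch_simple by blast

lemma known_N: assumes "known k" "0 \<le> t" shows "{\<omega> \<in> space M. k \<le> N t \<omega>} \<in> sets (G t)"
proof -
  have "{\<omega> \<in> space M. k \<le> N t \<omega>} = (\<Union>i. \<Union>m::nat. {\<omega> \<in> space M. k \<le> N t \<omega> \<and> xs k \<omega> = i \<and> birth k \<omega> \<le> real m})"
    using ex_nat_ge by auto
  also have "\<dots> \<in> sets (G t)"
    using knownD[OF assms] by (intro sets.countable_UN) auto
  finally show ?thesis .
qed

lemma before_pred:
  assumes "\<And>t. 0 \<le> t \<Longrightarrow> {\<omega> \<in> space M. k \<le> N t \<omega>} \<in> sets (G t)"
  shows "{z \<in> space pred. before k (fst z) (fst (snd z))} \<in> sets pred"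
proof -
  have "{z \<in> space pred. before k (fst z) (fst (snd z))} =
      {z \<in> space pred. \<exists>q\<in>\<rat>. 0 \<le> q \<and> q < fst (snd z) \<and> fst z \<in> {\<omega> \<in> space M. k \<le> N q \<omega>}}"
    by (auto simp: space_pred before_rat)
  then show ?thesis using pred_after[of "\<lambda>t. {\<omega> \<in> space M. k \<le> N t \<omega>}"] assms by simp
qed

lemma known_before:
  assumes "known k"
  shows "{z \<in> space pred. before k (fst z) (fst (snd z)) \<and> xs k (fst z) = i \<and> birth k (fst z) \<le> a} \<in> sets pred"
proof -
  let ?E = "\<lambda>q. {\<omega> \<in> space M. k \<le> N q \<omega> \<and> xs k \<omega> = i \<and> birth k \<omega> \<le> a}"
  have "{z \<in> space pred. before k (fst z) (fst (snd z)) \<and> xs k (fst z) = i \<and> birth k (fst z) \<le> a} =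
      {z \<in> space pred. \<exists>q\<in>\<rat>. 0 \<le> q \<and> q < fst (snd z) \<and> fst z \<in> ?E q}"
    by (auto simp: space_pred before_rat)
  then show ?thesis using pred_after[of ?E] knownD[OF assms] by simp
qed

lemma known_before_state:
  assumes "known k"
  shows "{z \<in> space pred. before k (fst z) (fst (snd z)) \<and> xs k (fst z) = i} \<in> sets pred"
proof -
  have "{z \<in> space pred. before k (fst z) (fst (snd z)) \<and> xs k (fst z) = i} =
      (\<Union>m::nat. {z \<in> space pred. before k (fst z) (fst (snd z)) \<and> xs k (fst z) = i \<and> birth k (fst z) \<le> real m})"
    using ex_nat_ge by auto
  also have "\<dots> \<in> sets pred" using known_before[OF assms] by (intro sets.countable_UN) auto
  finally show ?thesis .
qed

text \<open>The default -1 lies outside the range of ages, so points where level \<open>k\<close> is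
  not yet reached, or the state is not \<open>i\<close>, drop out of every set over nonnegative
  ages.\<close>

definition age :: "nat \<Rightarrow> nat \<Rightarrow> 'a \<times> real \<times> real \<Rightarrow> real" where
  "age k i z = (if before k (fst z) (fst (snd z)) \<and> xs k (fst z) = i then fst (snd z) - birth k (fst z) else - 1)"

lemma age_measurable: assumes "known k" shows "age k i \<in> borel_measurable pred"
proof -
  let ?V = "\<lambda>z. before k (fst z) (fst (snd z)) \<and> xs k (fst z) = i"
  have [measurable]: "Measurable.pred pred ?V"
    using known_before_state[OF assms] by (simp add: pred_def[symmetric] Measurable.pred_def)
  have "(\<lambda>z. if ?V z then birth k (fst z) else 0) \<in> borel_measurable pred"
  proof (rule borel_measurableI_le)
    fix a
    have "{z \<in> space pred. (if ?V z then birth k (fst z) else 0) \<le> a} =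
      {z \<in> space pred. before k (fst z) (fst (snd z)) \<and> xs k (fst z) = i \<and> birth k (fst z) \<le> a} \<union>
      (if 0 \<le> a then space pred - {z \<in> space pred. ?V z} else {})"
      by auto
    also have "\<dots> \<in> sets pred"
      using known_before[OF assms] known_before_state[OF assms] by auto
    finally show "{z \<in> space pred. (if ?V z then birth k (fst z) else 0) \<le> a} \<in> sets pred" .
  qed
  then have "(\<lambda>z. if ?V z then fst (snd z) - (if ?V z then birth k (fst z) else 0) else - 1) \<in> borel_measurable pred"
    by measurable
  also have "(\<lambda>z. if ?V z then fst (snd z) - (if ?V z then birth k (fst z) else 0) else - 1) = age k i"
    by (auto simp: age_def fun_eq_iff)
  finally show ?thesis .
qed

definition region :: "nat \<Rightarrow> nat \<Rightarrow> nat \<Rightarrow> ('a \<times> real \<times> real) set" where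
  "region k i j = {z \<in> space pred. before k (fst z) (fst (snd z)) \<and> xs k (fst z) = i \<and>
     snd (snd z) \<in> Lam i j (fst (snd z) - birth k (fst z)) k}"

lemma region_pred:
  assumes "known k" "i \<in> states" "j \<in> states - {i}" shows "region k i j \<in> sets pred"
proof -
  let ?L = "{(y, v). 0 \<le> y \<and> v \<in> Lam i j y k}"
  have L: "?L \<in> sets (borel \<Otimes>\<^sub>M borel)"
    using Lambda_region_measurable[OF rates majorants assms(2,3), of ord k] unfolding borel_prod .
  have "(\<lambda>z. (age k i z, snd (snd z))) \<in> pred \<rightarrow>\<^sub>M borel \<Otimes>\<^sub>M borel"
    using age_measurable[OF assms(1)] by measurable
  from measurable_sets[OF this L]
  have "(\<lambda>z. (age k i z, snd (snd z))) -` ?L \<inter> space pred \<in> sets pred" .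
  also have "(\<lambda>z. (age k i z, snd (snd z))) -` ?L \<inter> space pred = region k i j"
  proof -
    have "0 \<le> u - birth k \<omega>" if "\<omega> \<in> space M" "before k \<omega> u" for \<omega> u
      using that before_iff[OF that(1), of k u] birth_le[OF that(1), of k] by simp
    then show ?thesis unfolding region_def age_def by (auto simp: space_pred)
  qed
  finally show ?thesis .
qed

lemma sec_region:
  assumes "\<omega> \<in> space M"
  shows "sec (region k i j) \<omega> = (if reached k \<omega> \<and> xs k \<omega> = i then jump_region k j \<omega> else {})"
proof -
  have "(u, v) \<in> sec (region k i j) \<omega> \<longleftrightarrow> reached k \<omega> \<and> xs k \<omega> = i \<and> (u, v) \<in> jump_region k j \<omega>" for u v
    unfolding region_def using assms T_nonneg[OF assms, of k]
    by (auto simp: space_pred before_iff mem_jump_region)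
  then show ?thesis by auto
qed

text \<open>\<open>Suc_le_N_iff\<close> applied to a predictable set. This half of the induction
  step comes first because the cutoff in \<open>jump_set\<close> refers to level
  \<open>Suc k\<close>.\<close>

lemma known_Suc_N:
  assumes k: "known k" and t: "0 \<le> t"
  shows "{\<omega> \<in> space M. Suc k \<le> N t \<omega>} \<in> sets (G t)"
proof -
  let ?R = "\<Union>i\<in>states. \<Union>j\<in>states - {i}. region k i j"
  have R: "?R \<in> sets pred" using region_pred[OF k] by (intro sets.countable_UN'') auto
  have "Suc k \<le> N t \<omega> \<longleftrightarrow> emeasure (P \<omega>) (sec ?R \<omega> \<inter> {0<..t} \<times> UNIV) \<noteq> 0" if \<omega>: "\<omega> \<in> space M" for \<omega>
  proof (cases "reached k \<omega>")
    case True
    have "sec ?R \<omega> = (\<Union>i\<in>states. \<Union>j\<in>states - {i}. sec (region k i j) \<omega>)" by auto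
    also have "\<dots> = (\<Union>j\<in>states - {xs k \<omega>}. jump_region k j \<omega>)"
      unfolding sec_region[OF \<omega>] using UN_select[OF xs_states[OF \<omega> True], of "\<lambda>j. jump_region k j \<omega>"] True by simp
    finally show ?thesis using Suc_le_N[OF \<omega> True t] by simp
  next
    case False
    have "sec ?R \<omega> = (\<Union>i\<in>states. \<Union>j\<in>states - {i}. sec (region k i j) \<omega>)" by auto
    also have "\<dots> = {}" using False unfolding sec_region[OF \<omega>] by auto
    finally have "sec ?R \<omega> = {}" .
    moreover have "\<not> Suc k \<le> N t \<omega>"
      using False t reached_mono[of "Suc k" \<omega> k] unfolding reached_def by auto
    ultimately show ?thesis by simp
  qed
  then have "{\<omega> \<in> space M. Suc k \<le> N t \<omega>} =
      {\<omega> \<in> space (G t). emeasure (P \<omega>) (sec ?R \<omega> \<inter> {0<..t} \<times> UNIV) \<noteq> 0}"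
    by (auto simp: space_G)
  also have "\<dots> \<in> sets (G t)" using adapted_sec[OF t R] by measurable
  finally show ?thesis .
qed

text \<open>Since \<open>before\<close> is strict, the cutoff retains the closing arrival itself,
  and with it the point that triggers the transition.\<close>

definition jump_set :: "nat \<Rightarrow> nat \<Rightarrow> nat \<Rightarrow> real set \<Rightarrow> ('a \<times> real \<times> real) set" where
  "jump_set k i j A = {z \<in> region k i j. \<not> before (Suc k) (fst z) (fst (snd z)) \<and> fst (snd z) - birth k (fst z) \<in> A}"

lemma jump_set_pred:
  assumes k: "known k" and "i \<in> states" "j \<in> states - {i}" "A \<in> sets borel"
  shows "jump_set k i j A \<in> sets pred"
proof -
  have 1: "{z \<in> space pred. before (Suc k) (fst z) (fst (snd z))} \<in> sets pred"
    by (rule before_pred) (rule known_Suc_N[OF k])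
  have 2: "age k i -` A \<inter> space pred \<in> sets pred"
    by (rule measurable_sets[OF age_measurable[OF k] assms(4)])
  have "jump_set k i j A = region k i j \<inter> (age k i -` A \<inter> space pred) - {z \<in> space pred. before (Suc k) (fst z) (fst (snd z))}"
    unfolding jump_set_def region_def age_def by auto
  then show ?thesis using 1 2 region_pred[OF assms(1-3)] by auto
qed

lemma sec_jump_set:
  assumes \<omega>: "\<omega> \<in> space M"
  shows "sec (jump_set k i j A) \<omega> =
    (if reached k \<omega> \<and> xs k \<omega> = i then jump_region k j \<omega> \<inter> (live k \<omega> \<inter> {u. u - birth k \<omega> \<in> A}) \<times> UNIV else {})"
proof -
  have "(u, v) \<in> sec (jump_set k i j A) \<omega> \<longleftrightarrow> reached k \<omega> \<and> xs k \<omega> = i \<and>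
      (u, v) \<in> jump_region k j \<omega> \<and> u \<in> live k \<omega> \<and> u - birth k \<omega> \<in> A" for u v
  proof -
    have "(u, v) \<in> sec (jump_set k i j A) \<omega> \<longleftrightarrow>
        (u, v) \<in> sec (region k i j) \<omega> \<and> \<not> before (Suc k) \<omega> u \<and> u - birth k \<omega> \<in> A"
      unfolding jump_set_def by auto
    then show ?thesis unfolding sec_region[OF \<omega>]
      using live_iff[OF \<omega>, of k u] before_iff[OF \<omega>, of k u] mem_jump_region[OF \<omega>, of u v k j] by auto
  qed
  then show ?thesis by auto
qed

lemma P_jump_set:
  assumes \<omega>: "\<omega> \<in> space M" and j: "j \<in> states - {i}" and A: "A \<in> sets borel"
  shows "emeasure (P \<omega>) (sec (jump_set k i j A) \<omega>) =
    of_bool (xs k \<omega> = i \<and> reached (Suc k) \<omega> \<and> T (Suc k) \<omega> - birth k \<omega> \<in> A \<and> xs (Suc k) \<omega> = j)"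
proof (cases "reached k \<omega> \<and> xs k \<omega> = i")
  case True
  have "(\<lambda>u. u - birth k \<omega>) -` A \<inter> space borel \<in> sets borel"
    by (rule measurable_sets[OF _ A]) measurable
  then have "{u. u - birth k \<omega> \<in> A} \<in> sets borel" by (simp add: vimage_def)
  from P_jump_region_live[OF \<omega> _ _ this, of k j] show ?thesis
    using True j unfolding sec_jump_set[OF \<omega>] by auto
next
  case False
  then have "\<not> (xs k \<omega> = i \<and> reached (Suc k) \<omega>)" using reached_mono[of "Suc k" \<omega> k] by auto
  with False show ?thesis unfolding sec_jump_set[OF \<omega>] by auto
qed

lemma known: "known k"
proof (induction k)
  case 0
  show ?case unfolding known_def
  proof (intro allI impI)
    fix t :: real and i :: nat and a :: real assume t: "0 \<le> t"
    have "{\<omega> \<in> space M. 0 \<le> N t \<omega> \<and> xs 0 \<omega> = i \<and> birth 0 \<omega> \<le> a} = {\<omega> \<in> space M. X 0 \<omega> = i \<and> - a \<le> Y 0 \<omega>}"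
      by (auto simp: xs_def T_0 birth_0)
    then show "{\<omega> \<in> space M. 0 \<le> N t \<omega> \<and> xs 0 \<omega> = i \<and> birth 0 \<omega> \<le> a} \<in> sets (G t)"
      using initial[of i "- a"] mono_G[OF t] by auto
  qed
next
  case (Suc k)
  show ?case unfolding known_def
  proof (intro allI impI)
    fix t :: real and j :: nat and a :: real assume t: "0 \<le> t"
    let ?E = "{\<omega> \<in> space M. Suc k \<le> N t \<omega> \<and> xs (Suc k) \<omega> = j \<and> birth (Suc k) \<omega> \<le> a}"
    have E_iff: "\<omega> \<in> ?E \<longleftrightarrow> \<omega> \<in> space M \<and> reached (Suc k) \<omega> \<and> T (Suc k) \<omega> \<le> t \<and> T (Suc k) \<omega> \<le> a \<and> xs (Suc k) \<omega> = j" for \<omega>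
    proof (cases "\<omega> \<in> space M \<and> reached (Suc k) \<omega>")
      case True
      then show ?thesis using le_N_iff[of \<omega> "Suc k" t] birth_Suc[of \<omega> k] t by auto
    qed (use t in \<open>auto simp: reached_def\<close>)
    show "?E \<in> sets (G t)"
    proof (cases "j \<in> states \<and> 0 \<le> a")
      case False
      have "?E = {}"
      proof (rule equals0I)
        fix \<omega> assume "\<omega> \<in> ?E"
        then have "\<omega> \<in> space M" "reached (Suc k) \<omega>" "T (Suc k) \<omega> \<le> a" "xs (Suc k) \<omega> = j" unfolding E_iff by auto
        then show False using False T_nonneg[of \<omega> "Suc k"] xs_states[of \<omega> "Suc k"] by auto
      qed
      then show ?thesis by (simp only: sets.empty_sets)
    next
      case True
      \<comment> \<open>As the birth time at level \<open>Suc k\<close> is \<open>T (Suc k)\<close>,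
        the conditions \<open>Suc k \<le> N t\<close> and \<open>birth (Suc k) \<le> a\<close> merge
        into \<open>T (Suc k) \<le> min t a\<close>.\<close>
      define r where "r = min t a"
      have r: "0 \<le> r" "r \<le> t" using True t unfolding r_def by auto
      \<comment> \<open>All jump sets leading into \<open>j\<close>: up to time \<open>r\<close>
        they are charged exactly if the transition has happened by then and has led to
        \<open>j\<close>.\<close>
      let ?R = "\<Union>i\<in>states - {j}. jump_set k i j UNIV"
      have R: "?R \<in> sets pred" using jump_set_pred[OF Suc.IH] True by (intro sets.countable_UN'') auto
      have "\<omega> \<in> ?E \<longleftrightarrow> emeasure (P \<omega>) (sec ?R \<omega> \<inter> {0<..r} \<times> UNIV) \<noteq> 0" if \<omega>: "\<omega> \<in> space M" for \<omega>
      proof -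
        have "sec ?R \<omega> = (\<Union>i\<in>states - {j}. sec (jump_set k i j UNIV) \<omega>)" by auto
        also have "\<dots> = (if reached k \<omega> \<and> xs k \<omega> \<noteq> j then jump_region k j \<omega> \<inter> live k \<omega> \<times> UNIV else {})"
          using xs_states[OF \<omega>, of k] unfolding sec_jump_set[OF \<omega>] by auto
        finally have eq: "sec ?R \<omega> \<inter> {0<..r} \<times> UNIV =
            (if reached k \<omega> \<and> xs k \<omega> \<noteq> j then jump_region k j \<omega> \<inter> (live k \<omega> \<inter> {0<..r}) \<times> UNIV else {})"
          by auto
        show ?thesis
        proof (cases "reached k \<omega> \<and> xs k \<omega> \<noteq> j")
          case c: True
          have "emeasure (P \<omega>) (sec ?R \<omega> \<inter> {0<..r} \<times> UNIV) =
              of_bool (reached (Suc k) \<omega> \<and> T (Suc k) \<omega> \<in> {0<..r} \<and> xs (Suc k) \<omega> = j)"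
            unfolding eq using c True P_jump_region_live[OF \<omega>, of k j "{0<..r}"] by auto
          moreover have "0 < T (Suc k) \<omega>" if "reached (Suc k) \<omega>"
            using T_less[OF \<omega> that] T_nonneg[OF \<omega>, of k] c by simp
          ultimately show ?thesis unfolding E_iff using \<omega> by (auto simp: r_def)
        next
          case c: False
          have "\<omega> \<notin> ?E"
          proof
            assume "\<omega> \<in> ?E"
            then have "reached (Suc k) \<omega>" "xs (Suc k) \<omega> = j" unfolding E_iff by auto
            then show False using c xs_Suc[OF \<omega>, of k] reached_mono[of "Suc k" \<omega> k] by auto
          qed
          then show ?thesis using c unfolding eq by auto
        qed
      qed
      then have "?E = {\<omega> \<in> space (G r). emeasure (P \<omega>) (sec ?R \<omega> \<inter> {0<..r} \<times> UNIV) \<noteq> 0}"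
        by (auto simp: space_G)
      also have "\<dots> \<in> sets (G r)" using adapted_sec[OF r(1) R] by measurable
      finally show ?thesis using mono_G[OF r(2)] by auto
    qed
  qed
qed

lemma G_in_M: "A \<in> sets (G t) \<Longrightarrow> A \<in> sets M"
  using sets_G by blast

lemma reached_events: "{\<omega> \<in> space M. reached k \<omega>} \<in> sets M"
proof -
  have "{\<omega> \<in> space M. reached k \<omega>} = (\<Union>m::nat. {\<omega> \<in> space M. k \<le> N (real m) \<omega>})" (is "?L = ?R")
  proof (intro set_eqI iffI)
    fix \<omega> assume *: "\<omega> \<in> {\<omega> \<in> space M. reached k \<omega>}"
    then obtain t where t: "0 \<le> t" "k \<le> N t \<omega>" unfolding reached_def by auto
    obtain m :: nat where "t \<le> real m" using ex_nat_ge by auto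
    then show "\<omega> \<in> (\<Union>m::nat. {\<omega> \<in> space M. k \<le> N (real m) \<omega>})"
      using t N_mono[of \<omega> t "real m"] * by (auto intro!: exI[of _ m])
  next
    fix \<omega> assume R: "\<omega> \<in> ?R"
    then obtain m :: nat where "k \<le> N (real m) \<omega>" by auto
    then have "reached k \<omega>" unfolding reached_def by (intro exI[of _ "real m"]) simp
    with R show "\<omega> \<in> ?L" by auto
  qed
  also have "\<dots> \<in> sets M"
    by (intro sets.countable_UN) (auto intro!: G_in_M[OF known_N[OF known]])
  finally show ?thesis .
qed

lemma reached_state_events: "{\<omega> \<in> space M. reached k \<omega> \<and> xs k \<omega> = i} \<in> sets M"
proof -
  have "{\<omega> \<in> space M. reached k \<omega> \<and> xs k \<omega> = i} =
      (\<Union>m::nat. {\<omega> \<in> space M. k \<le> N (real m) \<omega> \<and> xs k \<omega> = i \<and> birth k \<omega> \<le> real m})" (is "?L = ?R")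
  proof (intro set_eqI iffI)
    fix \<omega> assume *: "\<omega> \<in> {\<omega> \<in> space M. reached k \<omega> \<and> xs k \<omega> = i}"
    then obtain t where t: "0 \<le> t" "k \<le> N t \<omega>" unfolding reached_def by auto
    obtain m :: nat where "max t (birth k \<omega>) \<le> real m" using real_arch_simple by blast
    then show "\<omega> \<in> (\<Union>m::nat. {\<omega> \<in> space M. k \<le> N (real m) \<omega> \<and> xs k \<omega> = i \<and> birth k \<omega> \<le> real m})"
      using t N_mono[of \<omega> t "real m"] * by (auto intro!: exI[of _ m])
  next
    fix \<omega> assume R: "\<omega> \<in> ?R"
    then obtain m :: nat where "k \<le> N (real m) \<omega>" by auto
    then have "reached k \<omega>" unfolding reached_def by (intro exI[of _ "real m"]) simp
    with R show "\<omega> \<in> ?L" by auto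
  qed
  also have "\<dots> \<in> sets M"
    by (intro sets.countable_UN) (auto intro!: G_in_M[OF knownD[OF known]])
  finally show ?thesis .
qed

lemma T_measurable: "T k \<in> borel_measurable M"
proof (rule borel_measurableI_le)
  fix a
  \<comment> \<open>All outcomes that never reach level \<open>k\<close> share the unspecified value
    \<open>Inf {}\<close>, so they enter a sublevel set all together or not at all.\<close>
  define c :: real where "c = Inf {}"
  have nr: "T k \<omega> = c" if "\<not> reached k \<omega>" for \<omega>
  proof -
    have "{t. 0 \<le> t \<and> k \<le> N t \<omega>} = {}" using that unfolding reached_def by auto
    then show ?thesis by (simp only: T_def arrival_def c_def)
  qed
  have "{\<omega> \<in> space M. T k \<omega> \<le> a} = (if 0 \<le> a then {\<omega> \<in> space M. k \<le> N a \<omega>} else {}) \<union>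
      (if c \<le> a then space M - {\<omega> \<in> space M. reached k \<omega>} else {})" (is "?l = ?r")
  proof (intro set_eqI)
    fix \<omega>
    show "\<omega> \<in> ?l \<longleftrightarrow> \<omega> \<in> ?r"
    proof (cases "\<omega> \<in> space M \<and> reached k \<omega>")
      case True
      then show ?thesis using T_nonneg[of \<omega> k] le_N_iff[of \<omega> k a] by auto
    next
      case False
      then have "\<not> (0 \<le> a \<and> \<omega> \<in> space M \<and> k \<le> N a \<omega>)" unfolding reached_def by auto
      with False show ?thesis using nr[of \<omega>] by auto
    qed
  qed
  also have "\<dots> \<in> sets M" using G_in_M[OF known_N[OF known]] reached_events by auto
  finally show "{\<omega> \<in> space M. T k \<omega> \<le> a} \<in> sets M" .
qed

section \<open>Probability of a transition and infinitely many arrivals\<close>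

definition jump_event :: "nat \<Rightarrow> nat \<Rightarrow> nat \<Rightarrow> real set \<Rightarrow> 'a set" where
  "jump_event k i j A = {\<omega> \<in> space M. xs k \<omega> = i \<and> reached (Suc k) \<omega> \<and>
     T (Suc k) \<omega> - birth k \<omega> \<in> A \<and> xs (Suc k) \<omega> = j}"

lemma jump_event_sets:
  assumes "i \<in> states" "j \<in> states - {i}" "A \<in> sets borel"
  shows "jump_event k i j A \<in> sets M"
proof -
  have "jump_event k i j A = {\<omega> \<in> space M. emeasure (P \<omega>) (sec (jump_set k i j A) \<omega>) \<noteq> 0}"
  proof (intro set_eqI)
    fix \<omega>
    show "\<omega> \<in> jump_event k i j A \<longleftrightarrow> \<omega> \<in> {\<omega> \<in> space M. emeasure (P \<omega>) (sec (jump_set k i j A) \<omega>) \<noteq> 0}"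
      by (cases "\<omega> \<in> space M") (simp_all add: jump_event_def P_jump_set[OF _ assms(2,3)] conj_ac)
  qed
  then show ?thesis using P_sec_measurable[OF jump_set_pred[OF known assms]] by simp
qed

text \<open>The compensator of the transition: the rate accumulated over the live times whose age
  lies in \<open>A\<close>.\<close>

definition exposure :: "nat \<Rightarrow> nat \<Rightarrow> nat \<Rightarrow> real set \<Rightarrow> 'a \<Rightarrow> ennreal" where
  "exposure k i j A \<omega> = (if reached k \<omega> \<and> xs k \<omega> = i then
     \<integral>\<^sup>+u. ennreal (ext_rate lam k i j (u - birth k \<omega>)) * indicator (live k \<omega> \<inter> {u. u - birth k \<omega> \<in> A}) u \<partial>lborel else 0)"

text \<open>Integration over vertical slices. At a live time the slice is the interval for the
  current age, whose length is the rate unless its left endpoint is infinite; this concerns a null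
  set of ages, and translation by the birth time keeps it null.\<close>

lemma lborel_jump_set:
  assumes \<omega>: "\<omega> \<in> space M" and i: "i \<in> states" and j: "j \<in> states - {i}" and A: "A \<in> sets borel"
  shows "emeasure lborel (sec (jump_set k i j A) \<omega>) = exposure k i j A \<omega>"
proof (cases "reached k \<omega> \<and> xs k \<omega> = i")
  case True
  let ?D = "live k \<omega> \<inter> {u. u - birth k \<omega> \<in> A}"
  have S: "sec (jump_set k i j A) \<omega> \<in> sets borel"
    by (rule sec_borel[OF jump_set_pred[OF known i j A]])
  have "emeasure lborel (sec (jump_set k i j A) \<omega>) =
      (\<integral>\<^sup>+u. emeasure lborel (Pair u -` sec (jump_set k i j A) \<omega>) \<partial>lborel)"
    unfolding lborel_prod[symmetric]
    by (rule lborel.emeasure_pair_measure_alt) (use S in \<open>simp only: lborel_prod sets_lborel\<close>)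
  also have "\<dots> = (\<integral>\<^sup>+u. ennreal (ext_rate lam k i j (u - birth k \<omega>)) * indicator ?D u \<partial>lborel)"
  proof (rule nn_integral_cong_AE)
    have "AE u in lborel. 0 \<le> u - birth k \<omega> \<longrightarrow>
        (\<forall>(i, j)\<in>state_pairs. \<forall>n. Lambda_start ord lamt i j (u - birth k \<omega>) n < \<infinity>)"
      by (rule AE_lborel_translation[OF AE_Lambda_start_finite[OF well_defined]])
    then show "AE u in lborel. emeasure lborel (Pair u -` sec (jump_set k i j A) \<omega>) =
        ennreal (ext_rate lam k i j (u - birth k \<omega>)) * indicator ?D u"
    proof eventually_elim
      case (elim u)
      show ?case
      proof (cases "u \<in> ?D")
        case u: True
        then have "T k \<omega> < u" using live_iff[OF \<omega>, of k u] before_iff[OF \<omega>, of k u] True by auto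
        moreover have "birth k \<omega> \<le> T k \<omega>" using birth_le[OF \<omega>] True by simp
        ultimately have nn: "0 \<le> u - birth k \<omega>" by simp
        have "Pair u -` sec (jump_set k i j A) \<omega> = Lam i j (u - birth k \<omega>) k"
          using True u \<open>T k \<omega> < u\<close> unfolding sec_jump_set[OF \<omega>] by (auto simp: mem_jump_region[OF \<omega>])
        moreover have "Lambda_start ord lamt i j (u - birth k \<omega>) k < \<infinity>"
          using elim nn i j by (auto simp: state_pairs_def)
        ultimately show ?thesis
          using u nn i j ratesD(2)[OF rates i j nn] by (simp add: emeasure_Lambda ext_rate_def)
      next
        case u: False
        then have "Pair u -` sec (jump_set k i j A) \<omega> = {}" unfolding sec_jump_set[OF \<omega>] by auto
        then show ?thesis using u by simp
      qed
    qed
  qed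
  finally show ?thesis using True unfolding exposure_def by simp
next
  case False
  show ?thesis unfolding exposure_def sec_jump_set[OF \<omega>] if_not_P[OF False] by simp
qed

lemma exposure_measurable:
  assumes "i \<in> states" "j \<in> states - {i}" "A \<in> sets borel"
  shows "exposure k i j A \<in> borel_measurable M"
proof -
  have "(\<lambda>\<omega>. emeasure lborel (sec (jump_set k i j A) \<omega> \<inter> UNIV)) \<in> borel_measurable M"
    by (rule lborel_sec_measurable[OF jump_set_pred[OF known assms]]) simp
  then show ?thesis
    by (rule measurable_cong[THEN iffD1, rotated]) (simp add: lborel_jump_set[OF _ assms])
qed

lemma jump_law:
  assumes "i \<in> states" "j \<in> states - {i}" "A \<in> sets borel"
  shows "emeasure M (jump_event k i j A) = (\<integral>\<^sup>+\<omega>. exposure k i j A \<omega> \<partial>M)"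
proof -
  have "emeasure M (jump_event k i j A) = (\<integral>\<^sup>+\<omega>. indicator (jump_event k i j A) \<omega> \<partial>M)"
    using jump_event_sets[OF assms] by simp
  also have "\<dots> = (\<integral>\<^sup>+\<omega>. emeasure (P \<omega>) (sec (jump_set k i j A) \<omega>) \<partial>M)"
    by (rule nn_integral_cong) (auto simp: P_jump_set[OF _ assms(2,3)] jump_event_def indicator_def)
  also have "\<dots> = (\<integral>\<^sup>+\<omega>. emeasure lborel (sec (jump_set k i j A) \<omega>) \<partial>M)"
    by (rule Campbell[OF jump_set_pred[OF known assms]])
  also have "\<dots> = (\<integral>\<^sup>+\<omega>. exposure k i j A \<omega> \<partial>M)"
    by (rule nn_integral_cong) (rule lborel_jump_set[OF _ assms])
  finally show ?thesis .
qed

text \<open>Divergence of \<open>cum_rate\<close> survives the removal of \<open>{0..c}\<close>,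
  because the integral over that part is finite.\<close>

lemma total_rate_tail:
  assumes i: "i \<in> states" and c: "0 \<le> c"
  shows "(\<integral>\<^sup>+s\<in>{c<..}. total_rate lam n i s \<partial>lborel) = \<infinity>"
proof (rule ccontr)
  assume "(\<integral>\<^sup>+s\<in>{c<..}. total_rate lam n i s \<partial>lborel) \<noteq> \<infinity>"
  then obtain r where r: "(\<integral>\<^sup>+s\<in>{c<..}. total_rate lam n i s \<partial>lborel) = ennreal r" "0 \<le> r"
    by (cases "\<integral>\<^sup>+s\<in>{c<..}. total_rate lam n i s \<partial>lborel") auto
  have [measurable]: "total_rate lam n i \<in> borel_measurable borel" by (rule total_rate_measurable[OF rates i])
  have bound: "cum_rate lam i y n \<le> cum_rate lam i c n + r" if "c \<le> y" for y
  proof -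
    have "ennreal (cum_rate lam i y n) = (\<integral>\<^sup>+s\<in>{0..y}. total_rate lam n i s \<partial>lborel)"
      using cum_rate_eq(1)[OF rates summable majorants i] c that by simp
    also have "\<dots> \<le> (\<integral>\<^sup>+s. total_rate lam n i s * indicator {0..c} s + total_rate lam n i s * indicator {c<..} s \<partial>lborel)"
      by (rule nn_integral_mono) (auto simp: indicator_def)
    also have "\<dots> = ennreal (cum_rate lam i c n) + ennreal r"
      unfolding r(1)[symmetric] cum_rate_eq(1)[OF rates summable majorants i c]
      by (rule nn_integral_add) measurable
    also have "\<dots> = ennreal (cum_rate lam i c n + r)"
      using r cum_rate_eq(2)[OF rates summable majorants i c] by simp
    finally show ?thesis
      using r cum_rate_eq(2)[OF rates summable majorants i c, of n] by (subst (asm) ennreal_le_iff) auto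
  qed
  have "filterlim (\<lambda>y. cum_rate lam i y n) at_top at_top" using diverge i unfolding rates_diverge_def by auto
  then have "\<forall>\<^sub>F y in at_top. cum_rate lam i c n + r < cum_rate lam i y n"
    by (simp add: filterlim_at_top_dense)
  from eventually_conj[OF this eventually_ge_at_top[of c]]
  obtain y where "cum_rate lam i c n + r < cum_rate lam i y n" "c \<le> y"
    by (auto simp: eventually_at_top_linorder)
  with bound show False by fastforce
qed

text \<open>Jumps to different targets are disjoint events, so the expected exposures have a finite
  sum and the total exposure is almost surely finite. By \<open>total_rate_tail\<close> a cycle
  without end would have infinite exposure.\<close>

lemma AE_reached_Suc: "AE \<omega> in M. reached k \<omega> \<and> xs k \<omega> = i \<longrightarrow> reached (Suc k) \<omega>"
proof (cases "i \<in> states")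
  case i: True
  let ?f = "\<lambda>j \<omega>. if j \<in> states - {i} then exposure k i j UNIV \<omega> else 0"
  have fm: "?f j \<in> borel_measurable M" for j
    using exposure_measurable[OF i, of j UNIV k] by (cases "j \<in> states - {i}") auto
  have "(\<integral>\<^sup>+\<omega>. (\<Sum>j. ?f j \<omega>) \<partial>M) = (\<Sum>j. \<integral>\<^sup>+\<omega>. ?f j \<omega> \<partial>M)"
    by (rule nn_integral_suminf) (rule fm)
  also have "\<dots> = (\<Sum>j. emeasure M (if j \<in> states - {i} then jump_event k i j UNIV else {}))"
    by (rule suminf_cong) (use jump_law[OF i, of _ UNIV k] in auto)
  also have "\<dots> = emeasure M (\<Union>j. if j \<in> states - {i} then jump_event k i j UNIV else {})"
  proof (rule suminf_emeasure)
    show "range (\<lambda>j. if j \<in> states - {i} then jump_event k i j UNIV else {}) \<subseteq> sets M"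
      using jump_event_sets[OF i, of _ UNIV k] by auto
    show "disjoint_family (\<lambda>j. if j \<in> states - {i} then jump_event k i j UNIV else {})"
      unfolding disjoint_family_on_def jump_event_def by auto
  qed
  also have "\<dots> < \<infinity>" by (simp add: less_top[symmetric])
  finally have "(\<integral>\<^sup>+\<omega>. (\<Sum>j. ?f j \<omega>) \<partial>M) \<noteq> \<infinity>" by simp
  then have "AE \<omega> in M. (\<Sum>j. ?f j \<omega>) \<noteq> \<infinity>"
    using fm by (intro nn_integral_PInf_AE) auto
  then show ?thesis using AE_space
  proof eventually_elim
    case (elim \<omega>)
    show ?case
    proof (intro impI, rule ccontr)
      assume r: "reached k \<omega> \<and> xs k \<omega> = i" and n: "\<not> reached (Suc k) \<omega>"
      have live: "live k \<omega> = {T k \<omega><..}" by (rule live_eq(2)[OF elim(2) n])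
      have [measurable]: "ext_rate lam k i j \<in> borel_measurable borel" for j by (rule ext_rate_measurable[OF rates i])
      have [measurable]: "total_rate lam k i \<in> borel_measurable borel" by (rule total_rate_measurable[OF rates i])
      let ?c = "T k \<omega> - birth k \<omega>"
      have c: "0 \<le> ?c" using birth_le[OF elim(2)] r by simp
      have "?f j \<omega> = (\<integral>\<^sup>+u. ennreal (ext_rate lam k i j (u - birth k \<omega>)) * indicator {T k \<omega><..} u \<partial>lborel)" for j
      proof (cases "j \<in> states - {i}")
        case False
        then have "ext_rate lam k i j s = 0" for s by (auto simp: ext_rate_def)
        with False show ?thesis by auto
      qed (use r in \<open>simp add: exposure_def live\<close>)
      then have "(\<Sum>j. ?f j \<omega>) = (\<Sum>j. \<integral>\<^sup>+u. ennreal (ext_rate lam k i j (u - birth k \<omega>)) * indicator {T k \<omega><..} u \<partial>lborel)"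
        by simp
      also have "\<dots> = (\<integral>\<^sup>+u. total_rate lam k i (u - birth k \<omega>) * indicator {T k \<omega><..} u \<partial>lborel)"
        unfolding total_rate_def by (subst nn_integral_suminf[symmetric]) (auto simp: ennreal_suminf_multc)
      also have "\<dots> = (\<integral>\<^sup>+s. total_rate lam k i s * indicator {?c<..} s \<partial>lborel)"
        by (subst nn_integral_real_affine[of _ 1 "birth k \<omega>"])
          (auto intro!: nn_integral_cong simp: indicator_def)
      also have "\<dots> = \<infinity>" by (rule total_rate_tail[OF i c])
      finally show False using elim(1) by simp
    qed
  qed
next
  case False
  show ?thesis using False xs_states by (intro AE_I2) auto
qed

theorem AE_reached: "AE \<omega> in M. \<forall>k. reached k \<omega>"
proof -
  have "AE \<omega> in M. \<forall>k i. reached k \<omega> \<and> xs k \<omega> = i \<longrightarrow> reached (Suc k) \<omega>"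
    unfolding AE_all_countable using AE_reached_Suc by blast
  then show ?thesis
  proof eventually_elim
    case (elim \<omega>)
    show ?case
    proof
      fix k show "reached k \<omega>"
        by (induction k) (use elim reached_0 in auto)
    qed
  qed
qed

definition hold :: "nat \<Rightarrow> 'a \<Rightarrow> real" where "hold k \<omega> = T (Suc k) \<omega> - T k \<omega>"

lemma hold_measurable: "hold k \<in> borel_measurable M"
  unfolding hold_def[abs_def] using T_measurable by measurable

text \<open>For \<open>n \<ge> 1\<close> the age restarts from 0 at \<open>T n\<close>, so the age
  at the jump is the holding time. Shifting time by \<open>T n\<close> and exchanging integrals
  turns the expected exposure into an integral over ages.\<close>

theorem holding_law:
  assumes i: "i \<in> states" and j: "j \<in> states - {i}" and A: "A \<in> sets borel" and n: "1 \<le> n"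
  shows "emeasure M {\<omega> \<in> space M. xs n \<omega> = i \<and> reached (Suc n) \<omega> \<and> hold n \<omega> \<in> A \<and> xs (Suc n) \<omega> = j} =
    (\<integral>\<^sup>+s. ennreal (ext_rate lam n i j s) * indicator A s *
      emeasure M {\<omega> \<in> space M. reached n \<omega> \<and> xs n \<omega> = i \<and> s \<le> hold n \<omega>} \<partial>lborel)"
proof -
  have birth: "birth n \<omega> = T n \<omega>" if "\<omega> \<in> space M" "reached n \<omega>" for \<omega>
    using birth_Suc[of \<omega> "n - 1"] that n by simp
  have [measurable]: "ext_rate lam n i j \<in> borel_measurable borel" by (rule ext_rate_measurable[OF rates i])
  note [measurable] = hold_measurable A
  let ?D = "{\<omega> \<in> space M. reached n \<omega> \<and> xs n \<omega> = i}"
  let ?E = "{\<omega> \<in> space M. xs n \<omega> = i \<and> reached (Suc n) \<omega> \<and> hold n \<omega> \<in> A \<and> xs (Suc n) \<omega> = j}"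
  let ?B = "\<lambda>s. {\<omega> \<in> space M. reached n \<omega> \<and> xs n \<omega> = i \<and> s \<le> hold n \<omega>}"
  let ?h = "\<lambda>\<omega> s. ennreal (ext_rate lam n i j s) * indicator A s * indicator ?D \<omega> * indicator {0<..hold n \<omega>} s"
  have D[measurable]: "?D \<in> sets M" by (rule reached_state_events)
  have "?E = jump_event n i j A"
    unfolding jump_event_def hold_def using birth reached_mono[of "Suc n" _ n] by auto
  then have "emeasure M ?E =
      (\<integral>\<^sup>+\<omega>. exposure n i j A \<omega> \<partial>M)"
    using jump_law[OF i j A] by simp
  also have "\<dots> = (\<integral>\<^sup>+\<omega>. \<integral>\<^sup>+s. ?h \<omega> s \<partial>lborel \<partial>M)"
  proof (rule nn_integral_cong_AE)
    show "AE \<omega> in M. exposure n i j A \<omega> =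
      (\<integral>\<^sup>+s. ?h \<omega> s \<partial>lborel)"
      using AE_reached AE_space
    proof eventually_elim
      case (elim \<omega>)
      show ?case
      proof (cases "xs n \<omega> = i")
        case True
        have live: "live n \<omega> = {T n \<omega><..T (Suc n) \<omega>}" using elim by (intro live_eq) auto
        have b: "birth n \<omega> = T n \<omega>" using birth elim by auto
        have "exposure n i j A \<omega> = (\<integral>\<^sup>+u. ennreal (ext_rate lam n i j (u - T n \<omega>)) *
            indicator ({T n \<omega><..T (Suc n) \<omega>} \<inter> {u. u - T n \<omega> \<in> A}) u \<partial>lborel)"
          using elim True unfolding exposure_def live b by simp
        also have "\<dots> = (\<integral>\<^sup>+u. ennreal (ext_rate lam n i j (u - T n \<omega>)) *
            indicator {T n \<omega><..T (Suc n) \<omega>} u * indicator A (u - T n \<omega>) \<partial>lborel)"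
          by (rule nn_integral_cong) (auto simp: indicator_def)
        also have "\<dots> = (\<integral>\<^sup>+s. ?h \<omega> s \<partial>lborel)"
          using elim True
          by (subst nn_integral_real_affine[of _ 1 "T n \<omega>"])
            (auto intro!: nn_integral_cong simp: indicator_def hold_def)
        finally show ?thesis .
      next
        case False
        then show ?thesis unfolding exposure_def by simp
      qed
    qed
  qed
  also have "\<dots> = (\<integral>\<^sup>+s. \<integral>\<^sup>+\<omega>. ?h \<omega> s \<partial>M \<partial>lborel)"
  proof -
    interpret pair_sigma_finite M lborel ..
    have "(\<lambda>(\<omega>, s). ?h \<omega> s)
        \<in> borel_measurable (M \<Otimes>\<^sub>M lborel)"
      unfolding greaterThanAtMost_def greaterThan_def atMost_def by measurable
    then show ?thesis by (rule Fubini'[symmetric])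
  qed
  also have "\<dots> = (\<integral>\<^sup>+s. ennreal (ext_rate lam n i j s) * indicator A s * emeasure M (?B s) \<partial>lborel)"
  proof (rule nn_integral_cong_AE)
    \<comment> \<open>The indicator of \<open>{0<..hold n \<omega>}\<close> and the event
      \<open>s \<le> hold n \<omega>\<close> can disagree only for \<open>s \<le> 0\<close>: at
      negative ages the rate vanishes, and the single age 0 is null.\<close>
    have "AE s in lborel. s \<noteq> (0 :: real)" by (rule AE_lborel_singleton)
    then show "AE s in lborel. (\<integral>\<^sup>+\<omega>. ?h \<omega> s \<partial>M) =
      ennreal (ext_rate lam n i j s) * indicator A s * emeasure M (?B s)"
    proof eventually_elim
      case (elim s)
      show ?case
      proof (cases "0 < s")
        case True
        have E: "?B s \<in> sets M"
        proof -
          have "?B s = ?D \<inter> {\<omega> \<in> space M. s \<le> hold n \<omega>}" by auto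
          then show ?thesis by simp
        qed
        have "(\<integral>\<^sup>+\<omega>. ?h \<omega> s \<partial>M) =
          (\<integral>\<^sup>+\<omega>. (ennreal (ext_rate lam n i j s) * indicator A s) *
            indicator (?B s) \<omega> \<partial>M)"
          using True by (intro nn_integral_cong) (auto simp: indicator_def)
        then show ?thesis by (simp only: nn_integral_cmult_indicator[OF E])
      next
        case False
        then have "s < 0" using elim by simp
        then show ?thesis by (simp add: ext_rate_def)
      qed
    qed
  qed
  finally show ?thesis .
qed

end

subsection \<open>From the law of a transition to conditional probabilities\<close>

text \<open>On a grid along which \<open>\<gamma>\<close> grows by equal steps \<open>\<gamma> t / m\<close>, the hypothesis bounds \<open>p t\<close> between
  \<open>p 0 (1 - \<gamma> t / m)^m\<close> and \<open>p 0 (1 + \<gamma> t / m)^(-m)\<close>; both bounds tend to \<open>p 0 exp (- \<gamma> t)\<close>.\<close>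

lemma exponential_decay:
  fixes p \<gamma> :: "real \<Rightarrow> real"
  assumes t: "0 \<le> t" and cont: "continuous_on {0..t} \<gamma>" and \<gamma>0: "\<gamma> 0 = 0"
    and mono: "\<And>a b. 0 \<le> a \<Longrightarrow> a \<le> b \<Longrightarrow> \<gamma> a \<le> \<gamma> b"
    and lower: "\<And>a b. 0 \<le> a \<Longrightarrow> a \<le> b \<Longrightarrow> p b * (\<gamma> b - \<gamma> a) \<le> p a - p b"
    and upper: "\<And>a b. 0 \<le> a \<Longrightarrow> a \<le> b \<Longrightarrow> p a - p b \<le> p a * (\<gamma> b - \<gamma> a)"
  shows "p t = p 0 * exp (- \<gamma> t)"
proof -
  \<comment> \<open>Stated for \<open>\<gamma> a \<le> \<gamma> b\<close> rather than
    \<open>a \<le> b\<close>, since the grid points are chosen by their \<open>\<gamma>\<close>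
    values; if \<open>b < a\<close>, monotonicity forces equality.\<close>
  have step: "p b * (1 + (\<gamma> b - \<gamma> a)) \<le> p a" "p a * (1 - (\<gamma> b - \<gamma> a)) \<le> p b"
    if "0 \<le> a" "0 \<le> b" "\<gamma> a \<le> \<gamma> b" for a b
  proof -
    have "p b * (1 + (\<gamma> b - \<gamma> a)) \<le> p a \<and> p a * (1 - (\<gamma> b - \<gamma> a)) \<le> p b"
    proof (cases "a \<le> b")
      case True
      then show ?thesis using lower[OF that(1) True] upper[OF that(1) True] by (simp add: algebra_simps)
    next
      case False
      then have ba: "b \<le> a" by simp
      then have "\<gamma> a = \<gamma> b" using mono[OF that(2) ba] that by simp
      then show ?thesis using lower[OF that(2) ba] upper[OF that(2) ba] by simp
    qed
    then show "p b * (1 + (\<gamma> b - \<gamma> a)) \<le> p a" "p a * (1 - (\<gamma> b - \<gamma> a)) \<le> p b" by auto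
  qed
  have \<gamma>t: "0 \<le> \<gamma> t" using mono[of 0 t] t \<gamma>0 by simp
  have bounds: "p 0 * (1 - \<gamma> t / real m) ^ m \<le> p t \<and> p t * (1 + \<gamma> t / real m) ^ m \<le> p 0"
    if m: "0 < m" "\<gamma> t \<le> real m" for m
  proof -
    define h where "h = \<gamma> t / real m"
    have h: "0 \<le> h" "h \<le> 1" using \<gamma>t m unfolding h_def by (auto simp: divide_le_eq)
    have "\<exists>s. 0 \<le> s \<and> s \<le> t \<and> \<gamma> s = real l * h" if "l \<le> m" for l
    proof (rule IVT'[of \<gamma> 0 _ t, OF _ _ t cont])
      show "\<gamma> 0 \<le> real l * h" using h \<gamma>0 by simp
      have "real l * h \<le> real m * h" using that h by (intro mult_right_mono) auto
      then show "real l * h \<le> \<gamma> t" using m unfolding h_def by simp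
    qed
    then obtain s where s: "\<And>l. l \<le> m \<Longrightarrow> 0 \<le> s l \<and> s l \<le> t \<and> \<gamma> (s l) = real l * h" by metis
    have "p (s 0) * (1 - h) ^ l \<le> p (s l) \<and> p (s l) * (1 + h) ^ l \<le> p (s 0)" if "l \<le> m" for l
      using that
    proof (induction l)
      case (Suc l)
      have d: "\<gamma> (s (Suc l)) - \<gamma> (s l) = h" using s[of l] s[of "Suc l"] Suc.prems by (simp add: algebra_simps)
      have st: "p (s (Suc l)) * (1 + h) \<le> p (s l)" "p (s l) * (1 - h) \<le> p (s (Suc l))"
        using step[of "s l" "s (Suc l)"] s[of l] s[of "Suc l"] Suc.prems d h by auto
      have "p (s 0) * (1 - h) ^ Suc l = (p (s 0) * (1 - h) ^ l) * (1 - h)" by simp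
      also have "\<dots> \<le> p (s l) * (1 - h)" using Suc h by (intro mult_right_mono) auto
      also note st(2)
      finally have 1: "p (s 0) * (1 - h) ^ Suc l \<le> p (s (Suc l))" .
      have "p (s (Suc l)) * (1 + h) ^ Suc l = (p (s (Suc l)) * (1 + h)) * (1 + h) ^ l" by simp
      also have "\<dots> \<le> p (s l) * (1 + h) ^ l" using st(1) h by (intro mult_right_mono) auto
      also have "\<dots> \<le> p (s 0)" using Suc by auto
      finally show ?case using 1 by simp
    qed auto
    \<comment> \<open>The intermediate value theorem gives only \<open>\<gamma> (s 0) = 0\<close>,
      not \<open>s 0 = 0\<close>; the step inequalities in both directions show that
      \<open>p\<close> agrees nevertheless.\<close>
    moreover have "p (s 0) = p 0" using step[of 0 "s 0"] step[of "s 0" 0] s[of 0] \<gamma>0 by simp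
    moreover have "p (s m) = p t"
    proof -
      have "\<gamma> (s m) = \<gamma> t" using s[of m] m unfolding h_def by simp
      then show ?thesis using step[of t "s m"] step[of "s m" t] s[of m] t by simp
    qed
    ultimately show ?thesis unfolding h_def[symmetric] by fastforce
  qed
  have ev: "\<forall>\<^sub>F m in sequentially. 0 < m \<and> \<gamma> t \<le> real m"
  proof -
    obtain K :: nat where "\<gamma> t \<le> real K" using real_arch_simple by blast
    then show ?thesis
      by (intro eventually_mono[OF eventually_ge_at_top[of "max 1 K"]]) auto
  qed
  have "(\<lambda>m. p 0 * (1 + (- \<gamma> t) / real m) ^ m) \<longlonglongrightarrow> p 0 * exp (- \<gamma> t)"
    by (intro tendsto_mult tendsto_const tendsto_exp_limit_sequentially)
  moreover have "\<forall>\<^sub>F m in sequentially. p 0 * (1 + (- \<gamma> t) / real m) ^ m \<le> p t"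
    using ev by eventually_elim (use bounds in auto)
  ultimately have 1: "p 0 * exp (- \<gamma> t) \<le> p t"
    by (intro tendsto_upperbound[of _ _ sequentially]) auto
  have "(\<lambda>m. p t * (1 + \<gamma> t / real m) ^ m) \<longlonglongrightarrow> p t * exp (\<gamma> t)"
    by (intro tendsto_mult tendsto_const tendsto_exp_limit_sequentially)
  moreover have "\<forall>\<^sub>F m in sequentially. p t * (1 + \<gamma> t / real m) ^ m \<le> p 0"
    using ev by eventually_elim (use bounds in auto)
  ultimately have "p t * exp (\<gamma> t) \<le> p 0"
    by (intro tendsto_upperbound[of _ _ sequentially]) auto
  then have "p t * exp (\<gamma> t) * exp (- \<gamma> t) \<le> p 0 * exp (- \<gamma> t)"
    by (intro mult_right_mono) auto
  then have "p t \<le> p 0 * exp (- \<gamma> t)" by (simp add: mult.assoc flip: exp_add)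
  with 1 show ?thesis by simp
qed

text \<open>One transition in isolation: current state \<open>x\<close>, holding time
  \<open>H\<close>, next state \<open>x'\<close>. All that is kept of the dynamics is the identity
  \<open>law\<close>.\<close>

locale renewal_step = prob_space M for M :: "'a measure" +
  fixes lam lamt :: "nat \<Rightarrow> nat \<Rightarrow> real \<Rightarrow> nat \<Rightarrow> real" and n :: nat
    and x :: "'a \<Rightarrow> nat" and H :: "'a \<Rightarrow> real" and x' :: "'a \<Rightarrow> nat"
  assumes rates: "rates lam" and majorants: "rate_majorants lam lamt" and summable: "rates_summable lam"
    and x_measurable [measurable]: "x \<in> measurable M (count_space UNIV)"
    and H_measurable [measurable]: "H \<in> borel_measurable M"
    and x'_measurable [measurable]: "x' \<in> measurable M (count_space UNIV)"
    and AE_step: "AE \<omega> in M. x \<omega> \<in> states \<and> x' \<omega> \<in> states - {x \<omega>} \<and> 0 < H \<omega>"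
    and law: "i \<in> states \<Longrightarrow> j \<in> states - {i} \<Longrightarrow> A \<in> sets borel \<Longrightarrow>
      emeasure M {\<omega> \<in> space M. x \<omega> = i \<and> H \<omega> \<in> A \<and> x' \<omega> = j} =
      (\<integral>\<^sup>+s. ennreal (ext_rate lam n i j s) * indicator A s * emeasure M {\<omega> \<in> space M. x \<omega> = i \<and> s \<le> H \<omega>} \<partial>lborel)"
begin

section \<open>Distribution of the holding time\<close>

text \<open>The closed event \<open>s \<le> H\<close> is the one in \<open>law\<close>. The
  distribution function comes from \<open>t < H\<close>, and the two versions are compared only
  through inequalities.\<close>

definition survival :: "nat \<Rightarrow> real \<Rightarrow> ennreal" where
  "survival i s = emeasure M {\<omega> \<in> space M. x \<omega> = i \<and> s \<le> H \<omega>}"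

lemma survival_measurable [measurable]: "survival i \<in> borel_measurable borel"
proof -
  have "(\<lambda>s. \<integral>\<^sup>+\<omega>. indicator {\<omega>. x \<omega> = i} \<omega> * indicator {..H \<omega>} s \<partial>M) \<in> borel_measurable borel"
    unfolding atMost_def by measurable
  also have "(\<lambda>s. \<integral>\<^sup>+\<omega>. indicator {\<omega>. x \<omega> = i} \<omega> * indicator {..H \<omega>} s \<partial>M) = survival i"
  proof
    fix s
    have "survival i s = (\<integral>\<^sup>+\<omega>. indicator {\<omega> \<in> space M. x \<omega> = i \<and> s \<le> H \<omega>} \<omega> \<partial>M)"
      unfolding survival_def by simp
    also have "\<dots> = (\<integral>\<^sup>+\<omega>. indicator {\<omega>. x \<omega> = i} \<omega> * indicator {..H \<omega>} s \<partial>M)"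
      by (rule nn_integral_cong) (auto simp: indicator_def)
    finally show "(\<integral>\<^sup>+\<omega>. indicator {\<omega>. x \<omega> = i} \<omega> * indicator {..H \<omega>} s \<partial>M) = survival i s" ..
  qed
  finally show ?thesis .
qed

lemma holding_density:
  assumes i: "i \<in> states" and A: "A \<in> sets borel"
  shows "emeasure M {\<omega> \<in> space M. x \<omega> = i \<and> H \<omega> \<in> A} =
    (\<integral>\<^sup>+s. total_rate lam n i s * survival i s * indicator A s \<partial>lborel)"
proof -
  note A [measurable]
  have [measurable]: "ext_rate lam n i j \<in> borel_measurable borel" for j by (rule ext_rate_measurable[OF rates i])
  let ?E = "\<lambda>j. {\<omega> \<in> space M. x \<omega> = i \<and> H \<omega> \<in> A \<and> x' \<omega> = j}"
  have E: "emeasure M (?E j) = (\<integral>\<^sup>+s. ennreal (ext_rate lam n i j s) * (survival i s * indicator A s) \<partial>lborel)" for j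
  proof (cases "j \<in> states - {i}")
    case True
    show ?thesis using law[OF i True A] by (simp add: survival_def mult_ac)
  next
    case False
    have "AE \<omega> in M. \<not> (x \<omega> = i \<and> H \<omega> \<in> A \<and> x' \<omega> = j)"
      using AE_step by eventually_elim (use False in auto)
    then have "emeasure M (?E j) = 0" by (rule emeasure_eq_0_AE)
    moreover have "ext_rate lam n i j s = 0" for s using False unfolding ext_rate_def by auto
    ultimately show ?thesis by simp
  qed
  have "{\<omega> \<in> space M. x \<omega> = i \<and> H \<omega> \<in> A} = (\<Union>j. ?E j)" by auto
  then have "emeasure M {\<omega> \<in> space M. x \<omega> = i \<and> H \<omega> \<in> A} = (\<Sum>j. emeasure M (?E j))"
    by (simp only:) (rule suminf_emeasure[symmetric], auto simp: disjoint_family_on_def)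
  also have "\<dots> = (\<integral>\<^sup>+s. (\<Sum>j. ennreal (ext_rate lam n i j s) * (survival i s * indicator A s)) \<partial>lborel)"
    unfolding E by (rule nn_integral_suminf[symmetric]) measurable
  also have "\<dots> = (\<integral>\<^sup>+s. total_rate lam n i s * survival i s * indicator A s \<partial>lborel)"
    unfolding total_rate_def by (simp add: mult.assoc)
  finally show ?thesis .
qed

text \<open>For \<open>s\<close> in \<open>{a<..b}\<close> the survival probability lies between
  \<open>p b\<close> and \<open>p a\<close>, so \<open>p a - p b\<close> is pinned between these
  multiples of \<open>\<gamma> b - \<gamma> a\<close>. This is the two-sided hypothesis of
  \<open>exponential_decay\<close>; differentiability is never involved.\<close>

lemma survival_function:
  assumes i: "i \<in> states" and t: "0 \<le> t"
  shows "prob {\<omega> \<in> space M. x \<omega> = i \<and> t < H \<omega>} = prob {\<omega> \<in> space M. x \<omega> = i} * exp (- cum_rate lam i t n)"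
proof -
  define p where "p t = prob {\<omega> \<in> space M. x \<omega> = i \<and> t < H \<omega>}" for t
  define \<gamma> where "\<gamma> t = cum_rate lam i t n" for t
  have [measurable]: "total_rate lam n i \<in> borel_measurable borel" by (rule total_rate_measurable[OF rates i])
  obtain C where C: "0 \<le> C" "AE y in lborel. \<forall>n. total_rate lam n i y \<le> ennreal C"
    using AE_total_rate_bounded[OF rates summable majorants i] by auto
  have \<gamma>: "ennreal (\<gamma> t) = (\<integral>\<^sup>+s\<in>{0..t}. total_rate lam n i s \<partial>lborel)" "0 \<le> \<gamma> t" if "0 \<le> t" for t
    unfolding \<gamma>_def using cum_rate_eq[OF rates summable majorants i that] by auto
  have \<gamma>_add: "ennreal (\<gamma> b) = ennreal (\<gamma> a) + (\<integral>\<^sup>+s\<in>{a<..b}. total_rate lam n i s \<partial>lborel)"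
    if "0 \<le> a" "a \<le> b" for a b
  proof -
    have "ennreal (\<gamma> b) = (\<integral>\<^sup>+s. total_rate lam n i s * indicator {0..a} s + total_rate lam n i s * indicator {a<..b} s \<partial>lborel)"
      using that \<gamma>(1)[of b] by (auto intro!: nn_integral_cong simp: indicator_def)
    also have "\<dots> = ennreal (\<gamma> a) + (\<integral>\<^sup>+s\<in>{a<..b}. total_rate lam n i s \<partial>lborel)"
      unfolding \<gamma>(1)[OF that(1)] by (rule nn_integral_add) measurable
    finally show ?thesis .
  qed
  have mono: "\<gamma> a \<le> \<gamma> b" if "0 \<le> a" "a \<le> b" for a b
  proof -
    have "ennreal (\<gamma> a) \<le> ennreal (\<gamma> b)" unfolding \<gamma>_add[OF that] by simp
    then show ?thesis using \<gamma>(2)[of b] that by (simp add: ennreal_le_iff)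
  qed
  have \<gamma>_diff: "(\<integral>\<^sup>+s\<in>{a<..b}. total_rate lam n i s \<partial>lborel) = ennreal (\<gamma> b - \<gamma> a)" if "0 \<le> a" "a \<le> b" for a b
  proof -
    have "ennreal (\<gamma> a) + ennreal (\<gamma> b - \<gamma> a) = ennreal (\<gamma> b)"
      using mono[OF that] \<gamma>(2)[of a] that by (subst ennreal_plus[symmetric]) auto
    then have "ennreal (\<gamma> a) + (\<integral>\<^sup>+s\<in>{a<..b}. total_rate lam n i s \<partial>lborel) = ennreal (\<gamma> a) + ennreal (\<gamma> b - \<gamma> a)"
      unfolding \<gamma>_add[OF that] ..
    then show ?thesis by (simp add: ennreal_add_left_cancel)
  qed
  \<comment> \<open>The essential bound on the rate makes \<open>\<gamma>\<close> Lipschitz, which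
    supplies the continuity for the intermediate value argument.\<close>
  have Lip: "\<gamma> b - \<gamma> a \<le> C * (b - a)" if "0 \<le> a" "a \<le> b" for a b
  proof -
    have "ennreal (\<gamma> b - \<gamma> a) \<le> (\<integral>\<^sup>+s. ennreal C * indicator {a<..b} s \<partial>lborel)"
      unfolding \<gamma>_diff[OF that, symmetric]
    proof (rule nn_integral_mono_AE)
      show "AE s in lborel. total_rate lam n i s * indicator {a<..b} s \<le> ennreal C * indicator {a<..b} s"
        using C(2) by eventually_elim (auto simp: indicator_def)
    qed
    also have "\<dots> = ennreal (C * (b - a))"
      using that C(1) by (simp add: nn_integral_cmult_indicator ennreal_mult)
    finally show ?thesis using C(1) that by (simp add: ennreal_le_iff)
  qed
  have cont: "continuous_on {0..t} \<gamma>"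
  proof (rule lipschitz_on_continuous_on)
    show "C-lipschitz_on {0..t} \<gamma>"
    proof (rule lipschitz_onI)
      fix a b assume "a \<in> {0..t}" "b \<in> {0..t}"
      then show "dist (\<gamma> a) (\<gamma> b) \<le> C * dist a b"
        using Lip[of a b] Lip[of b a] mono[of a b] mono[of b a]
        by (cases "a \<le> b") (auto simp: dist_real_def)
    qed (rule C)
  qed
  have incr: "ennreal (p a - p b) = (\<integral>\<^sup>+s. total_rate lam n i s * survival i s * indicator {a<..b} s \<partial>lborel)"
    if "0 \<le> a" "a \<le> b" for a b
  proof -
    have "p a = prob ({\<omega> \<in> space M. x \<omega> = i \<and> H \<omega> \<in> {a<..b}} \<union> {\<omega> \<in> space M. x \<omega> = i \<and> b < H \<omega>})"
      unfolding p_def using that by (intro arg_cong[where f=prob]) auto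
    also have "\<dots> = prob {\<omega> \<in> space M. x \<omega> = i \<and> H \<omega> \<in> {a<..b}} + p b"
      unfolding p_def by (rule finite_measure_Union) auto
    finally have "p a - p b = prob {\<omega> \<in> space M. x \<omega> = i \<and> H \<omega> \<in> {a<..b}}" by simp
    then show ?thesis using holding_density[OF i, of "{a<..b}"] by (simp add: emeasure_eq_measure)
  qed
  have p_mono: "p b \<le> p a" if "a \<le> b" for a b
    unfolding p_def using that by (intro finite_measure_mono) auto
  have lower: "p b * (\<gamma> b - \<gamma> a) \<le> p a - p b" if ab: "0 \<le> a" "a \<le> b" for a b
  proof -
    have "ennreal (p b * (\<gamma> b - \<gamma> a)) = (\<integral>\<^sup>+s. ennreal (p b) * (total_rate lam n i s * indicator {a<..b} s) \<partial>lborel)"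
      using mono[OF ab] by (subst nn_integral_cmult) (auto simp: \<gamma>_diff[OF ab] ennreal_mult p_def)
    also have "\<dots> \<le> (\<integral>\<^sup>+s. total_rate lam n i s * survival i s * indicator {a<..b} s \<partial>lborel)"
    proof (rule nn_integral_mono)
      fix s
      have "ennreal (p b) \<le> survival i s" if "s \<le> b"
        unfolding p_def survival_def emeasure_eq_measure[symmetric] by (rule emeasure_mono) (use that in auto)
      then show "ennreal (p b) * (total_rate lam n i s * indicator {a<..b} s) \<le> total_rate lam n i s * survival i s * indicator {a<..b} s"
        by (auto simp: indicator_def mult.commute[of "ennreal (p b)"] intro!: mult_left_mono)
    qed
    finally show ?thesis unfolding incr[OF ab, symmetric] using p_mono[OF ab(2)] by (simp add: ennreal_le_iff)
  qed
  have upper: "p a - p b \<le> p a * (\<gamma> b - \<gamma> a)" if ab: "0 \<le> a" "a \<le> b" for a b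
  proof -
    have "ennreal (p a - p b) \<le> (\<integral>\<^sup>+s. ennreal (p a) * (total_rate lam n i s * indicator {a<..b} s) \<partial>lborel)"
      unfolding incr[OF ab]
    proof (rule nn_integral_mono)
      fix s
      have "survival i s \<le> ennreal (p a)" if "a < s"
        unfolding p_def survival_def emeasure_eq_measure[symmetric] by (rule emeasure_mono) (use that in auto)
      then show "total_rate lam n i s * survival i s * indicator {a<..b} s \<le> ennreal (p a) * (total_rate lam n i s * indicator {a<..b} s)"
        by (auto simp: indicator_def mult.commute[of "ennreal (p a)"] intro!: mult_left_mono)
    qed
    also have "\<dots> = ennreal (p a * (\<gamma> b - \<gamma> a))"
      using mono[OF ab] by (subst nn_integral_cmult) (auto simp: \<gamma>_diff[OF ab] ennreal_mult p_def)
    finally show ?thesis using mono[OF ab] by (simp add: ennreal_le_iff p_def)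
  qed
  have \<gamma>0: "\<gamma> 0 = 0"
  proof -
    have "{0..0 :: real} \<in> null_sets lborel" by auto
    from nn_integral_null_set[OF this] have "ennreal (\<gamma> 0) = 0" unfolding \<gamma>(1)[OF order_refl] .
    then show ?thesis using \<gamma>(2)[of 0] by simp
  qed
  have "p t = p 0 * exp (- \<gamma> t)"
    by (rule exponential_decay[OF t cont \<gamma>0 mono lower upper])
  moreover have "p 0 = prob {\<omega> \<in> space M. x \<omega> = i}"
    unfolding p_def
  proof (rule finite_measure_eq_AE)
    show "AE \<omega> in M. \<omega> \<in> {\<omega> \<in> space M. x \<omega> = i \<and> 0 < H \<omega>} \<longleftrightarrow> \<omega> \<in> {\<omega> \<in> space M. x \<omega> = i}"
      using AE_step by eventually_elim auto
  qed measurable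
  ultimately show ?thesis unfolding p_def \<gamma>_def by simp
qed

theorem holding_cdf:
  assumes i: "i \<in> states" and t: "0 \<le> t" and pos: "0 < prob {\<omega> \<in> space M. x \<omega> = i}"
  shows "\<P>(\<omega> in M. H \<omega> \<le> t \<bar> x \<omega> = i) = holding_cdf lam t i n"
proof -
  let ?q = "prob {\<omega> \<in> space M. x \<omega> = i}"
  have "?q = prob ({\<omega> \<in> space M. H \<omega> \<le> t \<and> x \<omega> = i} \<union> {\<omega> \<in> space M. x \<omega> = i \<and> t < H \<omega>})"
    by (intro arg_cong[where f=prob]) auto
  also have "\<dots> = prob {\<omega> \<in> space M. H \<omega> \<le> t \<and> x \<omega> = i} + prob {\<omega> \<in> space M. x \<omega> = i \<and> t < H \<omega>}"
    by (rule finite_measure_Union) auto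
  finally have "prob {\<omega> \<in> space M. H \<omega> \<le> t \<and> x \<omega> = i} = ?q * (1 - exp (- cum_rate lam i t n))"
    unfolding survival_function[OF i t] by (simp add: algebra_simps)
  then show ?thesis using pos by (simp add: cond_prob_def holding_cdf_def)
qed

text \<open>The density formula says that two measures agree on sets; integrating \<open>f\<close>
  against both extends it to functions.\<close>

lemma nn_integral_holding:
  assumes i: "i \<in> states" and f [measurable]: "f \<in> borel_measurable borel"
  shows "(\<integral>\<^sup>+\<omega>. indicator {\<omega>. x \<omega> = i} \<omega> * f (H \<omega>) \<partial>M) = (\<integral>\<^sup>+s. total_rate lam n i s * survival i s * f s \<partial>lborel)"
proof -
  have [measurable]: "total_rate lam n i \<in> borel_measurable borel" by (rule total_rate_measurable[OF rates i])
  let ?\<nu> = "distr (density M (indicator {\<omega>. x \<omega> = i})) borel H"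
  have "?\<nu> = density lborel (\<lambda>s. total_rate lam n i s * survival i s)"
  proof (rule measure_eqI)
    fix A :: "real set" assume "A \<in> sets ?\<nu>"
    then have A [measurable]: "A \<in> sets borel" by simp
    have "emeasure ?\<nu> A = (\<integral>\<^sup>+\<omega>. indicator {\<omega>. x \<omega> = i} \<omega> * indicator (H -` A \<inter> space M) \<omega> \<partial>M)"
      by (subst emeasure_distr, simp, simp, subst emeasure_density) auto
    also have "\<dots> = (\<integral>\<^sup>+\<omega>. indicator {\<omega> \<in> space M. x \<omega> = i \<and> H \<omega> \<in> A} \<omega> \<partial>M)"
      by (rule nn_integral_cong) (auto simp: indicator_def)
    also have "\<dots> = emeasure M {\<omega> \<in> space M. x \<omega> = i \<and> H \<omega> \<in> A}" by simp
    also have "\<dots> = emeasure (density lborel (\<lambda>s. total_rate lam n i s * survival i s)) A"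
      unfolding holding_density[OF i A] by (subst emeasure_density) auto
    finally show "emeasure ?\<nu> A = emeasure (density lborel (\<lambda>s. total_rate lam n i s * survival i s)) A" .
  qed simp
  then have "(\<integral>\<^sup>+s. f s \<partial>?\<nu>) = (\<integral>\<^sup>+s. f s \<partial>density lborel (\<lambda>s. total_rate lam n i s * survival i s))" by simp
  then show ?thesis
    by (simp add: nn_integral_distr nn_integral_density)
qed

section \<open>Conditional distribution of the next state\<close>

text \<open>A version of \<open>trans_prob\<close> that is measurable on all pairs. Division by 0
  makes it 0 where the total rate is 0, and also where it is infinite, since \<open>enn2real\<close>
  then returns 0.\<close>

definition kernel :: "nat \<Rightarrow> nat \<Rightarrow> real \<Rightarrow> real" where
  "kernel j i s = (if i \<in> states then ext_rate lam n i j s / enn2real (total_rate lam n i s) else 0)"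

lemma kernel_measurable [measurable]: "(\<lambda>(i, s). kernel j i s) \<in> borel_measurable (count_space UNIV \<Otimes>\<^sub>M borel)"
proof (rule measurable_pair_measure_countable1)
  fix i :: nat
  show "(\<lambda>y. case (i, y) of (i, s) \<Rightarrow> kernel j i s) \<in> borel_measurable borel"
  proof (cases "i \<in> states")
    case True
    have [measurable]: "ext_rate lam n i j \<in> borel_measurable borel" by (rule ext_rate_measurable[OF rates True])
    have [measurable]: "total_rate lam n i \<in> borel_measurable borel" by (rule total_rate_measurable[OF rates True])
    show ?thesis unfolding kernel_def using True by simp
  next
    case False
    then show ?thesis unfolding kernel_def by simp
  qed
qed simp

text \<open>Where the exit rate vanishes both sides are 0, one through the indicator in
  \<open>trans_prob\<close>, the other through the convention for division by 0.\<close>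

lemma kernel_trans_prob:
  assumes "i \<in> states" "j \<in> states - {i}" "0 \<le> s"
  shows "trans_prob lam i j s n = kernel j i s"
  using assms ratesD(2)[OF rates assms]
  unfolding trans_prob_def kernel_def exit_rate_eq[OF rates assms(1,3)] ext_rate_def
  by (cases "enn2real (total_rate lam n i s) = 0") (auto simp: indicator_def less_le)

lemma ext_rate_le_total: "ennreal (ext_rate lam n i j s) \<le> total_rate lam n i s"
proof -
  have "ennreal (ext_rate lam n i j s) = (\<Sum>k\<in>{j}. ennreal (ext_rate lam n i k s))" by simp
  also have "\<dots> \<le> total_rate lam n i s" unfolding total_rate_def by (rule sum_le_suminf) auto
  finally show ?thesis .
qed

lemma kernel_nonneg: "0 \<le> kernel j i s"
  unfolding kernel_def using ext_rate_nonneg[OF rates] by simp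

lemma kernel_le_1: "kernel j i s \<le> 1"
proof (cases "i \<in> states \<and> total_rate lam n i s < \<infinity>")
  case True
  then have "ext_rate lam n i j s \<le> enn2real (total_rate lam n i s)"
    using enn2real_mono[OF ext_rate_le_total[of i j s]] ext_rate_nonneg[OF rates, of i n j s] by simp
  moreover have "0 \<le> enn2real (total_rate lam n i s)" by simp
  ultimately show ?thesis unfolding kernel_def by (simp add: divide_le_eq_1 less_le)
next
  case False
  then show ?thesis unfolding kernel_def by (cases "total_rate lam n i s") auto
qed

text \<open>The division is undone wherever the total rate is finite, hence almost everywhere; if
  the total is 0, each single rate is 0 as well.\<close>

lemma AE_total_kernel:
  assumes i: "i \<in> states"
  shows "AE s in lborel. total_rate lam n i s * ennreal (kernel j i s) = ennreal (ext_rate lam n i j s)"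
proof -
  obtain C where C: "0 \<le> C" "AE y in lborel. \<forall>n. total_rate lam n i y \<le> ennreal C"
    using AE_total_rate_bounded[OF rates summable majorants i] by auto
  from C(2) show ?thesis
  proof eventually_elim
    case (elim s)
    then have "total_rate lam n i s \<noteq> \<top>" by (metis ennreal_neq_top neq_top_trans)
    then obtain r where r: "total_rate lam n i s = ennreal r" "0 \<le> r" by (cases "total_rate lam n i s") auto
    have "ext_rate lam n i j s \<le> r"
      using ext_rate_le_total[of i j s] ext_rate_nonneg[OF rates i] r by (simp add: ennreal_le_iff)
    then have "r * (ext_rate lam n i j s / r) = ext_rate lam n i j s"
      using ext_rate_nonneg[OF rates i, of n j s] r by (cases "r = 0") auto
    then show ?case
      using r ext_rate_nonneg[OF rates i, of n j s] i by (simp add: kernel_def flip: ennreal_mult)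
  qed
qed

text \<open>Split by the value of \<open>x\<close>: on \<open>x = i\<close> the holding density
  times the kernel is the rate of the single target times the survival probability, which is the
  density in \<open>law\<close>. For \<open>j = i\<close> both sides are 0.\<close>

lemma transition_law:
  assumes j: "j \<in> states" and D: "D \<in> sets (count_space UNIV \<Otimes>\<^sub>M borel)"
  shows "(\<integral>\<^sup>+\<omega>. indicator {\<omega>. (x \<omega>, H \<omega>) \<in> D} \<omega> * ennreal (kernel j (x \<omega>) (H \<omega>)) \<partial>M) =
    emeasure M {\<omega> \<in> space M. (x \<omega>, H \<omega>) \<in> D \<and> x' \<omega> = j}"
proof -
  have D1 [measurable]: "Pair i -` D \<in> sets borel" for i by (rule sets_Pair1[OF D])
  note D [measurable]
  have k1 [measurable]: "kernel j i \<in> borel_measurable borel" for i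
    using measurable_compose[OF measurable_Pair1' kernel_measurable, of i j] by simp
  let ?h = "\<lambda>i \<omega>. indicator {\<omega>. x \<omega> = i} \<omega> * (indicator (Pair i -` D) (H \<omega>) * ennreal (kernel j i (H \<omega>)))"
  let ?E = "\<lambda>i. {\<omega> \<in> space M. x \<omega> = i \<and> H \<omega> \<in> Pair i -` D \<and> x' \<omega> = j}"
  have E: "(\<integral>\<^sup>+\<omega>. ?h i \<omega> \<partial>M) = emeasure M (?E i)" for i
  proof (cases "i \<in> states")
    case i: True
    have "(\<integral>\<^sup>+\<omega>. ?h i \<omega> \<partial>M) =
      (\<integral>\<^sup>+s. total_rate lam n i s * survival i s * (indicator (Pair i -` D) s * ennreal (kernel j i s)) \<partial>lborel)"
      by (rule nn_integral_holding[OF i]) measurable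
    also have "\<dots> = (\<integral>\<^sup>+s. ennreal (ext_rate lam n i j s) * indicator (Pair i -` D) s * survival i s \<partial>lborel)"
    proof (rule nn_integral_cong_AE)
      show "AE s in lborel. total_rate lam n i s * survival i s * (indicator (Pair i -` D) s * ennreal (kernel j i s)) =
        ennreal (ext_rate lam n i j s) * indicator (Pair i -` D) s * survival i s"
        using AE_total_kernel[OF i, of j]
      proof eventually_elim
        case (elim s)
        show ?case unfolding elim[symmetric] by (simp add: mult_ac)
      qed
    qed
    also have "\<dots> = emeasure M (?E i)"
    proof (cases "j = i")
      case True
      have "AE \<omega> in M. \<not> (x \<omega> = i \<and> H \<omega> \<in> Pair i -` D \<and> x' \<omega> = j)"
        using AE_step by eventually_elim (use True in auto)
      then have "emeasure M (?E i) = 0" by (rule emeasure_eq_0_AE)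
      moreover have "ext_rate lam n i j s = 0" for s using True unfolding ext_rate_def by auto
      ultimately show ?thesis by simp
    next
      case False
      then show ?thesis using law[OF i, of j "Pair i -` D"] j by (simp add: survival_def)
    qed
    finally show ?thesis .
  next
    case False
    have "AE \<omega> in M. \<not> (x \<omega> = i \<and> H \<omega> \<in> Pair i -` D \<and> x' \<omega> = j)"
        using AE_step by eventually_elim (use False in auto)
    then have "emeasure M (?E i) = 0" by (rule emeasure_eq_0_AE)
    with False show ?thesis by (simp add: kernel_def)
  qed
  have "(\<integral>\<^sup>+\<omega>. indicator {\<omega>. (x \<omega>, H \<omega>) \<in> D} \<omega> * ennreal (kernel j (x \<omega>) (H \<omega>)) \<partial>M) =
      (\<integral>\<^sup>+\<omega>. (\<Sum>i. ?h i \<omega>) \<partial>M)"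
  proof (rule nn_integral_cong)
    fix \<omega>
    have "(\<Sum>i. ?h i \<omega>) =
      (\<Sum>i\<in>{x \<omega>}. ?h i \<omega>)"
      by (rule suminf_finite) auto
    then show "indicator {\<omega>. (x \<omega>, H \<omega>) \<in> D} \<omega> * ennreal (kernel j (x \<omega>) (H \<omega>)) =
      (\<Sum>i. ?h i \<omega>)"
      by (simp add: indicator_def)
  qed
  also have "\<dots> = (\<Sum>i. emeasure M (?E i))"
    unfolding E[symmetric] by (rule nn_integral_suminf) measurable
  also have "\<dots> = emeasure M (\<Union>i. ?E i)"
    by (rule suminf_emeasure) (auto simp: disjoint_family_on_def)
  also have "(\<Union>i. ?E i) = {\<omega> \<in> space M. (x \<omega>, H \<omega>) \<in> D \<and> x' \<omega> = j}" by auto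
  finally show ?thesis .
qed

text \<open>Events of the conditioning sigma-algebra are preimages of sets \<open>D\<close> under
  \<open>(x, H)\<close>, so \<open>transition_law\<close> is the defining identity of conditional
  expectation for the bounded kernel.\<close>

theorem transition_cond_exp:
  assumes j: "j \<in> states"
  shows "AE \<omega> in M. j \<noteq> x \<omega> \<longrightarrow> trans_prob lam (x \<omega>) j (H \<omega>) n =
    real_cond_exp M (vimage_algebra (space M) (\<lambda>\<omega>. (x \<omega>, H \<omega>)) (count_space UNIV \<Otimes>\<^sub>M borel))
      (indicator {\<omega> \<in> space M. x' \<omega> = j}) \<omega>"
proof -
  let ?F = "vimage_algebra (space M) (\<lambda>\<omega>. (x \<omega>, H \<omega>)) (count_space UNIV \<Otimes>\<^sub>M borel)"
  have xH [measurable]: "(\<lambda>\<omega>. (x \<omega>, H \<omega>)) \<in> measurable M (count_space UNIV \<Otimes>\<^sub>M borel)" by measurable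
  have sub: "subalgebra M ?F"
    unfolding subalgebra_def using measurable_sets[OF xH]
    by (auto simp: sets_vimage_algebra2[OF measurable_space[OF xH, THEN funcsetI[rotated]]] space_pair_measure sets_vimage_algebra2)
  interpret finite_measure_subalgebra M ?F
    by (unfold_locales) (rule sub)
  let ?g = "\<lambda>\<omega>. kernel j (x \<omega>) (H \<omega>)"
  have g_F: "?g \<in> borel_measurable ?F"
  proof -
    have "(\<lambda>\<omega>. (x \<omega>, H \<omega>)) \<in> measurable ?F (count_space UNIV \<Otimes>\<^sub>M borel)"
      by (rule measurable_vimage_algebra1) (auto simp: space_pair_measure)
    from measurable_compose[OF this kernel_measurable] show ?thesis by simp
  qed
  have g_M: "?g \<in> borel_measurable M"
    using measurable_compose[OF xH kernel_measurable] by simp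
  have E: "{\<omega> \<in> space M. x' \<omega> = j} \<in> events" by measurable
  have int_g: "integrable M ?g"
    by (rule integrable_const_bound[of _ 1]) (use kernel_nonneg kernel_le_1 g_M in auto)
  have "AE \<omega> in M. real_cond_exp M ?F (indicator {\<omega> \<in> space M. x' \<omega> = j}) \<omega> = ?g \<omega>"
  proof (rule real_cond_exp_charact[OF _ _ int_g g_F])
    show "integrable M (indicator {\<omega> \<in> space M. x' \<omega> = j} :: _ \<Rightarrow> real)"
      using E by (simp add: integrable_indicator_iff less_top[symmetric])
    fix A assume A: "A \<in> sets ?F"
    then obtain D where D: "D \<in> sets (count_space UNIV \<Otimes>\<^sub>M borel)" "A = (\<lambda>\<omega>. (x \<omega>, H \<omega>)) -` D \<inter> space M"
      by (subst (asm) sets_vimage_algebra2) (auto simp: space_pair_measure)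
    have A_M: "A \<in> events" using A sub unfolding subalgebra_def by auto
    have "(LINT \<omega>:A|M. indicator {\<omega> \<in> space M. x' \<omega> = j} \<omega>) = (LINT \<omega>|M. indicator {\<omega> \<in> space M. (x \<omega>, H \<omega>) \<in> D \<and> x' \<omega> = j} \<omega> :: real)"
      unfolding set_lebesgue_integral_def
      by (rule Bochner_Integration.integral_cong) (auto simp: D(2) indicator_def)
    also have "\<dots> = prob {\<omega> \<in> space M. (x \<omega>, H \<omega>) \<in> D \<and> x' \<omega> = j}"
      by simp (intro arg_cong[where f=prob], auto)
    also have "\<dots> = enn2real (\<integral>\<^sup>+\<omega>. indicator {\<omega>. (x \<omega>, H \<omega>) \<in> D} \<omega> * ennreal (?g \<omega>) \<partial>M)"
      unfolding transition_law[OF j D(1)] by (simp add: measure_def)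
    also have "\<dots> = enn2real (\<integral>\<^sup>+\<omega>. ennreal (indicator A \<omega> * ?g \<omega>) \<partial>M)"
      by (intro arg_cong[where f=enn2real] nn_integral_cong) (auto simp: D(2) indicator_def)
    also have "\<dots> = (LINT \<omega>:A|M. ?g \<omega>)"
      unfolding set_lebesgue_integral_def
      using g_M A_M by (subst integral_eq_nn_integral) (auto simp: kernel_nonneg)
    finally show "(LINT \<omega>:A|M. indicator {\<omega> \<in> space M. x' \<omega> = j} \<omega>) = (LINT \<omega>:A|M. ?g \<omega>)" .
  qed
  with AE_step show ?thesis
  proof eventually_elim
    case (elim \<omega>)
    then show ?case using kernel_trans_prob[of "x \<omega>" j "H \<omega>"] j by auto
  qed
qed

end

subsection \<open>The theorem\<close>

text \<open>The two sets differ inside a null set, all of whose subsets are measurable.\<close>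

lemma (in complete_measure) sets_cong_AE:
  assumes "E' \<in> sets M" "E \<subseteq> space M" "AE \<omega> in M. \<omega> \<in> E \<longleftrightarrow> \<omega> \<in> E'"
  shows "E \<in> sets M"
proof -
  obtain N where N: "{\<omega> \<in> space M. \<not> (\<omega> \<in> E \<longleftrightarrow> \<omega> \<in> E')} \<subseteq> N" "emeasure M N = 0" "N \<in> sets M"
    using assms(3) by (rule AE_E)
  then have "E \<inter> N \<in> sets M" by (intro complete[of _ N]) auto
  moreover have "E = (E' - N) \<union> (E \<inter> N)" using N(1) assms(2) sets.sets_into_space[OF assms(1)] by auto
  ultimately show ?thesis using assms(1) N(3) by (metis sets.Diff sets.Un)
qed

text \<open>The conditions of \<open>sde_flow\<close> concern every outcome, so the space is cut
  down to outcomes whose path solves the equation, whose boxes have finite counts and whose vertical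
  lines at positive times carry mass at most 1.\<close>

lemma sde_flow_on_full_set:
  fixes M :: "'a measure" and F :: "real \<Rightarrow> 'a measure"
    and P :: "'a \<Rightarrow> (real \<times> real) measure"
  assumes "prob_space M" and filt: "usual_filtration M F"
    and order: "strict_linear_order_on states ord"
    and rates: "rates lam" and summable: "rates_summable lam" and diverge: "rates_diverge lam"
    and majorants: "rate_majorants lam lamt" and wd: "Lambda_well_defined ord lamt"
    and poisson: "poisson_random_measure M half_plane P"
    and sol: "sde_solution M F ord lam lamt P X Y N"
    and indep: "initial_independent M P (X 0) (Y 0)"
  obtains \<Omega> G where "\<Omega> \<in> sets M" "AE \<omega> in M. \<omega> \<in> \<Omega>"
    "sde_flow (restrict_space M \<Omega>) G P ord lam lamt X Y N"
proof -
  interpret prob_space M by fact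
  let ?V = "vimage_algebra (space M) (\<lambda>\<omega>. (X 0 \<omega>, Y 0 \<omega>)) (count_space states \<Otimes>\<^sub>M restrict_space borel {0..})"
  interpret I: poisson_initial M P "sets ?V"
  proof unfold_locales
    show "indep_set (sets ?V) (sets (vimage_algebra (space M) (\<lambda>\<omega>. \<lambda>A\<in>sets half_plane. emeasure (P \<omega>) A)
          (Pi\<^sub>M (sets half_plane) (\<lambda>_. borel))))"
      using indep unfolding initial_independent_def .
    show "space M \<in> sets ?V" using sets.top[of ?V] by simp
  qed (auto simp: poisson intro: sets.Int_stable)
  have space_F: "space (F t) = space M" for t
    using filt filtration.space_F[of "space M" F] unfolding usual_filtration_def by auto
  have X_meas: "X t \<in> measurable (F t) (count_space states)" and Y_meas: "Y t \<in> measurable (F t) (restrict_space borel {0..})"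
    if "0 \<le> t" for t using sol that unfolding sde_solution_def by auto
  have X_states: "X t \<omega> \<in> states" if "0 \<le> t" "\<omega> \<in> space M" for t \<omega>
    using measurable_space[OF X_meas[OF that(1)]] that by (simp add: space_F)
  have Y_nonneg: "0 \<le> Y t \<omega>" if "0 \<le> t" "\<omega> \<in> space M" for t \<omega>
    using measurable_space[OF Y_meas[OF that(1)]] that by (simp add: space_F space_restrict_space)
  let ?good = "\<lambda>\<omega>. (cadlag (\<lambda>t. X t \<omega>) \<and> cadlag (\<lambda>t. Y t \<omega>) \<and> cadlag (\<lambda>t. N t \<omega>) \<and>
        solves_path ord lam lamt (P \<omega>) (\<lambda>t. X t \<omega>) (\<lambda>t. Y t \<omega>) (\<lambda>t. N t \<omega>)) \<and>
      (\<forall>K::nat. emeasure (P \<omega>) ({0<..real K} \<times> {- real K..real K}) < \<infinity>) \<and>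
      (\<forall>u>0. emeasure (P \<omega>) ({u} \<times> UNIV) \<le> 1)"
  have "AE \<omega> in M. cadlag (\<lambda>t. X t \<omega>) \<and> cadlag (\<lambda>t. Y t \<omega>) \<and> cadlag (\<lambda>t. N t \<omega>) \<and>
        solves_path ord lam lamt (P \<omega>) (\<lambda>t. X t \<omega>) (\<lambda>t. Y t \<omega>) (\<lambda>t. N t \<omega>)"
    using sol unfolding sde_solution_def by auto
  then have "AE \<omega> in M. ?good \<omega>"
    using I.AE_boxes_finite I.AE_P_simple by eventually_elim auto
  then obtain Z where Z: "{\<omega> \<in> space M. \<not> ?good \<omega>} \<subseteq> Z" "emeasure M Z = 0" "Z \<in> sets M" by (rule AE_E)
  define \<Omega> where "\<Omega> = space M - Z"
  have \<Omega>: "\<Omega> \<in> sets M" "\<Omega> \<subseteq> space M" using Z(3) unfolding \<Omega>_def by auto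
  have good: "?good \<omega>" if "\<omega> \<in> \<Omega>" for \<omega> using that Z(1) unfolding \<Omega>_def by blast
  have "AE \<omega> in M. \<omega> \<notin> Z" using Z by (intro AE_not_in) auto
  then have AE_\<Omega>: "AE \<omega> in M. \<omega> \<in> \<Omega>" using AE_space by eventually_elim (auto simp: \<Omega>_def)
  define M0 where "M0 = restrict_space M \<Omega>"
  have space_M0: "space M0 = \<Omega>" unfolding M0_def using \<Omega> by (simp add: space_restrict_space Int_absorb2)
  define S where "S t = sigma (space M) (I.history t)" for t
  have hist_Pow: "I.history t \<subseteq> Pow (space M)" for t using I.history_events sets.space_closed by blast
  have S: "space (S t) = space M" "sets (S t) = sigma_sets (space M) (I.history t)" for t
    unfolding S_def using hist_Pow by (simp_all add: space_measure_of sets_measure_of)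
  \<comment> \<open>Each event of the trace on \<open>\<Omega>\<close> comes from an event of the
    history with the same probability, so the compensator identity carries over.\<close>
  define G where "G t = restrict_space (S t) \<Omega>" for t
  have G_sets: "sets (G t) = (\<inter>) \<Omega> ` sets (S t)" for t unfolding G_def by (rule sets_restrict_space)
  have S_M: "sets (S t) \<subseteq> sets M" for t unfolding S using I.history_events sets.sigma_sets_subset by blast
  have cm: "compensated_measure M0 G P"
  proof (rule compensated_measure.intro[OF _ compensated_measure_axioms.intro])
    show "prob_space M0"
      unfolding M0_def using \<Omega>(1) emeasure_eq_1_AE[OF \<Omega>(1) AE_\<Omega>] by (rule prob_space_restrict_space)
    show "space (G t) = space M0" for t
      unfolding G_def space_M0 using \<Omega> by (simp add: space_restrict_space S Int_absorb2)
    show "sets (G t) \<subseteq> sets M0" for t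
      unfolding G_sets unfolding M0_def sets_restrict_space using S_M by blast
    show "sets (G s) \<subseteq> sets (G t)" if "s \<le> t" for s t
    proof -
      have "sets (S s) \<subseteq> sets (S t)" unfolding S by (rule sigma_sets_mono') (rule I.history_mono[OF that])
      then show ?thesis unfolding G_sets by blast
    qed
    show "sets (P \<omega>) = sets half_plane" if "\<omega> \<in> space M0" for \<omega>
      using that \<Omega> I.sets_P unfolding space_M0 by auto
    show "emeasure (P \<omega>) ({0<..real K} \<times> {- real K..real K}) < \<infinity>" if "\<omega> \<in> space M0" for \<omega> K
      using good[of \<omega>] that unfolding space_M0 by blast
    show "(\<lambda>\<omega>. emeasure (P \<omega>) B) \<in> borel_measurable (G t)"
      if B: "0 \<le> t" "B \<in> sets half_plane" "B \<subseteq> {0<..t} \<times> UNIV" for t B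
    proof -
      have "(\<lambda>\<omega>. emeasure (P \<omega>) B) \<in> borel_measurable (S t)"
      proof (rule measurableI)
        fix E :: "ennreal set" assume E: "E \<in> sets borel"
        have "{\<omega> \<in> space M. emeasure (P \<omega>) B \<in> E} \<in> I.history t"
          by (rule I.cylinders_history[OF I.cylinders_single[OF B(2,3) E]])
        moreover have "(\<lambda>\<omega>. emeasure (P \<omega>) B) -` E \<inter> space (S t) = {\<omega> \<in> space M. emeasure (P \<omega>) B \<in> E}"
          by (auto simp: S)
        ultimately show "(\<lambda>\<omega>. emeasure (P \<omega>) B) -` E \<inter> space (S t) \<in> sets (S t)" by (auto simp: S)
      qed simp
      then show ?thesis unfolding G_def by (rule measurable_restrict_space1)
    qed
    show "(\<integral>\<^sup>+\<omega>\<in>A. emeasure (P \<omega>) B \<partial>M0) = emeasure M0 A * emeasure half_plane B"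
      if B: "0 \<le> s" "A \<in> sets (G s)" "B \<in> sets half_plane" "B \<subseteq> {s<..} \<times> UNIV" "emeasure half_plane B < \<infinity>" for s A B
    proof -
      obtain A' where A': "A' \<in> sets (S s)" "A = \<Omega> \<inter> A'" using B(2) unfolding G_sets by blast
      have "(\<integral>\<^sup>+\<omega>\<in>A. emeasure (P \<omega>) B \<partial>M0) = (\<integral>\<^sup>+\<omega>. emeasure (P \<omega>) B * indicator A \<omega> * indicator \<Omega> \<omega> \<partial>M)"
        unfolding M0_def using \<Omega> by (subst nn_integral_restrict_space) auto
      also have "\<dots> = (\<integral>\<^sup>+\<omega>\<in>A'. emeasure (P \<omega>) B \<partial>M)"
        by (rule nn_integral_cong_AE) (use AE_\<Omega> in \<open>eventually_elim, auto simp: A'(2) indicator_def\<close>)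
      also have "\<dots> = emeasure M A' * emeasure half_plane B"
        by (rule I.nn_integral_history[OF _ B(3) _ B(5)]) (use A'(1) B(4) S in auto)
      also have "emeasure M A' = emeasure M A"
        by (rule emeasure_eq_AE) (use AE_\<Omega> A' S_M \<Omega> in \<open>auto elim!: eventually_mono\<close>)
      also have "\<dots> = emeasure M0 A"
        unfolding M0_def using \<Omega> A'(2) by (subst emeasure_restrict_space) auto
      finally show ?thesis .
    qed
  qed
  have "sde_flow M0 G P ord lam lamt X Y N"
  proof (rule sde_flow.intro[OF cm], rule sde_flow_axioms.intro)
    show "sde_path ord lam lamt (P \<omega>) (\<lambda>t. X t \<omega>) (\<lambda>t. Y t \<omega>) (\<lambda>t. N t \<omega>)" if "\<omega> \<in> space M0" for \<omega>
    proof -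
      have \<omega>: "\<omega> \<in> \<Omega>" "\<omega> \<in> space M" using that \<Omega> unfolding space_M0 by auto
      show ?thesis
        by unfold_locales
          (use rates majorants order good[OF \<omega>(1)] \<omega>(2) I.sets_P I.P_int X_states Y_nonneg in \<open>simp_all, blast?\<close>)
    qed
    show "{\<omega> \<in> space M0. X 0 \<omega> = i \<and> a \<le> Y 0 \<omega>} \<in> sets (G 0)" for i a
    proof -
      have "{\<omega> \<in> space M. X 0 \<omega> = i \<and> a \<le> Y 0 \<omega>} \<in> sets ?V"
      proof (cases "i \<in> states")
        case True
        have "{i} \<times> ({0..} \<inter> {a..}) \<in> sets (count_space states \<Otimes>\<^sub>M restrict_space borel {0..})"
          using True by (intro pair_measureI) (auto simp: sets_restrict_space)
        then have "(\<lambda>\<omega>. (X 0 \<omega>, Y 0 \<omega>)) -` ({i} \<times> ({0..} \<inter> {a..})) \<inter> space M \<in> sets ?V"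
          by (rule in_vimage_algebra)
        also have "(\<lambda>\<omega>. (X 0 \<omega>, Y 0 \<omega>)) -` ({i} \<times> ({0..} \<inter> {a..})) \<inter> space M = {\<omega> \<in> space M. X 0 \<omega> = i \<and> a \<le> Y 0 \<omega>}"
          using Y_nonneg[of 0] by auto
        finally show ?thesis .
      next
        case False
        then have "{\<omega> \<in> space M. X 0 \<omega> = i \<and> a \<le> Y 0 \<omega>} = {}" using X_states[of 0] by auto
        then show ?thesis by (simp only: sets.empty_sets)
      qed
      then have "{\<omega> \<in> space M. X 0 \<omega> = i \<and> a \<le> Y 0 \<omega>} \<in> sets (S 0)"
        unfolding S by (intro sigma_sets.Basic I.init_history)
      moreover have "{\<omega> \<in> space M0. X 0 \<omega> = i \<and> a \<le> Y 0 \<omega>} = \<Omega> \<inter> {\<omega> \<in> space M. X 0 \<omega> = i \<and> a \<le> Y 0 \<omega>}"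
        using \<Omega> unfolding space_M0 by auto
      ultimately show ?thesis unfolding G_sets by blast
    qed
  qed (rule rates majorants order summable diverge wd)+
  then show thesis using that[OF \<Omega>(1) AE_\<Omega>] unfolding M0_def by blast
qed

theorem theorem3p2:
  fixes M :: "'a measure" and F :: "real \<Rightarrow> 'a measure"
    and ord :: "(nat \<times> nat) set"
    and lam lamt :: "nat \<Rightarrow> nat \<Rightarrow> real \<Rightarrow> nat \<Rightarrow> real"
    and P :: "'a \<Rightarrow> (real \<times> real) measure"
    and X :: "real \<Rightarrow> 'a \<Rightarrow> nat" and Y :: "real \<Rightarrow> 'a \<Rightarrow> real" and N :: "real \<Rightarrow> 'a \<Rightarrow> nat"
    and i n :: nat and y :: real
  assumes "prob_space M" and "usual_filtration M F"
    and "strict_linear_order_on states ord"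
    and "rates lam" and "rates_summable lam" and "rates_diverge lam"
    and "rate_majorants lam lamt" and "Lambda_well_defined ord lamt"
    and "poisson_random_measure M half_plane P" and "random_measure_adapted F P"
    and "sde_solution M F ord lam lamt P X Y N"
    and "initial_independent M P (X 0) (Y 0)"
    and "i \<in> states" and "0 \<le> y" and "1 \<le> n"
  shows "(0 < \<P>(\<omega> in M. post_jump_state X n \<omega> = i) \<longrightarrow>
            \<P>(\<omega> in M. holding_time X n \<omega> \<le> y \<bar> post_jump_state X n \<omega> = i) = holding_cdf lam y i n) \<and>
         (\<forall>j\<in>states. AE \<omega> in M. j \<noteq> post_jump_state X n \<omega> \<longrightarrow>
            trans_prob lam (post_jump_state X n \<omega>) j (holding_time X n \<omega>) n =
            real_cond_exp M
              (vimage_algebra (space M) (\<lambda>\<omega>. (post_jump_state X n \<omega>, holding_time X n \<omega>))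
                 (count_space UNIV \<Otimes>\<^sub>M borel))
              (indicator {\<omega> \<in> space M. post_jump_state X (Suc n) \<omega> = j}) \<omega>)"
proof -
  let ?x = "post_jump_state X n" and ?x' = "post_jump_state X (Suc n)" and ?H = "holding_time X n"
  interpret prob_space M by fact
  interpret complete_measure M using assms(2) unfolding usual_filtration_def by simp
  obtain \<Omega> G where \<Omega>: "\<Omega> \<in> sets M" and AE_\<Omega>: "AE \<omega> in M. \<omega> \<in> \<Omega>"
    and flow: "sde_flow (restrict_space M \<Omega>) G P ord lam lamt X Y N"
    by (rule sde_flow_on_full_set[OF assms(1-9,11,12)])
  let ?R = "restrict_space M \<Omega>"
  interpret flow: sde_flow ?R G P ord lam lamt X Y N by (rule flow)
  have \<Omega>_sub: "\<Omega> \<subseteq> space M" using \<Omega> by (rule sets.sets_into_space)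
  have space0: "space ?R = \<Omega>" using \<Omega>_sub by (simp add: space_restrict_space Int_absorb2)
  have sets0: "A \<in> sets M" if "A \<in> sets ?R" for A
    using that \<Omega> by (auto simp: sets_restrict_space)
  have em0: "emeasure ?R {\<omega> \<in> \<Omega>. Q \<omega>} = emeasure M {\<omega> \<in> \<Omega>. Q \<omega>}" for Q
    using \<Omega> by (intro emeasure_restrict_space) auto
  have AE_good: "AE \<omega> in M. \<omega> \<in> \<Omega> \<and> (\<forall>k. flow.reached k \<omega>)"
    using flow.AE_reached AE_\<Omega> \<Omega> by (subst (asm) AE_restrict_space_iff) auto
  have T: "jump_time (\<lambda>t. X t \<omega>) k = flow.T k \<omega>" if "\<omega> \<in> \<Omega> \<and> (\<forall>k. flow.reached k \<omega>)" for \<omega> k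
    using flow.jump_time_eq that by (simp add: space0)
  have xs: "post_jump_state X k \<omega> = flow.xs k \<omega>" if "\<omega> \<in> \<Omega> \<and> (\<forall>k. flow.reached k \<omega>)" for \<omega> k
    unfolding post_jump_state_def flow.xs_def T[OF that] ..
  have hold: "holding_time X k \<omega> = flow.hold k \<omega>" if "\<omega> \<in> \<Omega> \<and> (\<forall>k. flow.reached k \<omega>)" for \<omega> k
    unfolding holding_time_def flow.hold_def T[OF that] ..
  \<comment> \<open>\<open>post_jump_state\<close> reads \<open>X\<close> at a random time and
    agrees with the measurable \<open>flow.xs\<close> only almost surely; completeness of
    \<open>M\<close> turns this into measurability.\<close>
  have x_meas: "post_jump_state X k \<in> measurable M (count_space UNIV)" for k
  proof (subst measurable_count_space_eq2_countable, safe)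
    fix m
    show "post_jump_state X k -` {m} \<inter> space M \<in> events"
    proof (rule sets_cong_AE)
      show "{\<omega> \<in> \<Omega>. flow.reached k \<omega> \<and> flow.xs k \<omega> = m} \<in> events"
        using sets0[OF flow.reached_state_events[of k m]] unfolding space0 .
      show "AE \<omega> in M. \<omega> \<in> post_jump_state X k -` {m} \<inter> space M \<longleftrightarrow> \<omega> \<in> {\<omega> \<in> \<Omega>. flow.reached k \<omega> \<and> flow.xs k \<omega> = m}"
        using AE_good AE_space by eventually_elim (auto simp: xs)
    qed auto
  qed auto
  have H_meas: "holding_time X k \<in> borel_measurable M" for k
  proof (rule borel_measurableI_le)
    fix a
    show "{\<omega> \<in> space M. holding_time X k \<omega> \<le> a} \<in> events"
    proof (rule sets_cong_AE)
      have "{\<omega> \<in> space ?R. flow.hold k \<omega> \<le> a} \<in> sets ?R"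
        using flow.hold_measurable[of k] by measurable
      from sets0[OF this] show "{\<omega> \<in> \<Omega>. flow.hold k \<omega> \<le> a} \<in> events" unfolding space0 .
      show "AE \<omega> in M. \<omega> \<in> {\<omega> \<in> space M. holding_time X k \<omega> \<le> a} \<longleftrightarrow> \<omega> \<in> {\<omega> \<in> \<Omega>. flow.hold k \<omega> \<le> a}"
        using AE_good AE_space by eventually_elim (auto simp: hold)
    qed auto
  qed
  note [measurable] = x_meas H_meas
  \<comment> \<open>The law found on the restricted space is transported to \<open>M\<close>: the
    events on both sides agree almost surely with those of the flow.\<close>
  interpret step: renewal_step M lam lamt n ?x ?H ?x'
  proof unfold_locales
    show "AE \<omega> in M. ?x \<omega> \<in> states \<and>
        ?x' \<omega> \<in> states - {?x \<omega>} \<and> 0 < ?H \<omega>"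
      using AE_good
    proof eventually_elim
      case (elim \<omega>)
      then show ?case
        using flow.xs_states[of \<omega> n] flow.xs_Suc[of \<omega> n] flow.T_less[of \<omega> n]
        by (simp add: xs hold space0 flow.hold_def)
    qed
  next
    fix i j and A :: "real set" assume i: "i \<in> states" and j: "j \<in> states - {i}" and A [measurable]: "A \<in> sets borel"
    let ?E = "{\<omega> \<in> space M. ?x \<omega> = i \<and> ?H \<omega> \<in> A \<and> ?x' \<omega> = j}"
    let ?Eflow = "{\<omega> \<in> \<Omega>. flow.xs n \<omega> = i \<and> flow.reached (Suc n) \<omega> \<and> flow.hold n \<omega> \<in> A \<and> flow.xs (Suc n) \<omega> = j}"
    let ?Dflow = "\<lambda>s. {\<omega> \<in> \<Omega>. flow.reached n \<omega> \<and> flow.xs n \<omega> = i \<and> s \<le> flow.hold n \<omega>}"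
    have survival: "emeasure M {\<omega> \<in> space M. ?x \<omega> = i \<and> s \<le> ?H \<omega>} = emeasure ?R (?Dflow s)" for s
      unfolding em0
    proof (rule emeasure_eq_AE)
      show "AE \<omega> in M. \<omega> \<in> {\<omega> \<in> space M. ?x \<omega> = i \<and> s \<le> ?H \<omega>} \<longleftrightarrow> \<omega> \<in> ?Dflow s"
        using AE_good AE_space by eventually_elim (auto simp: xs hold)
      have "{\<omega> \<in> space ?R. s \<le> flow.hold n \<omega>} \<in> sets ?R"
        using flow.hold_measurable[of n] by measurable
      from sets0[OF sets.Int[OF flow.reached_state_events[of n i] this]]
      have "{\<omega> \<in> \<Omega>. flow.reached n \<omega> \<and> flow.xs n \<omega> = i} \<inter> {\<omega> \<in> \<Omega>. s \<le> flow.hold n \<omega>} \<in> events"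
        unfolding space0 .
      also have "{\<omega> \<in> \<Omega>. flow.reached n \<omega> \<and> flow.xs n \<omega> = i} \<inter> {\<omega> \<in> \<Omega>. s \<le> flow.hold n \<omega>} = ?Dflow s" by auto
      finally show "?Dflow s \<in> events" .
    qed measurable
    have "emeasure M ?E = emeasure ?R ?Eflow"
      unfolding em0
    proof (rule emeasure_eq_AE)
      show ae: "AE \<omega> in M. \<omega> \<in> ?E \<longleftrightarrow> \<omega> \<in> ?Eflow"
        using AE_good AE_space by eventually_elim (auto simp: xs hold)
      show E: "?E \<in> events"
        by measurable
      show "?Eflow \<in> events"
      proof (rule sets_cong_AE[OF E])
        show "AE \<omega> in M. \<omega> \<in> ?Eflow \<longleftrightarrow> \<omega> \<in> ?E"
          using ae by eventually_elim blast
      qed (use \<Omega>_sub in auto)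
    qed
    then show "emeasure M ?E =
      (\<integral>\<^sup>+s. ennreal (ext_rate lam n i j s) * indicator A s *
        emeasure M {\<omega> \<in> space M. ?x \<omega> = i \<and> s \<le> ?H \<omega>} \<partial>lborel)"
      using flow.holding_law[OF i j A assms(15)] unfolding survival space0 by simp
  qed (rule x_meas H_meas assms)+
  show ?thesis
    using step.holding_cdf[OF assms(13,14)] step.transition_cond_exp by blast
qed

end
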